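(* Let $u$ and $v$ be real-valued locally semiconvex functions on an open set $X\subset\mathbb{R}^n$, and suppose that the sum $w=u+v$ has an upper contact jet $(p,A)$ at $x\in X$. Then the following hold: (i) $x$ is an upper contact point for both summands $u$ and $v$ (which are therefore differentiable at $x$), and the upper contact jets of $u$ and $v$ at $x$ have first component $Du(x)$ and $Dv(x)$, respectively; (ii) for every set $E$ of full Lebesgue measure in a neighborhood of $x$, there exist $B,C\in\mathcal{S}(n)$ and a sequence $\{x_j\}_{j\in\mathbb{N}}$ of upper contact points for $w$, with $x_j\in E\cap\mathrm{Diff}^2u\cap\mathrm{Diff}^2v$ and $x_j\to x$ as $j\to\infty$, such that $$Du(x_j)\to Du(x),\qquad Dv(x_j)\to Dv(x),$$ $$D^2u(x_j)\to B,\qquad D^2v(x_j)\to C,\qquad\text{with } B+C\leq A.$$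
   Context: $\mathcal{S}(n)$ is the space of real symmetric $n\times n$ matrices with the Loewner order. A function $u:C\to\mathbb{R}$ on a convex set $C$ is $\lambda$-semiconvex ($\lambda\ge0$) if $u+\frac{\lambda}{2}|\cdot|^2$ is convex on $C$. $u$ is locally semiconvex on $X$ if every $x\in X$ belongs to some ball $B\subset X$ on which $u$ is $\lambda$-semiconvex for some $\lambda=\lambda(x)\geq 0$. $(p,A)\in\mathbb{R}^n\times\mathcal{S}(n)$ is an upper contact jet for $u$ at $x$, and $x$ is then called an upper contact point for $u$, if $u(y)\leq u(x)+\langle p,y-x\rangle+\frac12\langle A(y-x),y-x\rangle$ for all $y\in X$ near $x$. $\mathrm{Diff}^2u$ is the set of points $z$ at which $u$ is twice differentiable in the Peano sense, i.e. $u(y)=u(z)+\langle q,y-z\rangle+\frac12\langle B(y-z),y-z\rangle+o(|y-z|^2)$ as $y\to z$ for some (unique) $q=Du(z)\in\mathbb{R}^n$ and $B=D^2u(z)\in\mathcal{S}(n)$. *)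

theory Defs
  imports "HOL-Analysis.Analysis" "HOL-Library.Landau_Symbols"
begin

definition symmetric_matrix :: "real ^ 'n ^ 'n \<Rightarrow> bool" where
  "symmetric_matrix A \<longleftrightarrow> transpose A = A"

text \<open>The Loewner order; the library relation \<open>\<le>\<close> on matrices is the componentwise one.\<close>

definition loewner_le :: "real ^ 'n ^ 'n \<Rightarrow> real ^ 'n ^ 'n \<Rightarrow> bool"  (infix \<open>\<preceq>\<^sub>L\<close> 50) where
  "A \<preceq>\<^sub>L B \<longleftrightarrow> (\<forall>\<xi>. (A *v \<xi>) \<bullet> \<xi> \<le> (B *v \<xi>) \<bullet> \<xi>)"

definition semiconvex_on :: "real \<Rightarrow> (real ^ 'n) set \<Rightarrow> (real ^ 'n \<Rightarrow> real) \<Rightarrow> bool" where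
  "semiconvex_on \<mu> C u \<longleftrightarrow> 0 \<le> \<mu> \<and> convex_on C (\<lambda>x. u x + \<mu> / 2 * (norm x)\<^sup>2)"

definition locally_semiconvex_on :: "(real ^ 'n) set \<Rightarrow> (real ^ 'n \<Rightarrow> real) \<Rightarrow> bool" where
  "locally_semiconvex_on X u \<longleftrightarrow>
     (\<forall>x\<in>X. \<exists>c r \<mu>. x \<in> ball c r \<and> ball c r \<subseteq> X \<and> semiconvex_on \<mu> (ball c r) u)"

definition upper_contact_jet ::
    "(real ^ 'n) set \<Rightarrow> (real ^ 'n \<Rightarrow> real) \<Rightarrow> real ^ 'n \<Rightarrow> real ^ 'n \<Rightarrow> real ^ 'n ^ 'n \<Rightarrow> bool" where
  "upper_contact_jet X u x p A \<longleftrightarrow> x \<in> X \<and> symmetric_matrix A \<and>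
     (\<forall>\<^sub>F y in at x within X. u y \<le> u x + p \<bullet> (y - x) + 1 / 2 * ((A *v (y - x)) \<bullet> (y - x)))"

definition upper_contact_point ::
    "(real ^ 'n) set \<Rightarrow> (real ^ 'n \<Rightarrow> real) \<Rightarrow> real ^ 'n \<Rightarrow> bool" where
  "upper_contact_point X u x \<longleftrightarrow> (\<exists>p A. upper_contact_jet X u x p A)"

definition has_peano_jet ::
    "(real ^ 'n \<Rightarrow> real) \<Rightarrow> real ^ 'n \<Rightarrow> real ^ 'n \<Rightarrow> real ^ 'n ^ 'n \<Rightarrow> bool" where
  "has_peano_jet u z q B \<longleftrightarrow> symmetric_matrix B \<and>
     (\<lambda>y. u y - (u z + q \<bullet> (y - z) + 1 / 2 * ((B *v (y - z)) \<bullet> (y - z))))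
       \<in> o[at z](\<lambda>y. (norm (y - z))\<^sup>2)"

text \<open>Functions on \<open>X\<close> are total functions whose values off \<open>X\<close> are irrelevant. The limit
  \<open>y \<rightarrow> z\<close> in \<^const>\<open>has_peano_jet\<close> and the derivatives below are not restricted to \<open>X\<close>, so these
  notions are meant for open \<open>X\<close> only.\<close>

definition Diff2 :: "(real ^ 'n) set \<Rightarrow> (real ^ 'n \<Rightarrow> real) \<Rightarrow> (real ^ 'n) set" where
  "Diff2 X u = {z \<in> X. \<exists>q B. has_peano_jet u z q B}"

definition grad :: "(real ^ 'n \<Rightarrow> real) \<Rightarrow> real ^ 'n \<Rightarrow> real ^ 'n" where
  "grad u x = (THE q. GDERIV u x :> q)"

definition hess :: "(real ^ 'n \<Rightarrow> real) \<Rightarrow> real ^ 'n \<Rightarrow> real ^ 'n ^ 'n" where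
  "hess u z = (THE B. \<exists>q. has_peano_jet u z q B)"

text \<open>The descriptions above are well defined: a differentiable function has exactly one gradient,
  and a Peano jet is unique, its first component being the gradient.\<close>

lemma grad_eq:
  fixes u :: "real ^ 'n \<Rightarrow> real"
  assumes "GDERIV u x :> q"
  shows "grad u x = q"
  unfolding grad_def
proof (rule the_equality)
  show "GDERIV u x :> q" by (fact assms)
  fix q' assume "GDERIV u x :> q'"
  with assms have "(\<lambda>h. h \<bullet> q') = (\<lambda>h. h \<bullet> q)"
    unfolding gderiv_def by (rule has_derivative_unique[rotated])
  then have "\<And>h. h \<bullet> q' = h \<bullet> q" by meson
  then show "q' = q" by (metis vector_eq_ldot)
qed

lemma differentiable_GDERIV_grad:
  fixes u :: "real ^ 'n \<Rightarrow> real"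
  assumes "u differentiable (at x)"
  shows "GDERIV u x :> grad u x"
proof -
  obtain L where L: "(u has_derivative L) (at x)"
    using assms unfolding differentiable_def by blast
  then have "linear L"
    by (rule has_derivative_linear)
  then have "L = (\<lambda>h. h \<bullet> adjoint L 1)"
    using adjoint_works[of L] by (metis inner_real_def mult.right_neutral)
  with L have "GDERIV u x :> adjoint L 1"
    unfolding gderiv_def by metis
  with grad_eq show ?thesis
    by metis
qed

lemma has_peano_jet_GDERIV:
  fixes u :: "real ^ 'n \<Rightarrow> real"
  assumes "has_peano_jet u z q B"
  shows "GDERIV u z :> q"
proof -
  let ?R = "\<lambda>y. u y - (u z + q \<bullet> (y - z) + 1 / 2 * ((B *v (y - z)) \<bullet> (y - z)))"
  let ?Q = "\<lambda>y. (B *v (y - z)) \<bullet> (y - z)"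
  have small: "(\<lambda>y. (norm (y - z))\<^sup>2) \<in> o[at z](\<lambda>y. norm (y - z))"
  proof (rule smalloI_tendsto)
    have "((\<lambda>y. norm (y - z)) \<longlongrightarrow> 0) (at z)"
      by (rule tendsto_eq_intros refl | simp)+
    then show "((\<lambda>y. (norm (y - z))\<^sup>2 / norm (y - z)) \<longlongrightarrow> 0) (at z)"
      by (rule Lim_transform_eventually)
         (simp add: eventually_at_filter power2_eq_square)
    show "\<forall>\<^sub>F y in at z. norm (y - z) \<noteq> 0"
      by (simp add: eventually_at_filter)
  qed
  obtain K where K: "\<And>h. norm (B *v h) \<le> norm h * K"
    using bounded_linear.bounded[OF matrix_vector_mul_bounded_linear[of B]] by blast
  have "?Q \<in> O[at z](\<lambda>y. (norm (y - z))\<^sup>2)"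
  proof (rule bigoI[of _ K], rule always_eventually, rule allI)
    fix y
    have "norm (?Q y) \<le> norm (B *v (y - z)) * norm (y - z)"
      by (simp add: Cauchy_Schwarz_ineq2)
    also have "\<dots> \<le> (norm (y - z) * K) * norm (y - z)"
      by (intro mult_right_mono K) simp
    finally show "norm (?Q y) \<le> K * norm ((norm (y - z))\<^sup>2)"
      by (simp add: power2_eq_square mult_ac)
  qed
  then have "?Q \<in> o[at z](\<lambda>y. norm (y - z))"
    using small by (rule landau_o.big_small_trans)
  then have "(\<lambda>y. 1 / 2 * ?Q y) \<in> o[at z](\<lambda>y. norm (y - z))"
    by simp
  moreover have "?R \<in> o[at z](\<lambda>y. norm (y - z))"
    using assms small unfolding has_peano_jet_def by (blast intro: landau_o.small_trans)
  ultimately have "(\<lambda>y. ?R y + 1 / 2 * ?Q y) \<in> o[at z](\<lambda>y. norm (y - z))"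
    by (rule sum_in_smallo(1)[rotated])
  then have "((\<lambda>y. (?R y + 1 / 2 * ?Q y) / norm (y - z)) \<longlongrightarrow> 0) (at z)"
    by (rule smalloD_tendsto)
  then have "((\<lambda>y. norm ((?R y + 1 / 2 * ?Q y) / norm (y - z))) \<longlongrightarrow> 0) (at z)"
    by (rule tendsto_norm_zero)
  then have "((\<lambda>y. norm (u y - u z - (y - z) \<bullet> q) / norm (y - z)) \<longlongrightarrow> 0) (at z)"
    by (simp add: inner_commute algebra_simps)
  then show ?thesis
    unfolding gderiv_def has_derivative_iff_norm
    by (simp add: bounded_linear_inner_left)
qed

lemma has_peano_jet_unique:
  fixes u :: "real ^ 'n \<Rightarrow> real"
  assumes "has_peano_jet u z q B" "has_peano_jet u z q' B'"
  shows "q' = q \<and> B' = B"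
proof
  show q: "q' = q"
    using assms has_peano_jet_GDERIV grad_eq by metis
  define M where "M = B - B'"
  have M: "transpose M = M"
    using assms unfolding has_peano_jet_def symmetric_matrix_def M_def
    by (simp add: transpose_def vec_eq_iff)
  have "(\<lambda>y. (u y - (u z + q \<bullet> (y - z) + 1 / 2 * ((B' *v (y - z)) \<bullet> (y - z))))
       - (u y - (u z + q \<bullet> (y - z) + 1 / 2 * ((B *v (y - z)) \<bullet> (y - z)))))
       \<in> o[at z](\<lambda>y. (norm (y - z))\<^sup>2)"
    using assms unfolding has_peano_jet_def q by (elim conjE) (rule sum_in_smallo(2))
  then have o: "((\<lambda>y. (1 / 2 * ((M *v (y - z)) \<bullet> (y - z))) / (norm (y - z))\<^sup>2) \<longlongrightarrow> 0) (at z)"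
    unfolding M_def
    by (intro smalloD_tendsto)
       (simp add: matrix_vector_mult_diff_rdistrib inner_diff_left algebra_simps)
  have zero: "(M *v e) \<bullet> e = 0" for e
  proof (cases "e = 0")
    case False
    have lim: "filterlim (\<lambda>t::real. z + t *\<^sub>R e) (at z) (at_right 0)"
      unfolding filterlim_at
    proof
      show "\<forall>\<^sub>F t in at_right 0. z + t *\<^sub>R e \<in> UNIV \<and> z + t *\<^sub>R e \<noteq> z"
        using False by (simp add: eventually_at_filter)
      show "((\<lambda>t. z + t *\<^sub>R e) \<longlongrightarrow> z) (at_right 0)"
        by (rule tendsto_eq_intros refl | simp)+
    qed
    have "((\<lambda>t::real. (1 / 2 * ((M *v (t *\<^sub>R e)) \<bullet> (t *\<^sub>R e))) / (norm (t *\<^sub>R e))\<^sup>2) \<longlongrightarrow> 0) (at_right 0)"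
      using filterlim_compose[OF o lim] by simp
    moreover have "\<forall>\<^sub>F t::real in at_right 0.
       (1 / 2 * ((M *v (t *\<^sub>R e)) \<bullet> (t *\<^sub>R e))) / (norm (t *\<^sub>R e))\<^sup>2
         = (1 / 2 * ((M *v e) \<bullet> e)) / (norm e)\<^sup>2"
      unfolding eventually_at_filter
      by (simp add: matrix_vector_mult_scaleR power_mult_distrib power2_eq_square)
    ultimately have "((\<lambda>t::real. (1 / 2 * ((M *v e) \<bullet> e)) / (norm e)\<^sup>2) \<longlongrightarrow> 0) (at_right 0)"
      by (rule Lim_transform_eventually)
    then show ?thesis
      using False by (simp add: tendsto_const_iff)
  qed simp
  have "(M *v a) \<bullet> b = 0" for a b
  proof -
    have "(M *v b) \<bullet> a = (M *v a) \<bullet> b"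
      using M by (metis dot_lmul_matrix inner_commute transpose_matrix_vector)
    then show ?thesis
      using zero[of "a + b"] zero[of a] zero[of b]
      by (simp add: matrix_vector_right_distrib inner_add_left inner_add_right)
  qed
  then have "M *v a = 0" for a
    by (metis inner_eq_zero_iff)
  then have "M = 0"
    by (metis matrix_eq matrix_vector_mult_0)
  then show "B' = B" by (simp add: M_def)
qed

lemma has_peano_jet_grad_hess:
  fixes u :: "real ^ 'n \<Rightarrow> real"
  assumes "has_peano_jet u z q B"
  shows "grad u z = q" "hess u z = B"
proof -
  show "grad u z = q"
    using assms by (intro grad_eq has_peano_jet_GDERIV)
  show "hess u z = B"
    unfolding hess_def using assms has_peano_jet_unique by blast
qed

end

theory Submission
  imports Defs
begin

text \<open>
Part (i) is elementary. A semiconvex function has, at each point, a paraboloid that touches it from below.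
Subtracting such a paraboloid of \<open>v\<close> from the one that touches \<open>u + v\<close> from above at \<open>x\<close> yields a
paraboloid that touches \<open>u\<close> from above at \<open>x\<close>. A function enclosed by two touching paraboloids is
differentiable at the point of contact, with their common slope as gradient
(\<open>upper_contact_jet_summand\<close>, \<open>upper_contact_jet_GDERIV\<close>).

Part (ii) combines two theorems on semiconvex functions. Alexandrov's theorem
(\<open>convex_has_peano_jet_ae\<close>) says that \<open>u\<close> and \<open>v\<close> have second-order expansions almost everywhere near
\<open>x\<close>. Jensen's lemma (\<open>jensen_contact_points_not_negligible\<close>) says that the points near \<open>x\<close> at
which \<open>u + v\<close> has an upper contact jet with the matrix \<open>A + \<epsilon> I\<close> do not form a null set. So for each
\<open>\<epsilon> > 0\<close> some of these points, as close to \<open>x\<close> as desired, belong to \<open>E\<close> and admit both expansions. There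
the sum of the Hessians is at most \<open>A + \<epsilon> I\<close>, while each Hessian is bounded from below by semiconvexity.
By compactness the Hessians converge along a sequence with \<open>\<epsilon>\<close> tending to 0. The gradients converge because
of a Lipschitz estimate for slopes of touching paraboloids (\<open>contact_gradient_lipschitz\<close>), which also
drives Jensen's lemma.

Alexandrov's theorem is proved through the inverse of the gradient. For a strongly convex \<open>F\<close>, the map that
sends \<open>p\<close> to the minimizer of \<open>F - p \<bullet> (.)\<close> is Lipschitz. By Rademacher's theorem it is
differentiable almost everywhere, by Sard's theorem its critical values are null, and at its regular values
the gradient of \<open>F\<close> has a first-order expansion, which integrates to a second-order expansion of \<open>F\<close>.

Rademacher's theorem in turn rests on the case of one variable, proved with Vitali coverings. The directional
derivatives exist almost everywhere along all lines; that they depend linearly on the direction is verified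
in the mean over boxes.
\<close>

section \<open>Differentiability of Lipschitz functions of one real variable\<close>

text \<open>Outer regularity in the form needed for covering arguments: the outer measure of an arbitrary set
may be estimated from below by testing open supersets, inside which small balls can be chosen.\<close>

lemma outer_measure_lebesgue_le_open:
  assumes "\<And>T. open T \<Longrightarrow> E \<subseteq> T \<Longrightarrow> c \<le> emeasure lebesgue T"
  shows "c \<le> outer_measure_of lebesgue E"
  unfolding outer_measure_of_def
proof (rule INF_greatest)
  fix B assume "B \<in> {B \<in> sets lebesgue. E \<subseteq> B}"
  then have B: "B \<in> sets lebesgue" "E \<subseteq> B" by auto
  show "c \<le> emeasure lebesgue B"
  proof (rule ennreal_le_epsilon)
    fix e :: real assume e: "0 < e"
    obtain T where T: "open T" "B \<subseteq> T" "T - B \<in> lmeasurable" "emeasure lebesgue (T - B) < ennreal e"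
      using sets_lebesgue_outer_open[OF B(1) e] by blast
    have "c \<le> emeasure lebesgue T" using assms T B by blast
    also have "T = B \<union> (T - B)" using T by blast
    also have "emeasure lebesgue \<dots> \<le> emeasure lebesgue B + emeasure lebesgue (T - B)"
      using B T by (intro emeasure_subadditive) (auto simp: fmeasurableD)
    also have "\<dots> \<le> emeasure lebesgue B + ennreal e"
      using T by (intro add_left_mono) auto
    finally show "c \<le> emeasure lebesgue B + ennreal e" .
  qed
qed

text \<open>By Vitali's theorem, disjoint intervals \<open>{a..b}\<close> of the given kind inside an open \<open>T \<supseteq> E\<close> cover \<open>E\<close>
up to a null set. A Lipschitz map sends the null set to a null set, and the images \<open>{h a..h b}\<close> have
total length at most \<open>p\<close> times the measure of \<open>T\<close>. With outer measure,
this applies to sets \<open>E\<close> described by the frequent behaviour of difference quotients.\<close>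

lemma outer_measure_image_le:
  fixes h :: "real \<Rightarrow> real"
  assumes mono: "strict_mono h" and lip: "M-lipschitz_on UNIV h" and p: "0 \<le> p"
    and small: "\<And>x d. x \<in> E \<Longrightarrow> 0 < d \<Longrightarrow>
                  \<exists>a b. a < b \<and> b - a < d \<and> x \<in> {a..b} \<and> h b - h a \<le> p * (b - a)"
  shows "outer_measure_of lebesgue (h ` E) \<le> ennreal p * outer_measure_of lebesgue E"
proof (cases "p = 0")
  case True
  have "E = {}"
  proof (rule ccontr)
    assume "E \<noteq> {}"
    then obtain x where "x \<in> E" by blast
    from small[OF this, of 1] True obtain a b where "a < b" "h b - h a \<le> 0" by auto
    with strict_monoD[OF mono] show False by force
  qed
  then show ?thesis by simp
next
  case False
  with p have p: "0 < p" by simp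
  have "outer_measure_of lebesgue (h ` E) / ennreal p \<le> outer_measure_of lebesgue E"
  proof (rule outer_measure_lebesgue_le_open)
    fix T :: "real set" assume T: "open T" "E \<subseteq> T"
    define K where "K = {(c, r). 0 < r \<and> cball c r \<subseteq> T \<and> h (c + r) - h (c - r) \<le> p * (2 * r)}"
    have cov: "\<exists>i. i \<in> K \<and> x \<in> cball (fst i) (snd i) \<and> snd i < d" if xd: "x \<in> E" "0 < d" for x d
    proof -
      have "x \<in> T" using T(2) that(1) by blast
      then obtain e where e: "e > 0" "ball x e \<subseteq> T"
        by (rule openE[OF T(1)])
      have "min e d > 0" using e that by simp
      then obtain a b where ab: "a < b" "b - a < min e d" "x \<in> {a..b}" 
          "h b - h a \<le> p * (b - a)" using small[OF xd(1)] by metis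
      have s: "(a + b) / 2 + (b - a) / 2 = b" "(a + b) / 2 - (b - a) / 2 = a"
        by (simp_all add: field_simps)
      have "cball ((a + b) / 2) ((b - a) / 2) = {a..b}"
        by (simp add: cball_eq_atLeastAtMost s)
      moreover have "{a..b} \<subseteq> ball x e"
        using ab by (auto simp: dist_real_def)
      ultimately have *: "cball ((a + b) / 2) ((b - a) / 2) \<subseteq> T" 
        and "x \<in> cball ((a + b) / 2) ((b - a) / 2)"
        using ab e by blast+
      moreover have "(b - a) / 2 < d" using ab by simp
      moreover have "((a + b) / 2, (b - a) / 2) \<in> K"
        unfolding K_def mem_Collect_eq prod.case s using * ab by (simp add: algebra_simps)
      ultimately show ?thesis by (intro exI[of _ "((a + b) / 2, (b - a) / 2)"]) simp
    qed
    have K0: "0 < snd i" if "i \<in> K" for i using that by (auto simp: K_def)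
    obtain C where C: "countable C" "C \<subseteq> K"
      "pairwise (\<lambda>i j. disjnt (cball (fst i) (snd i)) (cball (fst j) (snd j))) C"
      "negligible (E - (\<Union>i\<in>C. cball (fst i) (snd i)))"
      by (rule Vitali_covering_theorem_cballs[of K snd E fst, OF K0 cov])
    define N where "N = E - (\<Union>i\<in>C. cball (fst i) (snd i))"
    define I where "I i = {h (fst i - snd i)..h (fst i + snd i)}" for i
    have hN: "negligible (h ` N)"
    proof (rule negligible_locally_Lipschitz_image)
      show "negligible N" using C by (simp add: N_def)
      show "\<exists>T B. open T \<and> x \<in> T \<and> (\<forall>y\<in>N \<inter> T. norm (h y - h x) \<le> B * norm (y - x))" for x
        using lipschitz_onD[OF lip] by (intro exI[of _ UNIV] exI[of _ M]) (simp add: dist_norm)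
    qed simp
    have sub: "h ` E \<subseteq> h ` N \<union> (\<Union>i\<in>C. I i)"
    proof
      fix y assume "y \<in> h ` E"
      then obtain x where x: "x \<in> E" "y = h x" by blast
      show "y \<in> h ` N \<union> (\<Union>i\<in>C. I i)"
      proof (cases "x \<in> N")
        case False
        then obtain i where "i \<in> C" "x \<in> cball (fst i) (snd i)" using x by (auto simp: N_def)
        then show ?thesis
          using x strict_mono_less_eq[OF mono] 
          by (auto simp: I_def cball_eq_atLeastAtMost intro!: bexI[of _ i])
      qed (use x in auto)
    qed
    \<comment> \<open>Disjoint intervals on the line are ordered, so \<open>h\<close> maps them to disjoint intervals.\<close>
    have bd: "fst j + snd j < fst i - snd i \<or> fst i + snd i < fst j - snd j" 
      if "i \<in> C" "j \<in> C" "i \<noteq> j" for i j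
    proof -
      have "disjnt (cball (fst i) (snd i)) (cball (fst j) (snd j))"
        using C(3) that by (auto simp: pairwise_def)
      moreover have "0 < snd i" "0 < snd j" using that C(2) by (auto simp: K_def)
      moreover have "max (fst i - snd i) (fst j - snd j) \<in> cball (fst i) (snd i) \<inter> cball (fst j) (snd j)"
        if "\<not> ?thesis"
        using that \<open>0 < snd i\<close> \<open>0 < snd j\<close> by (auto simp: cball_eq_atLeastAtMost)
      ultimately show ?thesis by (auto simp: disjnt_def)
    qed
    have disjI: "disjoint_family_on I C"
      unfolding disjoint_family_on_def
    proof (intro ballI impI)
      fix i j assume "i \<in> C" "j \<in> C" "i \<noteq> j"
      from bd[OF this] show "I i \<inter> I j = {}"
        using strict_monoD[OF mono] by (fastforce simp: I_def)
    qed
    have disjc: "disjoint_family_on (\<lambda>i. cball (fst i) (snd i)) C"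
      unfolding disjoint_family_on_def using C(3) by (auto simp: pairwise_def disjnt_def)
    have mI: "(\<Union>i\<in>C. I i) \<in> sets lebesgue"
      using C(1) by (intro sets.countable_UN') (auto simp: I_def)
    have hN': "h ` N \<in> sets lebesgue" "emeasure lebesgue (h ` N) = 0"
      using hN by (auto simp: negligible_iff_null_sets)
    have "outer_measure_of lebesgue (h ` E) \<le> outer_measure_of lebesgue (h ` N \<union> (\<Union>i\<in>C. I i))"
      by (rule outer_measure_of_mono[OF sub])
    also have "\<dots> = emeasure lebesgue (h ` N \<union> (\<Union>i\<in>C. I i))"
      using mI hN' by (intro outer_measure_of_eq) auto
    also have "\<dots> \<le> emeasure lebesgue (h ` N) + emeasure lebesgue (\<Union>i\<in>C. I i)"
      using mI hN' by (intro emeasure_subadditive)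
    also have "\<dots> = emeasure lebesgue (\<Union>i\<in>C. I i)" using hN' by simp
    also have "\<dots> = (\<integral>\<^sup>+i. emeasure lebesgue (I i) \<partial>count_space C)"
      by (rule emeasure_UN_countable) (use C disjI in \<open>simp_all add: I_def[abs_def]\<close>)
    also have "\<dots> \<le> (\<integral>\<^sup>+i. ennreal p * emeasure lebesgue (cball (fst i) (snd i)) \<partial>count_space C)"
    proof (rule nn_integral_mono)
      fix i assume "i \<in> space (count_space C)"
      then have i: "i \<in> C" by simp
      then have i': "0 < snd i" "h (fst i + snd i) - h (fst i - snd i) \<le> p * (2 * snd i)"
        using C(2) by (auto simp: K_def)
      have "h (fst i - snd i) \<le> h (fst i + snd i)" 
        using i' strict_mono_less_eq[OF mono] by simp
      then have "emeasure lebesgue (I i) = ennreal (h (fst i + snd i) - h (fst i - snd i))"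
        by (simp add: I_def)
      also have "\<dots> \<le> ennreal (p * (2 * snd i))" using i' by (intro ennreal_leI)
      also have "\<dots> = ennreal p * ennreal (2 * snd i)"
        using p i' by (intro ennreal_mult) auto
      also have "ennreal (2 * snd i) = emeasure lebesgue (cball (fst i) (snd i))"
        using i' by (simp add: cball_eq_atLeastAtMost)
      finally show "emeasure lebesgue (I i) \<le> ennreal p * emeasure lebesgue (cball (fst i) (snd i))" .
    qed
    also have "\<dots> = ennreal p * (\<integral>\<^sup>+i. emeasure lebesgue (cball (fst i) (snd i)) \<partial>count_space C)"
      by (rule nn_integral_cmult) simp
    also have "\<dots> = ennreal p * emeasure lebesgue (\<Union>i\<in>C. cball (fst i) (snd i))"
      by (subst emeasure_UN_countable) (use C disjc in \<open>auto\<close>)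
    also have "\<dots> \<le> ennreal p * emeasure lebesgue T"
    proof (intro mult_left_mono emeasure_mono)
      show "(\<Union>i\<in>C. cball (fst i) (snd i)) \<subseteq> T" using C(2) unfolding K_def by fastforce
    qed (use T in auto)
    finally have "outer_measure_of lebesgue (h ` E) \<le> ennreal p * emeasure lebesgue T" .
    then show "outer_measure_of lebesgue (h ` E) / ennreal p \<le> emeasure lebesgue T"
      using p by (intro divide_le_posI_ennreal) (auto simp: mult.commute)
  qed
  then have "ennreal p * (outer_measure_of lebesgue (h ` E) / ennreal p)
               \<le> ennreal p * outer_measure_of lebesgue E"
    by (intro mult_left_mono) auto
  moreover have "ennreal p * (outer_measure_of lebesgue (h ` E) / ennreal p)
                   = outer_measure_of lebesgue (h ` E) * ennreal p / ennreal p"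
    by (simp add: ennreal_times_divide mult.commute)
  moreover have "\<dots> = outer_measure_of lebesgue (h ` E)"
    using p by (intro ennreal_mult_divide_eq) auto
  ultimately show ?thesis by simp
qed


text \<open>Let \<open>E\<close> be a bounded part of the set. Arbitrarily short intervals with slope below \<open>p\<close> give
\<open>|h(E)| \<le> p |E|\<close>. Seen from the other side, intervals with slope above \<open>q\<close> are intervals on which
the inverse of \<open>h\<close> has slope below \<open>1/q\<close>, so \<open>|E| \<le> |h(E)| / q\<close>. Together \<open>|E| \<le> (p/q) |E|\<close>, and
\<open>E\<close> is null because \<open>p < q\<close>.\<close>

lemma lipschitz_quotient_oscillation_negligible:
  fixes h :: "real \<Rightarrow> real"
  assumes l: "0 < l" and lower: "\<And>x y. x < y \<Longrightarrow> l * (y - x) \<le> h y - h x"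
    and lip: "M-lipschitz_on UNIV h" and pq: "0 < p" "p < q"
  shows "negligible {x. (\<exists>\<^sub>F y in at x. (h y - h x) / (y - x) < p) \<and>
                        (\<exists>\<^sub>F y in at x. q < (h y - h x) / (y - x))}" (is "negligible ?S")
proof -
  have mono: "strict_mono h"
  proof (rule strict_monoI)
    fix x y :: real assume "x < y"
    then have "0 < l * (y - x)" using l by simp
    with lower[OF \<open>x < y\<close>] show "h x < h y" by linarith
  qed
  have cont: "continuous_on UNIV h" by (rule lipschitz_on_continuous_on[OF lip])
  have inj: "inj h" using mono by (rule strict_mono_imp_inj_on)
  have surj: "surj h"
  proof -
    have "\<exists>x. h x = y" for y
    proof -
      define t where "t = \<bar>y - h 0\<bar> / l + 1"
      have t: "t > 0" using l by (simp add: t_def add_nonneg_pos)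
      have "l * t \<ge> \<bar>y - h 0\<bar>" using l by (simp add: t_def field_simps)
      then have "h (-t) \<le> y" "y \<le> h t"
        using lower[of 0 t] lower[of "-t" 0] t by auto
      then show ?thesis
        using IVT'[of h "-t" y t] t continuous_on_subset[OF cont] by auto
    qed
    then show ?thesis by (metis surjI)
  qed
  define g where "g = inv h"
  have gh: "g (h x) = x" for x unfolding g_def by (rule inv_f_f[OF inj])
  have hg: "h (g y) = y" for y unfolding g_def by (rule surj_f_inv_f[OF surj])
  have gmono: "strict_mono g"
    by (rule strict_monoI) (metis hg strict_mono_less[OF mono])
  have glip: "(1/l)-lipschitz_on UNIV g"
  proof (rule lipschitz_onI)
    fix x y :: real
    have "\<bar>g x - g y\<bar> * l \<le> \<bar>x - y\<bar>"
    proof (cases "g x" "g y" rule: linorder_cases)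
      case less then show ?thesis using lower[OF less] hg by (simp add: algebra_simps)
    next
      case greater then show ?thesis using lower[OF greater] hg by (simp add: algebra_simps)
    qed simp
    then show "dist (g x) (g y) \<le> 1/l * dist x y" using l by (simp add: dist_real_def field_simps)
  qed (use l in simp)
  have neg: "negligible (?S \<inter> {-real n..real n})" for n :: nat
  proof -
    define E where "E = ?S \<inter> {-real n..real n}"
    define \<mu> :: "real set \<Rightarrow> ennreal" where "\<mu> = outer_measure_of lebesgue"
    have upper: "\<mu> (h ` E) \<le> ennreal p * \<mu> E"
      unfolding \<mu>_def
    proof (rule outer_measure_image_le[OF mono lip])
      fix x d :: real assume x: "x \<in> E" and d: "0 < d"
      have "\<exists>\<^sub>F y in at x. (h y - h x) / (y - x) < p" using x by (simp add: E_def)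
      moreover have "\<forall>\<^sub>F y in at x. y \<noteq> x \<and> dist y x < d"
        using d by (auto simp: eventually_at)
      ultimately obtain y where y: "(h y - h x) / (y - x) < p" "y \<noteq> x" "dist y x < d"
        using frequently_ex[OF frequently_eventually_conj] by blast
      show "\<exists>a b. a < b \<and> b - a < d \<and> x \<in> {a..b} \<and> h b - h a \<le> p * (b - a)"
      proof (cases "x < y")
        case True
        then show ?thesis using y
          by (intro exI[of _ x] exI[of _ y]) (simp add: dist_real_def pos_divide_less_eq)
      next
        case False
        then have "y < x" using y by simp
        then show ?thesis using y
          by (intro exI[of _ y] exI[of _ x]) (simp add: dist_real_def neg_divide_less_eq algebra_simps)
      qed
    qed (use pq in simp)
    have "\<mu> (g ` (h ` E)) \<le> ennreal (1/q) * \<mu> (h ` E)"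
      unfolding \<mu>_def
    proof (rule outer_measure_image_le[OF gmono glip])
      fix z d :: real assume "z \<in> h ` E" and d: "0 < d"
      then obtain x where x: "x \<in> E" "z = h x" by blast
      have "\<exists>\<^sub>F y in at x. q < (h y - h x) / (y - x)" using x by (simp add: E_def)
      moreover have "\<forall>\<^sub>F y in at x. y \<noteq> x \<and> dist (h y) (h x) < d"
      proof (intro eventually_conj)
        show "\<forall>\<^sub>F y in at x. dist (h y) (h x) < d"
          using cont d by (auto simp: continuous_on_eq_continuous_at isCont_def dest: tendstoD)
        show "\<forall>\<^sub>F y in at x. y \<noteq> x" by (simp add: eventually_at_filter)
      qed
      ultimately obtain y where y: "q < (h y - h x) / (y - x)" "y \<noteq> x" "dist (h y) (h x) < d"
        using frequently_ex[OF frequently_eventually_conj] by blast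
      show "\<exists>a b. a < b \<and> b - a < d \<and> z \<in> {a..b} \<and> g b - g a \<le> 1/q * (b - a)"
      proof (cases "x < y")
        case True
        then have "h x < h y" by (rule strict_monoD[OF mono])
        moreover have "y - x \<le> (h y - h x) / q" using y True pq by (simp add: field_simps)
        ultimately show ?thesis using y x gh
          by (intro exI[of _ "h x"] exI[of _ "h y"]) (simp add: dist_real_def)
      next
        case False
        then have "y < x" using y by simp
        then have "h y < h x" by (rule strict_monoD[OF mono])
        moreover have "x - y \<le> (h x - h y) / q" using y \<open>y < x\<close> pq by (simp add: field_simps)
        ultimately show ?thesis using y x gh
          by (intro exI[of _ "h y"] exI[of _ "h x"]) (simp add: dist_real_def)
      qed
    qed (use pq in simp)
    also have "g ` (h ` E) = E" by (simp add: image_image gh)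
    also have "ennreal (1/q) * \<mu> (h ` E) \<le> ennreal (1/q) * (ennreal p * \<mu> E)"
      by (intro mult_left_mono upper) simp
    also have "\<dots> = ennreal (p / q) * \<mu> E"
      using pq by (simp add: ennreal_mult' [symmetric] mult.assoc[symmetric])
    finally have le: "\<mu> E \<le> ennreal (p / q) * \<mu> E" .
    have "\<mu> E \<le> \<mu> {-real n..real n}" unfolding \<mu>_def E_def by (rule outer_measure_of_mono) simp
    also have "\<dots> < \<infinity>" by (simp add: \<mu>_def)
    finally obtain m where m: "m \<ge> 0" "\<mu> E = ennreal m" by (cases "\<mu> E") auto
    have "m \<le> p / q * m" using le m pq by (simp add: ennreal_mult'[symmetric])
    moreover have "p / q < 1" using pq by simp
    ultimately have "m = 0" using m mult_strict_right_mono[of "p / q" 1 m] by (cases "m = 0") auto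
    then have "\<mu> E = 0" using m by simp
    then obtain B where "B \<in> sets lebesgue" "E \<subseteq> B" "emeasure lebesgue B = 0"
      unfolding \<mu>_def using outer_measure_of_attain[of E lebesgue] by auto
    then have "negligible B" by (auto simp: negligible_iff_null_sets)
    then show ?thesis using \<open>E \<subseteq> B\<close> negligible_subset unfolding E_def by blast
  qed
  have "?S = (\<Union>n::nat. ?S \<inter> {-real n..real n})"
  proof -
    have "\<exists>n::nat. x \<in> {-real n..real n}" for x :: real
    proof -
      obtain n where "\<bar>x\<bar> \<le> real n" using real_arch_simple by blast
      then show ?thesis by (intro exI[of _ n]) auto
    qed
    then show ?thesis by blast
  qed
  moreover have "negligible (\<Union>n::nat. ?S \<inter> {-real n..real n})"
    using neg by (rule negligible_Union_nat)
  ultimately show ?thesis by simp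
qed

text \<open>Adding a steep linear function makes the slopes lie in \<open>[l, 3 l]\<close> with \<open>l > 0\<close>, so that the previous
lemma applies, and affects differentiability nowhere. A point without a derivative has
\<open>liminf < limsup\<close> of the difference quotients, hence lies in the oscillation set of one of
the countably many pairs of rationals \<open>p < q\<close>.\<close>

theorem lipschitz_real_differentiable_ae:
  fixes f :: "real \<Rightarrow> real"
  assumes lip: "L-lipschitz_on UNIV f"
  shows "negligible {x. \<not> f differentiable (at x)}"
proof -
  have L: "0 \<le> L" using lip by (rule lipschitz_on_nonneg)
  define l where "l = L + 1"
  define h where "h x = f x + 2 * l * x" for x
  have fl: "\<bar>f y - f x\<bar> \<le> L * \<bar>y - x\<bar>" for x y
    using lipschitz_onD[OF lip, of y x] by (simp add: dist_real_def)
  have lower: "l * (y - x) \<le> h y - h x" if "x < y" for x y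
    using fl[of y x] that by (simp add: h_def l_def algebra_simps)
  have hlip: "(3 * l)-lipschitz_on UNIV h"
  proof (rule lipschitz_onI)
    fix x y :: real
    have "h x - h y = (f x - f y) + 2 * l * (x - y)" by (simp add: h_def algebra_simps)
    then have "\<bar>h x - h y\<bar> \<le> \<bar>f x - f y\<bar> + 2 * l * \<bar>x - y\<bar>"
      using L by (metis abs_mult abs_of_nonneg abs_triangle_ineq l_def add_nonneg_nonneg mult_nonneg_nonneg zero_le_numeral zero_le_one)
    also have "\<dots> \<le> 3 * l * \<bar>x - y\<bar>"
      using fl[of x y] by (simp add: l_def algebra_simps)
    finally show "dist (h x) (h y) \<le> 3 * l * dist x y" by (simp add: dist_real_def)
  qed (use L in \<open>simp add: l_def\<close>)
  define S where "S p q = {x. (\<exists>\<^sub>F y in at x. (h y - h x) / (y - x) < p) \<and>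
                        (\<exists>\<^sub>F y in at x. q < (h y - h x) / (y - x))}" for p q
  have "{x. \<not> f differentiable (at x)} \<subseteq> (\<Union>(p, q) \<in> {(p, q). p \<in> \<rat> \<and> q \<in> \<rat> \<and> 0 < p \<and> p < q}. S p q)"
  proof clarify
    fix x assume nd: "\<not> f differentiable (at x)"
    define Q where "Q y = (h y - h x) / (y - x)" for y
    have Ql: "l \<le> Q y" if "y \<noteq> x" for y
      using lower[of x y] lower[of y x] that
      by (cases "x < y") (auto simp: Q_def field_simps)
    have Qu: "Q y \<le> 3 * l" if "y \<noteq> x" for y
      using lipschitz_onD[OF hlip, of x y] that
      by (cases "x < y") (auto simp: Q_def dist_real_def field_simps)
    define a where "a = Liminf (at x) (\<lambda>y. ereal (Q y))"
    define b where "b = Limsup (at x) (\<lambda>y. ereal (Q y))"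
    have la: "ereal l \<le> a" unfolding a_def
      using Ql by (intro Liminf_bounded) (auto simp: eventually_at_filter)
    have bu: "b \<le> ereal (3 * l)" unfolding b_def
      using Qu by (intro Limsup_bounded) (auto simp: eventually_at_filter)
    have ab: "a \<le> b" unfolding a_def b_def by (rule Liminf_le_Limsup) simp
    have "a \<noteq> b"
    proof
      assume eq: "a = b"
      obtain c where c: "a = ereal c" using la bu ab eq by (cases a) auto
      have "((\<lambda>y. ereal (Q y)) \<longlongrightarrow> ereal c) (at x)"
        using eq c unfolding a_def b_def by (intro Liminf_eq_Limsup) auto
      then have "(Q \<longlongrightarrow> c) (at x)" by simp
      then have "(h has_real_derivative c) (at x)"
        by (simp add: has_field_derivative_iff Q_def[abs_def])
      then have "((\<lambda>y. h y - 2 * l * y) has_real_derivative (c - 2 * l)) (at x)"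
        by (auto intro!: derivative_eq_intros)
      then have "(f has_real_derivative (c - 2 * l)) (at x)" by (simp add: h_def)
      then show False using nd real_differentiable_def by blast
    qed
    with ab have "a < b" by simp
    then obtain p' where p': "a < ereal p'" "ereal p' < b" using ereal_dense2 by blast
    then obtain q' where q': "ereal p' < ereal q'" "ereal q' < b" using ereal_dense2 by blast
    then have "p' < q'" by simp
    then obtain q where q: "q \<in> \<rat>" "p' < q" "q < q'" using Rats_dense_in_real by blast
    obtain p where p: "p \<in> \<rat>" "p' < p" "p < q" using q Rats_dense_in_real by blast
    have "l < p'" using la p' by (metis ereal_less_le le_less_trans less_ereal.simps(1))
    have "\<exists>\<^sub>F y in at x. Q y < p"
    proof (rule ccontr)
      assume "\<not> (\<exists>\<^sub>F y in at x. Q y < p)"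
      then have "ereal p \<le> a" unfolding a_def
        by (intro Liminf_bounded) (simp add: frequently_def not_less)
      then show False using p' p by (metis ereal_less_eq(3) leD le_less_trans less_ereal.simps(1) order.strict_implies_order order_trans)
    qed
    moreover have "\<exists>\<^sub>F y in at x. q < Q y"
    proof (rule ccontr)
      assume "\<not> (\<exists>\<^sub>F y in at x. q < Q y)"
      then have "b \<le> ereal q" unfolding b_def
        by (intro Limsup_bounded) (simp add: frequently_def not_less)
      then show False using q' q by (meson ereal_less_eq(3) leD less_imp_le order_trans)
    qed
    ultimately have "x \<in> S p q" by (simp add: S_def Q_def)
    moreover have "0 < p" using \<open>l < p'\<close> p L by (simp add: l_def)
    ultimately show "x \<in> (\<Union>(p, q) \<in> {(p, q). p \<in> \<rat> \<and> q \<in> \<rat> \<and> 0 < p \<and> p < q}. S p q)"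
      using p q by blast
  qed
  moreover have "negligible (\<Union>(p, q) \<in> {(p, q). p \<in> \<rat> \<and> q \<in> \<rat> \<and> 0 < p \<and> p < q}. S p q)"
  proof (rule negligible_countable_Union)
    have "countable ((\<rat>::real set) \<times> (\<rat>::real set))" using countable_rat by blast
    then have "countable {(p, q). p \<in> \<rat> \<and> q \<in> \<rat> \<and> 0 < p \<and> p < (q::real)}"
      by (rule countable_subset[rotated]) auto
    then show "countable ((\<lambda>(p, q). S p q) ` {(p, q). p \<in> \<rat> \<and> q \<in> \<rat> \<and> 0 < p \<and> p < q})" by simp
    fix T assume "T \<in> (\<lambda>(p, q). S p q) ` {(p, q). p \<in> \<rat> \<and> q \<in> \<rat> \<and> 0 < p \<and> p < q}"
    then show "negligible T"
      using lipschitz_quotient_oscillation_negligible[OF _ lower hlip] L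
      by (auto simp: S_def l_def)
  qed
  ultimately show ?thesis by (rule negligible_subset[rotated])
qed

section \<open>Rademacher's theorem\<close>

lemma lipschitz_on_normD:
  assumes "L-lipschitz_on UNIV (h :: 'a::real_normed_vector \<Rightarrow> 'b::real_normed_vector)"
  shows "norm (h x - h y) \<le> L * norm (x - y)"
  using lipschitz_onD[OF assms, of x y] by (simp add: dist_norm)

definition diffquot :: "('a::real_vector \<Rightarrow> real) \<Rightarrow> 'a \<Rightarrow> real \<Rightarrow> 'a \<Rightarrow> real" where
  "diffquot h v t x = (h (x + t *\<^sub>R v) - h x) / t"

lemma diffquot_bound:
  fixes h :: "'a::real_normed_vector \<Rightarrow> real"
  assumes "L-lipschitz_on UNIV h"
  shows "\<bar>diffquot h v t x\<bar> \<le> L * norm v"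
proof (cases "t = 0")
  case True
  then show ?thesis using lipschitz_on_nonneg[OF assms] by (simp add: diffquot_def)
next
  case False
  have "\<bar>h (x + t *\<^sub>R v) - h x\<bar> \<le> L * (\<bar>t\<bar> * norm v)"
    using lipschitz_on_normD[OF assms, of "x + t *\<^sub>R v" x] by simp
  then show ?thesis using False by (simp add: diffquot_def field_simps)
qed

lemma continuous_on_diffquot:
  fixes h :: "'a::real_normed_vector \<Rightarrow> real"
  assumes "continuous_on UNIV h"
  shows "continuous_on UNIV (diffquot h v t)"
proof -
  have "continuous_on UNIV (\<lambda>x. h (x + t *\<^sub>R v))"
    by (rule continuous_on_compose2[OF assms]) (auto intro!: continuous_intros)
  then show ?thesis
    using assms unfolding diffquot_def[abs_def] by (cases "t = 0") (auto intro!: continuous_intros)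
qed

lemma directional_derivative_iff:
  "((\<lambda>t. h (x + t *\<^sub>R v)) has_real_derivative d) (at 0) \<longleftrightarrow> ((\<lambda>t. diffquot h v t x) \<longlongrightarrow> d) (at 0)"
  by (simp add: has_field_derivative_iff diffquot_def)

text \<open>The Cauchy criterion describes directional differentiability by closed conditions on \<open>x\<close> that do not
mention the value of the derivative. This makes the set Borel for continuous \<open>h\<close>.\<close>

lemma directionally_differentiable_eq_cauchy:
  fixes h :: "'a::real_normed_vector \<Rightarrow> real"
  shows "{x. (\<lambda>t. h (x + t *\<^sub>R v)) differentiable (at 0)} =
    (\<Inter>k::nat. \<Union>m::nat. \<Inter>(s, t) \<in> {(s, t). s \<noteq> 0 \<and> t \<noteq> 0 \<and> \<bar>s\<bar> < 1 / Suc m \<and> \<bar>t\<bar> < 1 / Suc m}.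
       {x. \<bar>diffquot h v s x - diffquot h v t x\<bar> \<le> 1 / Suc k})" (is "?D = ?G")
proof (intro equalityI subsetI)
  fix x assume "x \<in> ?D"
  then obtain d where d: "((\<lambda>t. diffquot h v t x) \<longlongrightarrow> d) (at 0)"
    by (auto simp: real_differentiable_def directional_derivative_iff)
  have "\<exists>m::nat. \<forall>s t. s \<noteq> 0 \<and> t \<noteq> 0 \<and> \<bar>s\<bar> < 1 / Suc m \<and> \<bar>t\<bar> < 1 / Suc m \<longrightarrow>
          \<bar>diffquot h v s x - diffquot h v t x\<bar> \<le> 1 / Suc k" for k :: nat
  proof -
    have "0 < 1 / (2 * real (Suc k))" by simp
    from tendstoD[OF d this] obtain \<delta> where \<delta>: "\<delta> > 0"
      "\<And>t. t \<noteq> 0 \<Longrightarrow> \<bar>t\<bar> < \<delta> \<Longrightarrow> \<bar>diffquot h v t x - d\<bar> < 1 / (2 * real (Suc k))"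
      by (auto simp: eventually_at dist_real_def)
    obtain m :: nat where m: "1 / Suc m < \<delta>" using \<delta>(1) nat_approx_posE by blast
    show ?thesis
    proof (intro exI[of _ m] allI impI)
      fix s t :: real assume st: "s \<noteq> 0 \<and> t \<noteq> 0 \<and> \<bar>s\<bar> < 1 / Suc m \<and> \<bar>t\<bar> < 1 / Suc m"
      have "\<bar>diffquot h v s x - d\<bar> < 1 / (2 * real (Suc k))" "\<bar>diffquot h v t x - d\<bar> < 1 / (2 * real (Suc k))"
        using st m \<delta>(2) by auto
      then have "\<bar>diffquot h v s x - diffquot h v t x\<bar> \<le> 2 * (1 / (2 * real (Suc k)))" by linarith
      then show "\<bar>diffquot h v s x - diffquot h v t x\<bar> \<le> 1 / Suc k" by (simp del: of_nat_Suc)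
    qed
  qed
  then show "x \<in> ?G" by fastforce
next
  fix x assume x: "x \<in> ?G"
  have G: "\<exists>m::nat. \<forall>s t. s \<noteq> 0 \<and> t \<noteq> 0 \<and> \<bar>s\<bar> < 1 / Suc m \<and> \<bar>t\<bar> < 1 / Suc m \<longrightarrow>
          \<bar>diffquot h v s x - diffquot h v t x\<bar> \<le> 1 / Suc k" for k :: nat
    using x by fastforce
  define a where "a n = diffquot h v (1 / Suc n) x" for n :: nat
  have approx: "\<exists>k::nat. 1 / Suc k < e" if "e > 0" for e :: real
    using that nat_approx_posE by blast
  have "Cauchy a"
  proof (rule metric_CauchyI)
    fix e :: real assume "e > 0"
    then obtain k :: nat where k: "1 / Suc k < e" using approx by blast
    obtain m :: nat where m: "\<forall>s t. s \<noteq> 0 \<and> t \<noteq> 0 \<and> \<bar>s\<bar> < 1 / Suc m \<and> \<bar>t\<bar> < 1 / Suc m \<longrightarrow>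
          \<bar>diffquot h v s x - diffquot h v t x\<bar> \<le> 1 / Suc k" using G by blast
    have "dist (a i) (a j) < e" if "i \<ge> Suc m" "j \<ge> Suc m" for i j
    proof -
      have "\<bar>1 / real (Suc i)\<bar> < 1 / Suc m" "\<bar>1 / real (Suc j)\<bar> < 1 / Suc m"
        using that by (auto simp: field_simps)
      then have "\<bar>a i - a j\<bar> \<le> 1 / Suc k" using m unfolding a_def by auto
      then show ?thesis using k by (simp add: dist_real_def)
    qed
    then show "\<exists>M. \<forall>i\<ge>M. \<forall>j\<ge>M. dist (a i) (a j) < e" by blast
  qed
  then obtain d where d: "a \<longlonglongrightarrow> d" using Cauchy_convergent convergent_def by blast
  have "((\<lambda>t. diffquot h v t x) \<longlongrightarrow> d) (at 0)"
  proof (rule tendstoI)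
    fix e :: real assume "e > 0"
    then obtain k :: nat where k: "1 / Suc k < e" using approx by blast
    obtain m :: nat where m: "\<forall>s t. s \<noteq> 0 \<and> t \<noteq> 0 \<and> \<bar>s\<bar> < 1 / Suc m \<and> \<bar>t\<bar> < 1 / Suc m \<longrightarrow>
          \<bar>diffquot h v s x - diffquot h v t x\<bar> \<le> 1 / Suc k" using G by blast
    have "dist (diffquot h v t x) d < e" if t: "t \<noteq> 0" "\<bar>t\<bar> < 1 / Suc m" for t
    proof -
      have "(\<lambda>n. \<bar>diffquot h v t x - a n\<bar>) \<longlonglongrightarrow> \<bar>diffquot h v t x - d\<bar>"
        by (intro tendsto_intros d)
      moreover have "\<forall>n\<ge>Suc m. \<bar>diffquot h v t x - a n\<bar> \<le> 1 / Suc k"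
      proof (intro allI impI)
        fix n assume "n \<ge> Suc m"
        then have "\<bar>1 / real (Suc n)\<bar> < 1 / Suc m" by (auto simp: field_simps)
        then show "\<bar>diffquot h v t x - a n\<bar> \<le> 1 / Suc k" using m t unfolding a_def by auto
      qed
      ultimately have "\<bar>diffquot h v t x - d\<bar> \<le> 1 / Suc k" by (meson LIMSEQ_le_const2)
      then show ?thesis using k by (simp add: dist_real_def)
    qed
    then show "\<forall>\<^sub>F t in at 0. dist (diffquot h v t x) d < e"
      unfolding eventually_at by (intro exI[of _ "1 / Suc m"]) (auto simp: dist_real_def)
  qed
  then show "x \<in> ?D" by (auto simp: real_differentiable_def simp flip: directional_derivative_iff)
qed

lemma directionally_differentiable_borel:
  fixes h :: "'a::euclidean_space \<Rightarrow> real"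
  assumes "continuous_on UNIV h"
  shows "{x. (\<lambda>t. h (x + t *\<^sub>R v)) differentiable (at 0)} \<in> sets borel"
proof -
  have "closed {x. \<bar>diffquot h v s x - diffquot h v t x\<bar> \<le> 1 / Suc k}" for s t and k :: nat
    by (intro closed_Collect_le continuous_intros continuous_on_diffquot assms)
  then have "closed (\<Inter>(s, t) \<in> {(s, t). s \<noteq> 0 \<and> t \<noteq> 0 \<and> \<bar>s\<bar> < 1 / Suc m \<and> \<bar>t\<bar> < 1 / Suc m}.
       {x. \<bar>diffquot h v s x - diffquot h v t x\<bar> \<le> 1 / Suc k})" for m k :: nat
    by (intro closed_INT) auto
  then have "(\<Inter>k::nat. \<Union>m::nat. \<Inter>(s, t) \<in> {(s, t). s \<noteq> 0 \<and> t \<noteq> 0 \<and> \<bar>s\<bar> < 1 / Suc m \<and> \<bar>t\<bar> < 1 / Suc m}.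
       {x. \<bar>diffquot h v s x - diffquot h v t x\<bar> \<le> 1 / Suc k}) \<in> sets borel"
    by (intro sets.countable_INT sets.countable_UN) (intro subsetI, clarify, intro sets.countable_UN, auto intro!: borel_closed)
  then show ?thesis unfolding directionally_differentiable_eq_cauchy .
qed

text \<open>Fubini's theorem for lines in an arbitrary direction, without a change of coordinates: by translation
invariance, the measure of \<open>N\<close> is the average over \<open>t \<in> [0, 1]\<close> of the integrals of
\<open>indicator N (x + t v)\<close> over \<open>x\<close>; after exchanging the integrals, the inner one runs along a line.\<close>

lemma null_sets_if_null_on_parallel_lines:
  fixes N :: "'a::euclidean_space set"
  assumes N: "N \<in> sets borel" and lines: "\<And>x. negligible {t::real. x + t *\<^sub>R v \<in> N}"
  shows "N \<in> null_sets lborel"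
proof -
  have [measurable]: "(\<lambda>(x::'a, t::real). indicator N (x + t *\<^sub>R v) :: ennreal) \<in> borel_measurable (lborel \<Otimes>\<^sub>M lborel)"
    using N by measurable
  have tr: "(\<integral>\<^sup>+x. indicator N (x + t *\<^sub>R v) \<partial>lborel) = emeasure lborel N" for t :: real
  proof -
    have "(\<integral>\<^sup>+x. indicator N x \<partial>lborel) = (\<integral>\<^sup>+x. indicator N x \<partial>distr lborel borel ((+) (t *\<^sub>R v)))"
      by (simp add: lborel_distr_plus)
    also have "\<dots> = (\<integral>\<^sup>+x. indicator N (t *\<^sub>R v + x) \<partial>lborel)"
      using N by (intro nn_integral_distr) auto
    finally show ?thesis using N by (simp add: add.commute)
  qed
  have "emeasure lborel N = (\<integral>\<^sup>+t. emeasure lborel N * indicator {0..1::real} t \<partial>lborel)"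
    by (simp add: nn_integral_cmult_indicator)
  also have "\<dots> = (\<integral>\<^sup>+t. (\<integral>\<^sup>+x. indicator N (x + t *\<^sub>R v) * indicator {0..1::real} t \<partial>lborel) \<partial>lborel)"
    using N by (intro nn_integral_cong) (simp add: nn_integral_multc tr)
  also have "\<dots> = (\<integral>\<^sup>+x. (\<integral>\<^sup>+t. indicator N (x + t *\<^sub>R v) * indicator {0..1::real} t \<partial>lborel) \<partial>lborel)"
    using N by (intro lborel_pair.Fubini') measurable
  also have "\<dots> = (\<integral>\<^sup>+x. 0 \<partial>(lborel :: 'a measure))"
  proof (rule nn_integral_cong)
    fix x :: 'a
    have s: "{t::real. x + t *\<^sub>R v \<in> N} \<in> sets borel"
    proof -
      have "(\<lambda>t::real. x + t *\<^sub>R v) -` N \<inter> space borel \<in> sets borel"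
        by (rule measurable_sets[OF _ N]) measurable
      then show ?thesis by (simp add: vimage_def)
    qed
    have "{t::real. x + t *\<^sub>R v \<in> N} \<in> null_sets lborel"
      using lines[of x] s by (simp add: negligible_iff_null_sets null_sets_completion_iff)
    then have "AE t in lborel. x + t *\<^sub>R v \<notin> N" 
      using AE_not_in by fastforce
    then have "(\<integral>\<^sup>+t. indicator N (x + t *\<^sub>R v) * indicator {0..1::real} t \<partial>lborel) = (\<integral>\<^sup>+t. 0 \<partial>(lborel :: real measure))"
      by (intro nn_integral_cong_AE) auto
    then show "(\<integral>\<^sup>+t. indicator N (x + t *\<^sub>R v) * indicator {0..1::real} t \<partial>lborel) = 0" by simp
  qed
  finally have "emeasure lborel N = 0" by simp
  then show ?thesis using N by (simp add: null_sets_def)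
qed

lemma lipschitz_directionally_differentiable_AE:
  fixes h :: "'a::euclidean_space \<Rightarrow> real"
  assumes lip: "L-lipschitz_on UNIV h"
  shows "AE x in lborel. (\<lambda>t. h (x + t *\<^sub>R v)) differentiable (at 0)"
proof -
  define N where "N = - {x. (\<lambda>t. h (x + t *\<^sub>R v)) differentiable (at 0)}"
  have "N \<in> null_sets lborel"
  proof (rule null_sets_if_null_on_parallel_lines)
    show "N \<in> sets borel" unfolding N_def
      using directionally_differentiable_borel[OF lipschitz_on_continuous_on[OF lip]] by simp
    fix x
    define \<phi> where "\<phi> t = h (x + t *\<^sub>R v)" for t
    have "(L * norm v)-lipschitz_on UNIV \<phi>"
    proof (rule lipschitz_onI)
      fix s t :: real
      have "x + s *\<^sub>R v - (x + t *\<^sub>R v) = (s - t) *\<^sub>R v" by (simp add: algebra_simps)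
      then show "dist (\<phi> s) (\<phi> t) \<le> L * norm v * dist s t"
        using lipschitz_on_normD[OF lip, of "x + s *\<^sub>R v" "x + t *\<^sub>R v"]
        by (simp add: \<phi>_def dist_norm mult_ac)
    qed (use lipschitz_on_nonneg[OF lip] in simp)
    then have "negligible {t. \<not> \<phi> differentiable (at t)}" by (rule lipschitz_real_differentiable_ae)
    moreover have "{t. x + t *\<^sub>R v \<in> N} \<subseteq> {t. \<not> \<phi> differentiable (at t)}"
    proof clarify
      fix t assume t: "x + t *\<^sub>R v \<in> N" and "\<phi> differentiable (at t)"
      then obtain d where "(\<phi> has_real_derivative d) (at (0 + t))" by (auto simp: real_differentiable_def)
      then have "((\<lambda>s. \<phi> (s + t)) has_real_derivative d) (at 0)" by (subst DERIV_shift[symmetric])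
      moreover have "(\<lambda>s. \<phi> (s + t)) = (\<lambda>s. h ((x + t *\<^sub>R v) + s *\<^sub>R v))"
        by (simp add: \<phi>_def algebra_simps)
      ultimately show False using t unfolding N_def real_differentiable_def by auto
    qed
    ultimately show "negligible {t. x + t *\<^sub>R v \<in> N}" by (rule negligible_subset)
  qed
  then have "AE x in lborel. x \<notin> N" by (rule AE_not_in)
  then show ?thesis by (simp add: N_def)
qed

text \<open>For large \<open>k\<close> the function \<open>1 + F / k\<close> is a nonnegative density that gives every box its volume. So it
is a density of Lebesgue measure, and must equal 1.\<close>

lemma AE_eq_0_if_integral_boxes_0:
  fixes F :: "'a::euclidean_space \<Rightarrow> real"
  assumes [measurable]: "F \<in> borel_measurable borel" and bd: "AE x in lborel. \<bar>F x\<bar> \<le> K"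
    and int: "\<And>l u. (\<integral>x. indicator (box l u) x * F x \<partial>lborel) = 0"
  shows "AE x in lborel. F x = 0"
proof -
  define k where "k = \<bar>K\<bar> + 1"
  have k: "k > 0" by (simp add: k_def)
  have bd': "AE x in lborel. \<bar>F x\<bar> \<le> k" using bd by eventually_elim (simp add: k_def)
  define M where "M = density lborel (\<lambda>x. ennreal (1 + F x / k))"
  have "lborel = M"
  proof (rule lborel_eqI)
    fix l u :: 'a assume lu: "\<And>b. b \<in> Basis \<Longrightarrow> l \<bullet> b \<le> u \<bullet> b"
    have fin: "emeasure lborel (box l u) < \<infinity>" by (simp add: emeasure_lborel_box_eq)
    have i1: "integrable lborel (indicator (box l u) :: 'a \<Rightarrow> real)" using fin by simp
    have i2: "integrable lborel (\<lambda>x. indicator (box l u) x * F x)"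
    proof (rule Bochner_Integration.integrable_bound)
      show "integrable lborel (\<lambda>x. k * indicator (box l u) x)" using i1 by simp
      show "AE x in lborel. norm (indicator (box l u) x * F x) \<le> norm (k * indicator (box l u) x)"
        using bd' by eventually_elim (use k in \<open>auto simp: indicator_def\<close>)
    qed simp
    have "emeasure M (box l u) = (\<integral>\<^sup>+x. ennreal (1 + F x / k) * indicator (box l u) x \<partial>lborel)"
      unfolding M_def by (intro emeasure_density) auto
    also have "\<dots> = (\<integral>\<^sup>+x. ennreal (indicator (box l u) x + (indicator (box l u) x * F x) / k) \<partial>lborel)"
      by (intro nn_integral_cong) (auto simp: indicator_def)
    also have "\<dots> = ennreal (\<integral>x. indicator (box l u) x + (indicator (box l u) x * F x) / k \<partial>lborel)"
    proof (rule nn_integral_eq_integral)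
      show "integrable lborel (\<lambda>x. indicator (box l u) x + (indicator (box l u) x * F x) / k)"
        using i1 i2 by simp
      show "AE x in lborel. 0 \<le> indicator (box l u) x + (indicator (box l u) x * F x) / k"
        using bd' by eventually_elim (use k in \<open>auto simp: indicator_def field_simps\<close>)
    qed
    also have "\<dots> = ennreal (\<integral>x. indicator (box l u) x \<partial>lborel)"
      using i1 i2 int by simp
    also have "\<dots> = (\<Prod>b\<in>Basis. (u - l) \<bullet> b)"
      using lu by (simp add: measure_lborel_box_eq)
    finally show "emeasure M (box l u) = (\<Prod>b\<in>Basis. (u - l) \<bullet> b)" .
  qed (simp add: M_def)
  then have "density lborel (\<lambda>x. ennreal (1 + F x / k)) = density lborel (\<lambda>x. 1)"
    by (simp add: M_def density_1)
  then have "AE x in lborel. ennreal (1 + F x / k) = 1"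
    by (subst (asm) sigma_finite_measure.density_unique_iff[OF sigma_finite_lborel]) auto
  then show ?thesis
  proof eventually_elim
    case (elim x)
    then have "1 + F x / k = 1" by (metis ennreal_eq_1)
    then show ?case using k by simp
  qed
qed

lemma tendsto_diffquot_seq:
  assumes "((\<lambda>t. h (x + t *\<^sub>R v)) has_real_derivative d) (at 0)"
  shows "(\<lambda>n::nat. diffquot h v (1 / Suc n) x) \<longlonglongrightarrow> d"
proof -
  have "filterlim (\<lambda>n::nat. 1 / real (Suc n)) (at 0) sequentially"
    unfolding filterlim_at using LIMSEQ_Suc[OF lim_1_over_n] by auto
  with assms show ?thesis
    unfolding directional_derivative_iff by (rule filterlim_compose)
qed

text \<open>The difference quotients of step \<open>1 / (n + 1)\<close> satisfy
\<open>q (v + w) n x = q v n x + q w n (x + e n)\<close> with the displacement \<open>e n = v / (n + 1)\<close>. The displaced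
argument prevents a pointwise passage to the limit. Integrated over a box, however, the displacement
moves to the indicator of the box, which converges off the boundary. By dominated convergence the limits
are additive in the mean over each box, hence almost everywhere.\<close>

lemma directional_derivative_add_AE:
  fixes h :: "'a::euclidean_space \<Rightarrow> real"
  assumes lip: "L-lipschitz_on UNIV h"
  shows "AE x in lborel. \<exists>a b. ((\<lambda>t. h (x + t *\<^sub>R v)) has_real_derivative a) (at 0) \<and>
           ((\<lambda>t. h (x + t *\<^sub>R w)) has_real_derivative b) (at 0) \<and>
           ((\<lambda>t. h (x + t *\<^sub>R (v + w))) has_real_derivative (a + b)) (at 0)"
proof -
  have cont: "continuous_on UNIV h" by (rule lipschitz_on_continuous_on[OF lip])
  define q where "q z n x = diffquot h z (1 / Suc n) x" for z x and n :: nat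
  have qm[measurable]: "q z n \<in> borel_measurable borel" for z n
    unfolding q_def by (intro borel_measurable_continuous_onI continuous_on_diffquot cont)
  have qb: "\<bar>q z n x\<bar> \<le> L * norm z" for z n x
    unfolding q_def by (rule diffquot_bound[OF lip])
  define D where "D z x = lim (\<lambda>n. q z n x)" for z x
  have Dm[measurable]: "D z \<in> borel_measurable borel" for z
    unfolding D_def[abs_def] by (rule borel_measurable_lim_metric) simp
  have dd: "AE x in lborel. ((\<lambda>t. h (x + t *\<^sub>R z)) has_real_derivative D z x) (at 0)" for z
    using lipschitz_directionally_differentiable_AE[OF lip, of z]
  proof eventually_elim
    case (elim x)
    then obtain d where d: "((\<lambda>t. h (x + t *\<^sub>R z)) has_real_derivative d) (at 0)"
      by (auto simp: real_differentiable_def)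
    then have "D z x = d" unfolding D_def q_def by (intro limI tendsto_diffquot_seq)
    with d show ?case by simp
  qed
  have lm: "AE x in lborel. (\<lambda>n. q z n x) \<longlonglongrightarrow> D z x" for z
    using dd[of z] by eventually_elim (unfold q_def, rule tendsto_diffquot_seq)
  have Db: "AE x in lborel. \<bar>D z x\<bar> \<le> L * norm z" for z
    using lm[of z]
  proof eventually_elim
    case (elim x)
    then have "(\<lambda>n. \<bar>q z n x\<bar>) \<longlonglongrightarrow> \<bar>D z x\<bar>" by (rule tendsto_rabs)
    then show ?case using qb by (intro LIMSEQ_le_const2) auto
  qed
  have qadd: "q (v + w) n x = q v n x + q w n (x + (1 / Suc n) *\<^sub>R v)" for n x
    by (simp add: q_def diffquot_def algebra_simps add_divide_distrib[symmetric])
  have fin: "integrable lborel (indicator (cball c r) :: 'a \<Rightarrow> real)" for c r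
    using emeasure_bounded_finite[of "cball c r"] by simp
  have box_int: "(\<integral>x. indicator (box l u) x * (D (v + w) x - D v x - D w x) \<partial>lborel) = 0" for l u
  proof -
    let ?B = "box l u"
    obtain r where "\<forall>x\<in>?B. norm x \<le> r"
      using bounded_box[of l u] unfolding bounded_iff by blast
    then have r: "?B \<subseteq> cball 0 r" by auto
    \<comment> \<open>An integrable majorant of all integrands: the box displaced by \<open>e n\<close> stays within distance
\<open>norm v\<close> of the ball around the box.\<close>
    define W where "W x = (L * norm v + L * norm w + L * norm (v + w)) * indicator (cball 0 (r + norm v)) x" for x :: 'a
    have L: "L \<ge> 0" using lip by (rule lipschitz_on_nonneg)
    have Wi: "integrable lborel W" unfolding W_def using fin by (intro integrable_mult_right) auto
    have ae_fr: "AE x in lborel. x \<in> ?B \<or> x \<notin> cbox l u"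
    proof -
      have "cbox l u - box l u \<in> null_sets lborel"
        using negligible_frontier_interval[of l u] by (simp add: negligible_iff_null_sets null_sets_completion_iff)
      then have "AE x in lborel. x \<notin> cbox l u - box l u" by (rule AE_not_in)
      then show ?thesis by eventually_elim auto
    qed
    have ind: "indicator ?B x * \<bar>q z n y\<bar> \<le> W x" if "z \<in> {v, w, v + w}" for x y z n
    proof -
      have "0 \<le> L * norm v" "0 \<le> L * norm w" "0 \<le> L * norm (v + w)" using L by auto
      then have "\<bar>q z n y\<bar> \<le> L * norm v + L * norm w + L * norm (v + w)" 
        using qb[of z n y] that by auto
      moreover have "x \<in> ?B \<Longrightarrow> x \<in> cball 0 (r + norm v)" using r by (fastforce intro: add_increasing2)
      ultimately show ?thesis using L by (auto simp: W_def indicator_def)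
    qed
    have c1: "integrable lborel (\<lambda>x. indicator ?B x * D z x)"
      "\<And>n. integrable lborel (\<lambda>x. indicator ?B x * q z n x)"
      "(\<lambda>n. \<integral>x. indicator ?B x * q z n x \<partial>lborel) \<longlonglongrightarrow> (\<integral>x. indicator ?B x * D z x \<partial>lborel)"
      if z: "z \<in> {v, w, v + w}" for z
    proof -
      have a1: "AE x in lborel. (\<lambda>n. indicator ?B x * q z n x) \<longlonglongrightarrow> indicator ?B x * D z x"
        using lm[of z] by eventually_elim (intro tendsto_intros)
      have a2: "AE x in lborel. norm (indicator ?B x * q z n x) \<le> W x" for n
        using ind[OF z] by (intro AE_I2) (simp add: abs_mult)
      show "integrable lborel (\<lambda>x. indicator ?B x * D z x)" by (rule integrable_dominated_convergence[OF _ _ Wi a1 a2]) measurable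
      show "\<And>n. integrable lborel (\<lambda>x. indicator ?B x * q z n x)" by (rule integrable_dominated_convergence2[OF _ _ Wi a1 a2]) measurable
      show "(\<lambda>n. \<integral>x. indicator ?B x * q z n x \<partial>lborel) \<longlonglongrightarrow> (\<integral>x. indicator ?B x * D z x \<partial>lborel)"
        by (rule integral_dominated_convergence[OF _ _ Wi a1 a2]) measurable
    qed
    define e where "e n = (1 / real (Suc n)) *\<^sub>R v" for n
    have e0: "e \<longlonglongrightarrow> 0"
    proof -
      have "(\<lambda>n. 1 / real (Suc n)) \<longlonglongrightarrow> 0" by (rule LIMSEQ_Suc[OF lim_1_over_n])
      then show ?thesis unfolding e_def by (auto intro: tendsto_eq_intros)
    qed
    have en: "norm (e n) \<le> norm v" for n by (simp add: e_def divide_le_eq algebra_simps)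
    have a1: "AE y in lborel. (\<lambda>n. indicator ?B (y - e n) * q w n y) \<longlonglongrightarrow> indicator ?B y * D w y"
      using lm[of w] ae_fr
    proof eventually_elim
      case (elim y)
      have ye: "(\<lambda>n. y - e n) \<longlonglongrightarrow> y" using tendsto_diff[OF tendsto_const e0, of y] by simp
      have "\<forall>\<^sub>F n in sequentially. indicator ?B (y - e n) = (indicator ?B y :: real)"
      proof (cases "y \<in> ?B")
        case True
        then have "\<forall>\<^sub>F n in sequentially. y - e n \<in> ?B" using topological_tendstoD[OF ye open_box] by blast
        then show ?thesis by eventually_elim (use True in simp)
      next
        case False
        then have "y \<in> - cbox l u" using elim by simp
        then have "\<forall>\<^sub>F n in sequentially. y - e n \<in> - cbox l u"
          by (rule topological_tendstoD[OF ye, rotated]) (simp add: closed_cbox open_Compl)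
        then show ?thesis
        proof eventually_elim
          case (elim n)
          then have "y - e n \<notin> ?B" using box_subset_cbox by blast
          then show ?case using False by simp
        qed
      qed
      then have "(\<lambda>n. indicator ?B (y - e n)) \<longlonglongrightarrow> (indicator ?B y :: real)" by (rule tendsto_eventually)
      then show ?case using elim by (intro tendsto_mult)
    qed
    have a2: "AE y in lborel. norm (indicator ?B (y - e n) * q w n y) \<le> W y" for n
    proof (rule AE_I2)
      fix y
      have "0 \<le> L * norm v" "0 \<le> L * norm w" "0 \<le> L * norm (v + w)" using L by auto
      then have "\<bar>q w n y\<bar> \<le> L * norm v + L * norm w + L * norm (v + w)" using qb[of w n y] by linarith
      moreover have "y - e n \<in> ?B \<Longrightarrow> y \<in> cball 0 (r + norm v)"
      proof -
        assume "y - e n \<in> ?B"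
        then have "norm (y - e n) \<le> r" using r by auto
        then show ?thesis using en[of n] norm_triangle_sub[of y "e n"] by simp
      qed
      ultimately show "norm (indicator ?B (y - e n) * q w n y) \<le> W y"
        using L by (auto simp: W_def indicator_def)
    qed
    have c2: "(\<lambda>n. \<integral>y. indicator ?B (y - e n) * q w n y \<partial>lborel) \<longlonglongrightarrow> (\<integral>x. indicator ?B x * D w x \<partial>lborel)"
      by (rule integral_dominated_convergence[OF _ _ Wi a1 a2]) measurable
    \<comment> \<open>The substitution \<open>y = e n + x\<close> carries the displacement from the quotient to the indicator.\<close>
    have tr: "(\<integral>y. indicator ?B (y - e n) * q w n y \<partial>lborel) = (\<integral>x. indicator ?B x * q (v + w) n x \<partial>lborel)
                - (\<integral>x. indicator ?B x * q v n x \<partial>lborel)" for n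
    proof -
      have "(\<integral>y. indicator ?B (y - e n) * q w n y \<partial>lborel) = (\<integral>y. indicator ?B (y - e n) * q w n y \<partial>distr lborel borel ((+) (e n)))"
        by (simp add: lborel_distr_plus)
      also have "\<dots> = (\<integral>x. indicator ?B (e n + x - e n) * q w n (e n + x) \<partial>lborel)"
        by (intro integral_distr) measurable
      also have "\<dots> = (\<integral>x. indicator ?B x * q (v + w) n x - indicator ?B x * q v n x \<partial>lborel)"
        by (intro Bochner_Integration.integral_cong) (auto simp: qadd e_def algebra_simps)
      also have "\<dots> = (\<integral>x. indicator ?B x * q (v + w) n x \<partial>lborel) - (\<integral>x. indicator ?B x * q v n x \<partial>lborel)"
        by (intro Bochner_Integration.integral_diff c1) auto
      finally show ?thesis .
    qed
    have "(\<lambda>n. \<integral>y. indicator ?B (y - e n) * q w n y \<partial>lborel) \<longlonglongrightarrow>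
            (\<integral>x. indicator ?B x * D (v + w) x \<partial>lborel) - (\<integral>x. indicator ?B x * D v x \<partial>lborel)"
      unfolding tr by (intro tendsto_diff c1) auto
    with c2 have "(\<integral>x. indicator ?B x * D w x \<partial>lborel) =
       (\<integral>x. indicator ?B x * D (v + w) x \<partial>lborel) - (\<integral>x. indicator ?B x * D v x \<partial>lborel)"
      by (rule LIMSEQ_unique)
    moreover have "(\<integral>x. indicator ?B x * (D (v + w) x - D v x - D w x) \<partial>lborel) = 
        (\<integral>x. indicator ?B x * D (v + w) x \<partial>lborel) - (\<integral>x. indicator ?B x * D v x \<partial>lborel)
          - (\<integral>x. indicator ?B x * D w x \<partial>lborel)"
      by (simp add: right_diff_distrib c1 Bochner_Integration.integral_diff Bochner_Integration.integrable_diff)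
    ultimately show ?thesis by simp
  qed
  have "AE x in lborel. D (v + w) x - D v x - D w x = 0"
  proof (rule AE_eq_0_if_integral_boxes_0)
    show "AE x in lborel. \<bar>D (v + w) x - D v x - D w x\<bar> \<le> L * norm (v + w) + L * norm v + L * norm w"
      using Db[of "v + w"] Db[of v] Db[of w] by eventually_elim linarith
  qed (use box_int in auto)
  then show ?thesis
    using dd[of "v + w"] dd[of v] dd[of w]
  proof eventually_elim
    case (elim x)
    then have "D (v + w) x = D v x + D w x" by simp
    with elim show ?case by metis
  qed
qed

text \<open>Additivity, applied to the multiples of the basis vectors one after the other. The exceptional null set
depends on the direction \<open>u\<close>, whereas \<open>G\<close> does not.\<close>

lemma directional_derivative_linear_AE:
  fixes h :: "'a::euclidean_space \<Rightarrow> real"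
  assumes lip: "L-lipschitz_on UNIV h"
  obtains G where "\<And>u. AE x in lborel. ((\<lambda>t. h (x + t *\<^sub>R u)) has_real_derivative (u \<bullet> G x)) (at 0)"
proof -
  define d where "d b x = (SOME d. ((\<lambda>t. h (x + t *\<^sub>R b)) has_real_derivative d) (at 0))" for b x
  have d: "AE x in lborel. ((\<lambda>t. h (x + t *\<^sub>R b)) has_real_derivative d b x) (at 0)" for b
    using lipschitz_directionally_differentiable_AE[OF lip, of b]
    by eventually_elim (auto simp: real_differentiable_def d_def intro: someI)
  have sm: "AE x in lborel. ((\<lambda>t. h (x + t *\<^sub>R (\<Sum>b\<in>S. c b *\<^sub>R b))) has_real_derivative (\<Sum>b\<in>S. c b * d b x)) (at 0)"
    if "finite S" for S :: "'a set" and c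
    using that
  proof (induction S)
    case empty
    show ?case by simp
  next
    case (insert a S)
    have sc: "AE x in lborel. ((\<lambda>t. h (x + t *\<^sub>R (c a *\<^sub>R a))) has_real_derivative (c a * d a x)) (at 0)"
      using d[of a]
    proof eventually_elim
      case (elim x)
      have "((\<lambda>t. h (x + (c a * t) *\<^sub>R a)) has_real_derivative (d a x * c a)) (at 0)"
        by (rule DERIV_chain2[of "\<lambda>t. h (x + t *\<^sub>R a)" "d a x" "\<lambda>t. c a * t"])
           (use elim in \<open>auto intro!: derivative_eq_intros\<close>)
      then show ?case by (simp add: mult.commute)
    qed
    show ?case
      using sc insert.IH directional_derivative_add_AE[OF lip, of "c a *\<^sub>R a" "\<Sum>b\<in>S. c b *\<^sub>R b"]
    proof eventually_elim
      case (elim x)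
      then obtain \<alpha> \<beta> where ab: "((\<lambda>t. h (x + t *\<^sub>R (c a *\<^sub>R a))) has_real_derivative \<alpha>) (at 0)"
        "((\<lambda>t. h (x + t *\<^sub>R (\<Sum>b\<in>S. c b *\<^sub>R b))) has_real_derivative \<beta>) (at 0)"
        "((\<lambda>t. h (x + t *\<^sub>R (c a *\<^sub>R a + (\<Sum>b\<in>S. c b *\<^sub>R b)))) has_real_derivative (\<alpha> + \<beta>)) (at 0)"
        by blast
      have "\<alpha> = c a * d a x" "\<beta> = (\<Sum>b\<in>S. c b * d b x)"
        using ab elim DERIV_unique by blast+
      then show ?case using ab(3) insert.hyps by simp
    qed
  qed
  define G where "G x = (\<Sum>b\<in>Basis. d b x *\<^sub>R b)" for x
  show thesis
  proof (rule that[of G])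
    fix u
    show "AE x in lborel. ((\<lambda>t. h (x + t *\<^sub>R u)) has_real_derivative (u \<bullet> G x)) (at 0)"
      using sm[of Basis "\<lambda>b. u \<bullet> b"]
      by (simp add: euclidean_representation G_def inner_sum_right mult.commute)
  qed
qed

text \<open>At almost every \<open>x\<close> the directional derivatives in the directions of a countable dense set exist and are
given by \<open>G x\<close>. Finitely many of these directions are \<open>\<epsilon>\<close>-dense in the unit sphere, so that the
convergence is uniform over them, and the Lipschitz bound passes it on to all directions.\<close>

theorem rademacher_real:
  fixes h :: "'a::euclidean_space \<Rightarrow> real"
  assumes lip: "L-lipschitz_on UNIV h"
  shows "AE x in lborel. h differentiable (at x)"
proof -
  obtain G where G: "\<And>u. AE x in lborel. ((\<lambda>t. h (x + t *\<^sub>R u)) has_real_derivative (u \<bullet> G x)) (at 0)"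
    using directional_derivative_linear_AE[OF lip] by blast
  obtain D :: "'a set" where D: "countable D" "\<And>X. open X \<Longrightarrow> X \<noteq> {} \<Longrightarrow> \<exists>d\<in>D. d \<in> X"
    by (rule countable_dense_setE) blast
  have L: "L \<ge> 0" using lip by (rule lipschitz_on_nonneg)
  have "AE x in lborel. \<forall>u\<in>D. ((\<lambda>t. h (x + t *\<^sub>R u)) has_real_derivative (u \<bullet> G x)) (at 0)"
    using D(1) G by (subst AE_ball_countable) auto
  then show ?thesis
  proof eventually_elim
    case (elim x)
    define K where "K = L + norm (G x) + 1"
    have K: "K > 0" using L by (simp add: K_def add_nonneg_pos)
    have "(h has_derivative (\<lambda>v. v \<bullet> G x)) (at x)"
      unfolding has_derivative_at_alt
    proof (intro conjI allI impI bounded_linear_inner_left)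
      fix e :: real assume e: "e > 0"
      define \<epsilon> where "\<epsilon> = e / K"
      have \<epsilon>: "\<epsilon> > 0" using e K by (simp add: \<epsilon>_def)
      have "sphere 0 1 \<subseteq> (\<Union>u\<in>D. ball u \<epsilon>)"
      proof
        fix z :: 'a assume "z \<in> sphere 0 1"
        obtain u where "u \<in> D" "u \<in> ball z \<epsilon>" using D(2)[of "ball z \<epsilon>"] \<epsilon> by auto
        then show "z \<in> (\<Union>u\<in>D. ball u \<epsilon>)" by (auto simp: dist_commute)
      qed
      then obtain U where U: "U \<subseteq> D" "finite U" "sphere 0 1 \<subseteq> (\<Union>u\<in>U. ball u \<epsilon>)"
        using compactE_image[of "sphere (0::'a) 1" D "\<lambda>u. ball u \<epsilon>"] by (metis compact_sphere open_ball)
      have "\<forall>u\<in>U. \<forall>\<^sub>F t in at 0. \<bar>diffquot h u t x - u \<bullet> G x\<bar> < \<epsilon>"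
      proof
        fix u assume "u \<in> U"
        then have "((\<lambda>t. diffquot h u t x) \<longlongrightarrow> u \<bullet> G x) (at 0)"
          using elim U by (auto simp flip: directional_derivative_iff)
        from tendstoD[OF this \<epsilon>] show "\<forall>\<^sub>F t in at 0. \<bar>diffquot h u t x - u \<bullet> G x\<bar> < \<epsilon>"
          by (simp add: dist_real_def)
      qed
      then have "\<forall>\<^sub>F t in at 0. \<forall>u\<in>U. \<bar>diffquot h u t x - u \<bullet> G x\<bar> < \<epsilon>"
        using U(2) by (simp add: eventually_ball_finite)
      then obtain \<delta> where \<delta>: "\<delta> > 0"
        "\<And>t u. t \<noteq> 0 \<Longrightarrow> \<bar>t\<bar> < \<delta> \<Longrightarrow> u \<in> U \<Longrightarrow> \<bar>diffquot h u t x - u \<bullet> G x\<bar> < \<epsilon>"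
        by (auto simp: eventually_at dist_real_def)
      show "\<exists>d>0. \<forall>y. norm (y - x) < d \<longrightarrow> norm (h y - h x - (y - x) \<bullet> G x) \<le> e * norm (y - x)"
      proof (intro exI[of _ \<delta>] conjI allI impI \<delta>(1))
        fix y assume y: "norm (y - x) < \<delta>"
        show "norm (h y - h x - (y - x) \<bullet> G x) \<le> e * norm (y - x)"
        proof (cases "y = x")
          case False
          define t where "t = norm (y - x)"
          define z where "z = (1 / t) *\<^sub>R (y - x)"
          have t: "t > 0" "t < \<delta>" using False y by (auto simp: t_def)
          have yz: "y = x + t *\<^sub>R z" using t by (simp add: z_def)
          have "norm z = 1" using False by (simp add: z_def t_def)
          then obtain u where u: "u \<in> U" "norm (z - u) < \<epsilon>"
            using U(3) by (force simp: dist_norm norm_minus_commute)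
          have 1: "\<bar>h (x + t *\<^sub>R u) - h x - t * (u \<bullet> G x)\<bar> \<le> t * \<epsilon>"
          proof -
            have "h (x + t *\<^sub>R u) - h x - t * (u \<bullet> G x) = t * (diffquot h u t x - u \<bullet> G x)"
              using t by (simp add: diffquot_def right_diff_distrib diff_divide_distrib)
            then show ?thesis using \<delta>(2)[of t u] t u by (simp add: abs_mult)
          qed
          have 2: "\<bar>h y - h (x + t *\<^sub>R u)\<bar> \<le> L * (t * \<epsilon>)"
          proof -
            have "\<bar>h y - h (x + t *\<^sub>R u)\<bar> \<le> L * norm (t *\<^sub>R (z - u))"
              using lipschitz_on_normD[OF lip, of y "x + t *\<^sub>R u"] by (simp add: yz algebra_simps)
            also have "\<dots> \<le> L * (t * \<epsilon>)"
              using u t L by (intro mult_left_mono) auto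
            finally show ?thesis .
          qed
          have 3: "\<bar>t * (u \<bullet> G x) - (y - x) \<bullet> G x\<bar> \<le> t * \<epsilon> * norm (G x)"
          proof -
            have "t * (u \<bullet> G x) - (y - x) \<bullet> G x = t * ((u - z) \<bullet> G x)"
              by (simp add: yz inner_diff_left algebra_simps)
            also have "\<bar>\<dots>\<bar> \<le> t * (norm (u - z) * norm (G x))"
              using t Cauchy_Schwarz_ineq2[of "u - z" "G x"] by (simp add: abs_mult)
            also have "\<dots> \<le> t * (\<epsilon> * norm (G x))"
              using u t by (intro mult_left_mono mult_right_mono) (auto simp: norm_minus_commute)
            finally show ?thesis by (simp add: mult.assoc)
          qed
          have "\<bar>h y - h x - (y - x) \<bullet> G x\<bar> \<le> t * \<epsilon> + L * (t * \<epsilon>) + t * \<epsilon> * norm (G x)"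
            using 1 2 3 by linarith
          also have "\<dots> = K * \<epsilon> * t" by (simp add: K_def algebra_simps)
          also have "\<dots> = e * t" using K by (simp add: \<epsilon>_def)
          finally show ?thesis by (simp add: t_def)
        qed simp
      qed
    qed
    then show ?case by (rule differentiableI)
  qed
qed

theorem rademacher:
  fixes f :: "'a::euclidean_space \<Rightarrow> 'b::euclidean_space"
  assumes lip: "L-lipschitz_on UNIV f"
  shows "AE x in lborel. f differentiable (at x)"
proof -
  have "AE x in lborel. (\<lambda>x. f x \<bullet> i) differentiable (at x)" if "i \<in> Basis" for i
  proof (rule rademacher_real)
    show "L-lipschitz_on UNIV (\<lambda>x. f x \<bullet> i)"
    proof (rule lipschitz_onI)
      fix x y
      have "\<bar>(f x - f y) \<bullet> i\<bar> \<le> norm (f x - f y)" by (rule Basis_le_norm[OF that])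
      also have "\<dots> \<le> L * norm (x - y)" by (rule lipschitz_on_normD[OF lip])
      finally show "dist (f x \<bullet> i) (f y \<bullet> i) \<le> L * dist x y" by (simp add: dist_norm inner_diff_left)
    qed (rule lipschitz_on_nonneg[OF lip])
  qed
  then have "AE x in lborel. \<forall>i\<in>Basis. (\<lambda>x. f x \<bullet> i) differentiable (at x)"
    by (subst AE_ball_countable) (auto intro: countable_finite)
  then show ?thesis
    by eventually_elim (use differentiable_componentwise_within[of f _ UNIV] in auto)
qed

section \<open>Images of critical points\<close>

text \<open>The theorem \<open>baby_Sard\<close> concerns vectors with well-ordered index types. An enumeration provides every
finite type \<open>'n\<close> with a well-ordered copy, to which vectors are transported by relabelling.\<close>

typedef ('n::finite) ord_index = "{..<CARD('n)}"
  morphisms nat_of_index index_of_nat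
  by (metis lessThan_iff zero_less_card_finite)

instance ord_index :: (finite) finite
proof
  have "finite (nat_of_index ` (UNIV :: 'a ord_index set))"
    by (rule finite_subset[of _ "{..<CARD('a)}"]) (use nat_of_index in auto)
  then show "finite (UNIV :: 'a ord_index set)"
    by (rule finite_imageD) (auto simp: inj_on_def nat_of_index_inject)
qed

instantiation ord_index :: (finite) wellorder
begin

definition less_eq_ord_index :: "'a ord_index \<Rightarrow> 'a ord_index \<Rightarrow> bool" where
  "i \<le> j \<longleftrightarrow> nat_of_index i \<le> nat_of_index j"

definition less_ord_index :: "'a ord_index \<Rightarrow> 'a ord_index \<Rightarrow> bool" where
  "i < j \<longleftrightarrow> nat_of_index i < nat_of_index j"

instance
proof
  fix P :: "'a ord_index \<Rightarrow> bool" and a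
  assume step: "\<And>x. (\<And>y. y < x \<Longrightarrow> P y) \<Longrightarrow> P x"
  show "P a"
    by (induction a rule: measure_induct_rule[of nat_of_index]) (auto intro: step simp: less_ord_index_def)
qed (auto simp: less_eq_ord_index_def less_ord_index_def nat_of_index_inject)

end

lemma card_ord_index: "CARD('n::finite ord_index) = CARD('n)"
proof -
  have "nat_of_index ` (UNIV :: 'n ord_index set) = {..<CARD('n)}"
    using type_definition.Rep_range[OF type_definition_ord_index] by simp
  then have "card (nat_of_index ` (UNIV :: 'n ord_index set)) = CARD('n)" by simp
  then show ?thesis by (simp add: card_image inj_on_def nat_of_index_inject)
qed

lemma negligible_linear_image_dim_le:
  fixes f :: "'a::euclidean_space \<Rightarrow> 'b::euclidean_space"
  assumes "linear f" "negligible S" "DIM('a) \<le> DIM('b)"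
  shows "negligible (f ` S)"
proof (rule negligible_locally_Lipschitz_image[OF assms(3,2)])
  obtain B where B: "\<And>x. norm (f x) \<le> B * norm x" using linear_bounded[OF assms(1)] by blast
  show "\<exists>T B. open T \<and> x \<in> T \<and> (\<forall>y\<in>S \<inter> T. norm (f y - f x) \<le> B * norm (y - x))" for x
    using B by (intro exI[of _ UNIV] exI[of _ B]) (simp flip: linear_diff[OF assms(1)])
qed

text \<open>Sard's theorem is invariant under linear changes of coordinates: conjugate with the relabelling \<open>\<phi>\<close> of
the coordinates, and return with its inverse \<open>\<psi>\<close>.\<close>

lemma negligible_image_singular_derivative:
  fixes f :: "real ^ 'n \<Rightarrow> real ^ 'n"
  assumes der: "\<And>x. x \<in> S \<Longrightarrow> (f has_derivative f' x) (at x within S)"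
    and sing: "\<And>x. x \<in> S \<Longrightarrow> \<not> inj (f' x)"
  shows "negligible (f ` S)"
proof -
  obtain g :: "'n ord_index \<Rightarrow> 'n" where g: "bij g"
    using finite_same_card_bij[of "UNIV :: 'n ord_index set" "UNIV :: 'n set"] card_ord_index by auto
  define \<phi> :: "real ^ 'n \<Rightarrow> real ^ 'n ord_index" where "\<phi> x = (\<chi> i. x $ g i)" for x
  define \<psi> :: "real ^ 'n ord_index \<Rightarrow> real ^ 'n" where "\<psi> y = (\<chi> j. y $ inv g j)" for y
  have lin: "linear \<phi>" "linear \<psi>"
    by (auto intro!: linearI simp: \<phi>_def \<psi>_def vec_eq_iff)
  have \<psi>\<phi>: "\<psi> (\<phi> x) = x" for x
    using g by (simp add: \<phi>_def \<psi>_def vec_eq_iff bij_is_surj surj_f_inv_f)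
  have \<phi>\<psi>: "\<phi> (\<psi> y) = y" for y
    using g by (simp add: \<phi>_def \<psi>_def vec_eq_iff bij_is_inj inv_f_f)
  have bl: "bounded_linear \<phi>" "bounded_linear \<psi>"
    using lin by (simp_all add: linear_conv_bounded_linear)
  define F where "F = \<phi> \<circ> f \<circ> \<psi>"
  have img: "\<psi> ` (\<phi> ` S) = S" by (simp add: image_image \<psi>\<phi>)
  have "negligible (F ` (\<phi> ` S))"
  proof (rule baby_Sard)
    fix y assume "y \<in> \<phi> ` S"
    then obtain x where x: "x \<in> S" "y = \<phi> x" by blast
    show "(F has_derivative (\<phi> \<circ> f' (\<psi> y) \<circ> \<psi>)) (at y within \<phi> ` S)"
      unfolding F_def
    proof (rule diff_chain_within)
      show "(\<psi> has_derivative \<psi>) (at y within \<phi> ` S)"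
        by (rule bounded_linear_imp_has_derivative[OF bl(2)])
      show "(\<phi> \<circ> f has_derivative \<phi> \<circ> f' (\<psi> y)) (at (\<psi> y) within \<psi> ` \<phi> ` S)"
        using x der[OF x(1)] 
        by (intro diff_chain_within bounded_linear_imp_has_derivative[OF bl(1)]) (simp add: img \<psi>\<phi>)
    qed
    then have l: "linear (\<phi> \<circ> f' (\<psi> y) \<circ> \<psi>)"
      using has_derivative_linear by blast
    have "\<not> inj (\<phi> \<circ> f' (\<psi> y) \<circ> \<psi>)"
    proof
      assume "inj (\<phi> \<circ> f' (\<psi> y) \<circ> \<psi>)"
      then have "inj (\<phi> \<circ> f' (\<psi> y) \<circ> \<psi> \<circ> \<phi>)"
        by (rule inj_compose) (metis \<psi>\<phi> injI)
      then have "inj (f' (\<psi> y))"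
        by (auto simp: inj_def \<psi>\<phi>)
      then show False using sing[OF x(1)] x \<psi>\<phi> by simp
    qed
    then have "rank (matrix (\<phi> \<circ> f' (\<psi> y) \<circ> \<psi>)) \<noteq> CARD('n ord_index)"
      using full_rank_injective[of "matrix (\<phi> \<circ> f' (\<psi> y) \<circ> \<psi>)"] l by (simp add: matrix_works)
    then show "rank (matrix (\<phi> \<circ> f' (\<psi> y) \<circ> \<psi>)) < CARD('n ord_index)"
      using rank_bound[of "matrix (\<phi> \<circ> f' (\<psi> y) \<circ> \<psi>)"] by simp
  qed simp
  then have "negligible (\<psi> ` (F ` (\<phi> ` S)))"
    by (rule negligible_linear_image_dim_le[OF lin(2)]) (simp add: card_ord_index)
  moreover have "\<psi> ` (F ` (\<phi> ` S)) = f ` S" by (simp add: image_image F_def \<psi>\<phi>)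
  ultimately show ?thesis by simp
qed

section \<open>Subgradients of convex functions\<close>

text \<open>A hyperplane separates the epigraph from the vertical half-line below \<open>(y, f y)\<close>. It is not vertical
because \<open>y\<close> is an interior point of the domain, so it is the graph of an affine minorant.\<close>

lemma convex_on_subgradient_exists:
  fixes f :: "'a::euclidean_space \<Rightarrow> real"
  assumes f: "convex_on S f" and S: "open S" and y: "y \<in> S"
  obtains q where "\<And>z. z \<in> S \<Longrightarrow> f y + q \<bullet> (z - y) \<le> f z"
proof -
  have c1: "convex ({y} \<times> {..<f y})" by (intro convex_Times) auto
  have c2: "convex (epigraph S f)" using f by (rule convex_epigraphI)
  have "(y, f y - 1) \<in> {y} \<times> {..<f y}" "(y, f y) \<in> epigraph S f"
    using y by (auto simp: mem_epigraph)
  moreover have "({y} \<times> {..<f y}) \<inter> epigraph S f = {}" by (auto simp: mem_epigraph)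
  ultimately obtain a b where ab: "a \<noteq> 0" "\<forall>x\<in>{y} \<times> {..<f y}. a \<bullet> x \<le> b" "\<forall>x\<in>epigraph S f. b \<le> a \<bullet> x"
    using separating_hyperplane_sets[OF c1 c2] by blast
  obtain g \<alpha> where a: "a = (g, \<alpha>)" by (cases a)
  have lo: "g \<bullet> y + \<alpha> * t \<le> b" if "t < f y" for t
    using ab(2) that by (auto simp: a)
  have hi: "b \<le> g \<bullet> z + \<alpha> * s" if "z \<in> S" "f z \<le> s" for z s
    using bspec[OF ab(3), of "(z, s)"] that by (simp add: a mem_epigraph)
  have "\<alpha> \<ge> 0" using lo[of "f y - 1"] hi[OF y, of "f y"] by (simp add: algebra_simps)
  moreover have "\<alpha> \<noteq> 0"
  proof
    assume 0: "\<alpha> = 0"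
    then have "g \<noteq> 0" using ab(1) a by (auto simp: zero_prod_def)
    obtain e where e: "e > 0" "ball y e \<subseteq> S" using S y by (rule openE)
    define z where "z = y - (e / 2 / norm g) *\<^sub>R g"
    have "z \<in> S" using e \<open>g \<noteq> 0\<close> by (intro subsetD[OF e(2)]) (simp add: z_def dist_norm)
    then have "g \<bullet> y \<le> g \<bullet> z" using lo[of "f y - 1"] hi[of z "f z"] 0 by simp
    then have "(e / 2 / norm g) * (g \<bullet> g) \<le> 0" by (simp add: z_def inner_diff_right)
    then have "g \<bullet> g \<le> 0" using e \<open>g \<noteq> 0\<close> by (simp add: mult_le_0_iff divide_le_0_iff)
    then show False using \<open>g \<noteq> 0\<close> inner_gt_zero_iff[of g] by linarith
  qed
  ultimately have \<alpha>: "\<alpha> > 0" by simp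
  \<comment> \<open>The half-line does not contain its endpoint \<open>(y, f y)\<close>; the inequality there is a limit.\<close>
  have key: "g \<bullet> y + \<alpha> * f y \<le> b"
  proof (rule ccontr)
    assume above: "\<not> g \<bullet> y + \<alpha> * f y \<le> b"
    define D where "D = g \<bullet> y + \<alpha> * f y - b"
    define t where "t = f y - D / (2 * \<alpha>)"
    have d: "D > 0" using above by (simp add: D_def)
    then have "t < f y" using \<alpha> by (simp add: t_def)
    from lo[OF this] have "g \<bullet> y + \<alpha> * t \<le> b" .
    moreover have "\<alpha> * t = \<alpha> * f y - D / 2"
      using \<alpha> by (simp add: t_def right_diff_distrib)
    ultimately show False using d D_def by linarith
  qed
  show thesis
  proof (rule that[of "- (g /\<^sub>R \<alpha>)"])
    fix z assume "z \<in> S"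
    from hi[OF this order_refl] key have "g \<bullet> y + \<alpha> * f y \<le> g \<bullet> z + \<alpha> * f z" by linarith
    then show "f y + (- (g /\<^sub>R \<alpha>)) \<bullet> (z - y) \<le> f z"
      using \<alpha> by (simp add: inner_diff_right field_simps)
  qed
qed

text \<open>The perturbed function is strongly convex, hence grows quadratically away from its minimizer: compare
the minimum with the value at \<open>(1 - t) y + t z\<close>, divide by \<open>t\<close> and let \<open>t\<close> tend to 0.\<close>

lemma convex_plus_half_norm_sq_minimizer:
  fixes f :: "'a::euclidean_space \<Rightarrow> real"
  assumes K: "compact K" "K \<noteq> {}" and f: "convex_on K f" "continuous_on K f"
  obtains y where "y \<in> K"
    "\<And>z. z \<in> K \<Longrightarrow> (f y + (norm y)\<^sup>2 / 2 - p \<bullet> y) + (norm (z - y))\<^sup>2 / 2 \<le> f z + (norm z)\<^sup>2 / 2 - p \<bullet> z"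
proof -
  define g where "g z = f z + (norm z)\<^sup>2 / 2 - p \<bullet> z" for z
  have "continuous_on K g" unfolding g_def by (intro continuous_intros f) auto
  then obtain y where y: "y \<in> K" "\<And>z. z \<in> K \<Longrightarrow> g y \<le> g z"
    using continuous_attains_inf[OF K] by metis
  show thesis
  proof (rule that[OF y(1)])
    fix z assume z: "z \<in> K"
    have "(norm (z - y))\<^sup>2 / 2 \<le> g z - g y"
    \<comment> \<open>The rule performs the limit, in terms of \<open>s = 1 - t\<close> tending to 1.\<close>
    proof (rule field_le_mult_one_interval)
      fix s :: real assume s: "0 < s" "s < 1"
      define t where "t = 1 - s"
      have t: "0 < t" "t < 1" using s by (auto simp: t_def)
      define x where "x = (1 - t) *\<^sub>R y + t *\<^sub>R z"
      have "x \<in> K" unfolding x_def using convex_on_imp_convex[OF f(1)] y z t by (simp add: convex_def)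
      then have gx: "g y \<le> f x + (norm x)\<^sup>2 / 2 - p \<bullet> x" using y(2) by (simp add: g_def)
      have fx: "f x \<le> (1 - t) * f y + t * f z"
        unfolding x_def using convex_onD[OF f(1)] y z t by simp
      have nx: "(norm x)\<^sup>2 = (1 - t) * (norm y)\<^sup>2 + t * (norm z)\<^sup>2 - t * (1 - t) * (norm (z - y))\<^sup>2"
        unfolding x_def power2_norm_eq_inner
        by (simp add: inner_add_left inner_add_right inner_diff_left inner_diff_right inner_commute algebra_simps)
      have px: "p \<bullet> x = (1 - t) * (p \<bullet> y) + t * (p \<bullet> z)"
        by (simp add: x_def inner_add_right)
      have "g y \<le> ((1 - t) * f y + t * f z)
          + ((1 - t) * (norm y)\<^sup>2 + t * (norm z)\<^sup>2 - t * (1 - t) * (norm (z - y))\<^sup>2) / 2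
          - ((1 - t) * (p \<bullet> y) + t * (p \<bullet> z))" (is "?l \<le> ?r")
        using gx fx unfolding nx px by (meson add_right_mono diff_right_mono order_trans)
      moreover have "t * (g z - g y) - t * ((1 - t) * ((norm (z - y))\<^sup>2 / 2)) = ?r - ?l"
        by (simp add: g_def field_simps)
      ultimately have "t * ((1 - t) * ((norm (z - y))\<^sup>2 / 2)) \<le> t * (g z - g y)"
        by linarith
      then show "s * ((norm (z - y))\<^sup>2 / 2) \<le> g z - g y"
        using t by (simp add: t_def)
    qed
    then show "(f y + (norm y)\<^sup>2 / 2 - p \<bullet> y) + (norm (z - y))\<^sup>2 / 2 \<le> f z + (norm z)\<^sup>2 / 2 - p \<bullet> z"
      by (simp add: g_def)
  qed
qed

text \<open>Differentiability of \<open>J\<close> at \<open>p0\<close> with invertible derivative gives a first-order expansion of any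
right inverse of \<open>J\<close>, provided that \<open>J p\<close> close to \<open>J p0\<close> forces \<open>p\<close> close to \<open>p0\<close>. This is
where cocoercivity enters: in the direction \<open>d\<close> from \<open>p0\<close> to \<open>p\<close>, the component \<open>J \<bullet> d\<close> is
nondecreasing along the segment, and at the distance \<open>\<eta> / 2\<close> from \<open>p0\<close> it has already grown by
\<open>\<delta>\<close>. In particular no other \<open>p\<close> has the same value as \<open>p0\<close>.\<close>

lemma cocoercive_inverse_expansion:
  fixes J :: "'a::euclidean_space \<Rightarrow> 'a"
  assumes co: "\<And>p p'. (norm (J p - J p'))\<^sup>2 \<le> (J p - J p') \<bullet> (p - p')"
    and der: "(J has_derivative T) (at p0)" and S: "linear S" "\<And>h. S (T h) = h" and \<epsilon>: "0 < \<epsilon>"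
  obtains \<delta> where "0 < \<delta>"
    "\<And>p. norm (J p - J p0) < \<delta> \<Longrightarrow> norm (p - p0 - S (J p - J p0)) \<le> \<epsilon> * norm (J p - J p0)"
proof -
  obtain B where B: "B > 0" "\<And>k. norm (S k) \<le> B * norm k"
    using linear_bounded_pos[OF S(1)] by blast
  define c where "c = 1 / B"
  have c: "c > 0" using B by (simp add: c_def)
  have Tc: "c * norm h \<le> norm (T h)" for h
    using B(2)[of "T h"] B(1) S(2)[of h] by (simp add: c_def field_simps)
  define e where "e = min (c / 2) (\<epsilon> * c / (2 * B))"
  have e: "e > 0" "e \<le> c / 2" "e \<le> \<epsilon> * c / (2 * B)" using c B \<epsilon> by (auto simp: e_def)
  obtain \<eta> where \<eta>: "\<eta> > 0" "\<And>p. norm (p - p0) < \<eta> \<Longrightarrow> norm (J p - J p0 - T (p - p0)) \<le> e * norm (p - p0)"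
    using der e(1) unfolding has_derivative_at_alt by blast
  have low: "c / 2 * norm (p - p0) \<le> norm (J p - J p0)" if "norm (p - p0) < \<eta>" for p
  proof -
    have "c * norm (p - p0) \<le> norm (T (p - p0))" by (rule Tc)
    also have "\<dots> \<le> norm (J p - J p0) + norm (J p - J p0 - T (p - p0))"
      by (metis norm_triangle_sub norm_minus_commute)
    also have "\<dots> \<le> norm (J p - J p0) + c / 2 * norm (p - p0)"
      using \<eta>(2)[OF that] mult_right_mono[OF e(2), of "norm (p - p0)"] by simp
    finally show ?thesis by simp
  qed
  define \<delta> where "\<delta> = (c / 2)\<^sup>2 * (\<eta> / 2)"
  have near: "norm (p - p0) < \<eta>" if p: "norm (J p - J p0) < \<delta>" for p
  proof (rule ccontr)
    assume far: "\<not> norm (p - p0) < \<eta>"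
    define l where "l = norm (p - p0)"
    have l: "l \<ge> \<eta>" using far by (simp add: l_def)
    then have l0: "l > 0" using \<eta> by simp
    define d where "d = (1 / l) *\<^sub>R (p - p0)"
    have nd: "norm d = 1" using l0 by (simp add: d_def l_def)
    have pd: "p = p0 + l *\<^sub>R d" using l0 by (simp add: d_def)
    define r where "r = p0 + (\<eta> / 2) *\<^sub>R d"
    have r: "norm (r - p0) = \<eta> / 2" using \<eta> nd by (simp add: r_def)
    have "c / 2 * (\<eta> / 2) \<le> norm (J r - J p0)" using low[of r] r \<eta> by simp
    then have "(c / 2 * (\<eta> / 2))\<^sup>2 \<le> (norm (J r - J p0))\<^sup>2"
      using c \<eta> by (intro power_mono) auto
    also have "\<dots> \<le> (J r - J p0) \<bullet> (r - p0)" by (rule co)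
    also have "\<dots> = \<eta> / 2 * ((J r - J p0) \<bullet> d)" by (simp add: r_def)
    finally have "(\<eta> / 2) * ((c / 2)\<^sup>2 * (\<eta> / 2)) \<le> \<eta> / 2 * ((J r - J p0) \<bullet> d)"
      by (simp add: power2_eq_square algebra_simps)
    then have 1: "\<delta> \<le> (J r - J p0) \<bullet> d" using \<eta>(1) unfolding \<delta>_def by (simp add: mult_le_cancel_left_pos mult.commute)
    have "0 \<le> (J p - J r) \<bullet> (p - r)" using co[of p r] by (meson order_trans zero_le_power2)
    also have "p - r = (l - \<eta> / 2) *\<^sub>R d" by (simp add: pd r_def algebra_simps)
    finally have "0 \<le> (l - \<eta> / 2) * ((J p - J r) \<bullet> d)" by simp
    then have "0 \<le> (J p - J r) \<bullet> d" using l \<eta> by (simp add: zero_le_mult_iff)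
    then have "\<delta> \<le> (J p - J p0) \<bullet> d" using 1 by (simp add: inner_diff_left)
    also have "\<dots> \<le> norm (J p - J p0)" using norm_cauchy_schwarz[of "J p - J p0" d] nd by simp
    finally show False using p by simp
  qed
  show thesis
  proof (rule that[of \<delta>])
    show "0 < \<delta>" using c \<eta> by (simp add: \<delta>_def)
    fix p assume p: "norm (J p - J p0) < \<delta>"
    from near[OF p] have n: "norm (p - p0) < \<eta>" .
    have "norm (p - p0 - S (J p - J p0)) = norm (S (J p - J p0 - T (p - p0)))"
      by (simp add: linear_diff[OF S(1)] S(2) norm_minus_commute)
    also have "\<dots> \<le> B * norm (J p - J p0 - T (p - p0))" by (rule B)
    also have "\<dots> \<le> B * (\<epsilon> * c / (2 * B) * norm (p - p0))"
    proof -
      have "e * norm (p - p0) \<le> \<epsilon> * c / (2 * B) * norm (p - p0)" using e by (intro mult_right_mono) auto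
      then show ?thesis using \<eta>(2)[OF n] B by (intro mult_left_mono) auto
    qed
    also have "\<dots> = \<epsilon> * (c / 2 * norm (p - p0))" using B by simp
    also have "\<dots> \<le> \<epsilon> * norm (J p - J p0)" using low[OF n] \<epsilon> by (intro mult_left_mono) auto
    finally show "norm (p - p0 - S (J p - J p0)) \<le> \<epsilon> * norm (J p - J p0)" .
  qed
qed

text \<open>Divide \<open>[0, 1]\<close> into \<open>N\<close> equal pieces: the quadratic terms sum up to \<open>b / N\<close>.\<close>

lemma increment_le_of_quadratic_modulus:
  fixes \<psi> :: "real \<Rightarrow> real"
  assumes "\<And>s t. s \<in> {0..1} \<Longrightarrow> t \<in> {0..1} \<Longrightarrow> \<bar>\<psi> t - \<psi> s\<bar> \<le> a * \<bar>t - s\<bar> + b * (t - s)\<^sup>2"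
  shows "\<bar>\<psi> 1 - \<psi> 0\<bar> \<le> a"
proof -
  have "\<bar>\<psi> 1 - \<psi> 0\<bar> \<le> a + b * (1 / real (Suc n))" for n
  proof -
    define N where "N = Suc n"
    have N: "real N > 0" by (simp add: N_def)
    have "\<psi> 1 - \<psi> 0 = (\<Sum>i<N. \<psi> (real (Suc i) / N) - \<psi> (real i / N))"
      using N sum_lessThan_telescope[of "\<lambda>i. \<psi> (real i / N)" N] by simp
    also have "\<bar>\<dots>\<bar> \<le> (\<Sum>i<N. \<bar>\<psi> (real (Suc i) / N) - \<psi> (real i / N)\<bar>)" by (rule sum_abs)
    also have "\<dots> \<le> (\<Sum>i<N. a * (1 / N) + b * (1 / N)\<^sup>2)"
    proof (rule sum_mono)
      fix i assume "i \<in> {..<N}"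
      then have "real (Suc i) / N \<in> {0..1}" "real i / N \<in> {0..1}" by (auto simp: divide_le_eq)
      moreover have "real (Suc i) / N - real i / N = 1 / N" by (simp add: add_divide_distrib)
      ultimately show "\<bar>\<psi> (real (Suc i) / N) - \<psi> (real i / N)\<bar> \<le> a * (1 / N) + b * (1 / N)\<^sup>2"
        using assms[of "real i / N" "real (Suc i) / N"] by simp
    qed
    also have "\<dots> = a + b * (1 / N)" using N by (simp add: power2_eq_square field_simps)
    finally show ?thesis by (simp add: N_def)
  qed
  moreover have "(\<lambda>n. a + b * (1 / real (Suc n))) \<longlonglongrightarrow> a + b * 0"
    by (intro tendsto_intros LIMSEQ_Suc[OF lim_1_over_n])
  ultimately show ?thesis by (intro LIMSEQ_le_const) auto
qed

text \<open>A first-order expansion of the subgradients integrates to a second-order expansion of \<open>F\<close>. Since \<open>F\<close>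
need not be differentiable along the segment from \<open>y0\<close> to \<open>y\<close>, the integration is replaced by
comparing two points of the segment through the subgradients at either of them: the remainder \<open>\<psi>\<close>
then has small increments up to a quadratic term.\<close>

lemma second_order_bound_from_subgradients:
  fixes F :: "'a::euclidean_space \<Rightarrow> real"
  assumes S: "linear S" and y: "y \<in> ball y0 \<delta>"
    and sub: "\<And>y. y \<in> ball y0 \<delta> \<Longrightarrow> \<exists>p. (\<forall>z\<in>ball y0 \<delta>. F y + p \<bullet> (z - y) \<le> F z) \<and>
                norm (p - p0 - S (y - y0)) \<le> \<epsilon> * norm (y - y0)"
    and \<epsilon>: "0 \<le> \<epsilon>"
  shows "\<bar>F y - F y0 - p0 \<bullet> (y - y0) - (S (y - y0) \<bullet> (y - y0)) / 2\<bar> \<le> \<epsilon> * (norm (y - y0))\<^sup>2"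
proof -
  define h where "h = y - y0"
  define Q where "Q = S h \<bullet> h"
  define \<psi> where "\<psi> t = F (y0 + t *\<^sub>R h) - t * (p0 \<bullet> h) - t\<^sup>2 / 2 * Q" for t
  have inb: "y0 + t *\<^sub>R h \<in> ball y0 \<delta>" if "t \<in> {0..1}" for t
  proof -
    have "\<bar>t\<bar> * norm h \<le> 1 * norm h" using that by (intro mult_right_mono) auto
    then show ?thesis using y by (simp add: h_def dist_norm norm_minus_commute)
  qed
  have low: "\<psi> t - \<psi> s \<ge> - (\<epsilon> * (norm h)\<^sup>2 * \<bar>t - s\<bar>) - \<bar>Q\<bar> / 2 * (t - s)\<^sup>2"
    if st: "s \<in> {0..1}" "t \<in> {0..1}" for s t
  proof -
    obtain p where p: "\<forall>z\<in>ball y0 \<delta>. F (y0 + s *\<^sub>R h) + p \<bullet> (z - (y0 + s *\<^sub>R h)) \<le> F z"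
      "norm (p - p0 - S (s *\<^sub>R h)) \<le> \<epsilon> * norm (s *\<^sub>R h)"
      using sub[OF inb[OF st(1)]] by auto
    define e where "e = (p - p0 - S (s *\<^sub>R h)) \<bullet> h"
    have "\<bar>e\<bar> \<le> norm (p - p0 - S (s *\<^sub>R h)) * norm h" unfolding e_def by (rule Cauchy_Schwarz_ineq2)
    also have "\<dots> \<le> \<epsilon> * norm (s *\<^sub>R h) * norm h" using p(2) by (intro mult_right_mono) auto
    also have "\<dots> = \<epsilon> * (norm h)\<^sup>2 * \<bar>s\<bar>" by (simp add: power2_eq_square)
    also have "\<dots> \<le> \<epsilon> * (norm h)\<^sup>2" using st \<epsilon> by (intro mult_left_le) auto
    finally have e: "\<bar>e\<bar> \<le> \<epsilon> * (norm h)\<^sup>2" .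
    have ph: "p \<bullet> h = p0 \<bullet> h + s * Q + e"
      by (simp add: e_def Q_def inner_diff_left linear_scale[OF S])
    have "F (y0 + s *\<^sub>R h) + (t - s) * (p \<bullet> h) \<le> F (y0 + t *\<^sub>R h)"
      using bspec[OF p(1) inb[OF st(2)]] by (simp add: algebra_simps inner_diff_right)
    then have "\<psi> t - \<psi> s \<ge> (t - s) * e - (t - s)\<^sup>2 / 2 * Q"
      unfolding \<psi>_def ph by (simp add: power2_eq_square field_simps)
    moreover have "\<bar>(t - s) * e\<bar> \<le> \<epsilon> * (norm h)\<^sup>2 * \<bar>t - s\<bar>"
      using mult_left_mono[OF e, of "\<bar>t - s\<bar>"] by (simp add: abs_mult mult_ac)
    moreover have "(t - s)\<^sup>2 / 2 * Q \<le> \<bar>Q\<bar> / 2 * (t - s)\<^sup>2"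
      using mult_left_mono[of Q "\<bar>Q\<bar>" "(t - s)\<^sup>2 / 2"] by (simp add: mult_ac)
    ultimately show ?thesis by linarith
  qed
  have "\<bar>\<psi> 1 - \<psi> 0\<bar> \<le> \<epsilon> * (norm h)\<^sup>2"
  proof (rule increment_le_of_quadratic_modulus[where b = "\<bar>Q\<bar> / 2"])
    fix s t :: real assume st: "s \<in> {0..1}" "t \<in> {0..1}"
    show "\<bar>\<psi> t - \<psi> s\<bar> \<le> \<epsilon> * (norm h)\<^sup>2 * \<bar>t - s\<bar> + \<bar>Q\<bar> / 2 * (t - s)\<^sup>2"
      using low[OF st] low[OF st(2,1)] by (simp add: abs_minus_commute power2_commute)
  qed
  then show ?thesis by (simp add: \<psi>_def h_def Q_def)
qed

section \<open>Alexandrov's theorem\<close>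

lemma has_peano_jet_iff:
  "has_peano_jet u z q B \<longleftrightarrow> symmetric_matrix B \<and>
     (\<forall>\<epsilon>>0. \<exists>\<delta>>0. \<forall>y. norm (y - z) < \<delta> \<longrightarrow>
        \<bar>u y - (u z + q \<bullet> (y - z) + 1 / 2 * ((B *v (y - z)) \<bullet> (y - z)))\<bar> \<le> \<epsilon> * (norm (y - z))\<^sup>2)"
    (is "_ \<longleftrightarrow> _ \<and> ?R")
proof -
  let ?D = "\<lambda>y. u y - (u z + q \<bullet> (y - z) + 1 / 2 * ((B *v (y - z)) \<bullet> (y - z)))"
  have "?D \<in> o[at z](\<lambda>y. (norm (y - z))\<^sup>2) \<longleftrightarrow> ?R"
  proof
    assume L: "?D \<in> o[at z](\<lambda>y. (norm (y - z))\<^sup>2)"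
    show ?R
    proof (intro allI impI)
      fix \<epsilon> :: real assume "0 < \<epsilon>"
      from landau_o.smallD[OF L this] obtain \<delta> where \<delta>: "\<delta> > 0"
        "\<And>y. y \<noteq> z \<Longrightarrow> dist y z < \<delta> \<Longrightarrow> norm (?D y) \<le> \<epsilon> * norm ((norm (y - z))\<^sup>2)"
        unfolding eventually_at by blast
      show "\<exists>\<delta>>0. \<forall>y. norm (y - z) < \<delta> \<longrightarrow> \<bar>?D y\<bar> \<le> \<epsilon> * (norm (y - z))\<^sup>2"
      proof (intro exI[of _ \<delta>] conjI \<delta>(1) allI impI)
        fix y assume "norm (y - z) < \<delta>"
        then show "\<bar>?D y\<bar> \<le> \<epsilon> * (norm (y - z))\<^sup>2"
          using \<delta>(2)[of y] by (cases "y = z") (auto simp: dist_norm)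
      qed
    qed
  next
    assume R: ?R
    show "?D \<in> o[at z](\<lambda>y. (norm (y - z))\<^sup>2)"
    proof (rule landau_o.smallI)
      fix \<epsilon> :: real assume "0 < \<epsilon>"
      with R obtain \<delta> where "\<delta> > 0" "\<And>y. norm (y - z) < \<delta> \<Longrightarrow> \<bar>?D y\<bar> \<le> \<epsilon> * (norm (y - z))\<^sup>2" by blast
      then show "\<forall>\<^sub>F y in at z. norm (?D y) \<le> \<epsilon> * norm ((norm (y - z))\<^sup>2)"
        unfolding eventually_at by (intro exI[of _ \<delta>]) (auto simp: dist_norm)
    qed
  qed
  then show ?thesis by (simp add: has_peano_jet_def)
qed

lemma symmetric_matrix_add: "symmetric_matrix A \<Longrightarrow> symmetric_matrix B \<Longrightarrow> symmetric_matrix (A + B)"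
  by (simp add: symmetric_matrix_def transpose_def vec_eq_iff)

lemma symmetric_matrix_scaleR_mat: "symmetric_matrix (k *\<^sub>R mat 1)"
  by (simp add: symmetric_matrix_def transpose_def mat_def vec_eq_iff)

lemma has_peano_jet_add:
  assumes "has_peano_jet u z q B" "has_peano_jet v z q' B'"
  shows "has_peano_jet (\<lambda>y. u y + v y) z (q + q') (B + B')"
proof -
  have "(\<lambda>y. (u y - (u z + q \<bullet> (y - z) + 1 / 2 * ((B *v (y - z)) \<bullet> (y - z))))
           + (v y - (v z + q' \<bullet> (y - z) + 1 / 2 * ((B' *v (y - z)) \<bullet> (y - z)))))
          \<in> o[at z](\<lambda>y. (norm (y - z))\<^sup>2)"
    using assms unfolding has_peano_jet_def by (elim conjE) (rule sum_in_smallo(1))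
  moreover have "(\<lambda>y. (u y - (u z + q \<bullet> (y - z) + 1 / 2 * ((B *v (y - z)) \<bullet> (y - z))))
           + (v y - (v z + q' \<bullet> (y - z) + 1 / 2 * ((B' *v (y - z)) \<bullet> (y - z)))))
      = (\<lambda>y. u y + v y - (u z + v z + (q + q') \<bullet> (y - z) + 1 / 2 * (((B + B') *v (y - z)) \<bullet> (y - z))))"
    by (simp add: fun_eq_iff inner_add_left matrix_vector_mult_add_rdistrib algebra_simps)
  ultimately show ?thesis
    using assms by (simp add: has_peano_jet_def symmetric_matrix_add)
qed

lemma scaleR_mat_vector_mult: "(k *\<^sub>R mat 1) *v h = k *\<^sub>R (h :: real ^ 'n)"
  by (simp add: scaleR_matrix_vector_assoc[symmetric])

lemma has_peano_jet_half_norm_sq: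
  "has_peano_jet (\<lambda>y. k / 2 * (norm y)\<^sup>2) z (k *\<^sub>R z) (k *\<^sub>R mat 1)"
proof -
  have "k / 2 * (norm y)\<^sup>2 - (k / 2 * (norm z)\<^sup>2 + (k *\<^sub>R z) \<bullet> (y - z)
          + 1 / 2 * (((k *\<^sub>R mat 1) *v (y - z)) \<bullet> (y - z))) = 0" for y
    unfolding scaleR_mat_vector_mult power2_norm_eq_inner
    by (simp add: inner_diff_left inner_diff_right inner_commute algebra_simps)
  then have eq: "(\<lambda>y. k / 2 * (norm y)\<^sup>2 - (k / 2 * (norm z)\<^sup>2 + (k *\<^sub>R z) \<bullet> (y - z)
          + 1 / 2 * (((k *\<^sub>R mat 1) *v (y - z)) \<bullet> (y - z)))) = (\<lambda>_. 0)"
    by (rule ext)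
  show ?thesis
    unfolding has_peano_jet_def eq by (simp add: symmetric_matrix_scaleR_mat)
qed

lemma has_peano_jet_remove_half_norm_sq:
  assumes "has_peano_jet (\<lambda>y. u y + k / 2 * (norm y)\<^sup>2) z q B"
  shows "has_peano_jet u z (q + (- k) *\<^sub>R z) (B + (- k) *\<^sub>R mat 1)"
  using has_peano_jet_add[OF assms has_peano_jet_half_norm_sq[of "- k" z]] by simp

text \<open>A Peano jet sees the derivative \<open>S\<close> of the gradient only through its quadratic form, so the symmetric
part of \<open>S\<close> serves as the Hessian.\<close>

lemma quadratic_form_symmetrized:
  fixes S :: "real ^ 'n \<Rightarrow> real ^ 'n"
  assumes "linear S"
  obtains B where "symmetric_matrix B" "\<And>h. (B *v h) \<bullet> h = S h \<bullet> h"
proof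
  define M where "M = matrix S"
  define B where "B = (1 / 2) *\<^sub>R (M + transpose M)"
  show "symmetric_matrix B"
    by (simp add: B_def symmetric_matrix_def transpose_def vec_eq_iff)
  show "(B *v h) \<bullet> h = S h \<bullet> h" for h
  proof -
    have "(transpose M *v h) \<bullet> h = (M *v h) \<bullet> h"
      by (simp add: dot_lmul_matrix inner_commute[of h])
    moreover have "M *v h = S h" using assms by (simp add: M_def matrix_works)
    ultimately show ?thesis
      by (simp add: B_def scaleR_matrix_vector_assoc[symmetric] matrix_vector_mult_add_rdistrib inner_add_left)
  qed
qed

lemma negligible_if_AE_lborel:
  assumes "AE x in lborel. P x"
  shows "negligible {x. \<not> P x}"
proof -
  obtain N where "{x \<in> space lborel. \<not> P x} \<subseteq> N" "emeasure lborel N = 0" "N \<in> sets lborel"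
    using assms by (rule AE_E)
  then have "{x. \<not> P x} \<subseteq> N" "negligible N"
    by (auto simp: negligible_iff_null_sets null_sets_completion_iff null_sets_def)
  then show ?thesis using negligible_subset by blast
qed

text \<open>Let \<open>F = f + |.|\<^sup>2 / 2\<close> on a compact ball \<open>K\<close>. For each \<open>p\<close> the function \<open>F - p \<bullet> (.)\<close> has a unique
minimizer \<open>J p\<close> in \<open>K\<close>. In other words \<open>J\<close> inverts the multivalued gradient of \<open>F\<close>: if \<open>p\<close> is a
subgradient of \<open>F\<close> at \<open>y\<close>, then \<open>J p = y\<close>. By strong convexity \<open>J\<close> is cocoercive and so 1-Lipschitz,
hence differentiable almost everywhere by Rademacher's theorem.

Every interior point \<open>y\<close> is a value of \<open>J\<close>. It is exceptional if \<open>y = J p\<close> where \<open>J\<close> is not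
differentiable at \<open>p\<close>, or differentiable with a singular derivative. These values form a null set, in the
first case because \<open>J\<close> is Lipschitz, in the second by Sard's theorem. At the other points the
derivative of \<open>J\<close> is invertible, so the subgradients of \<open>F\<close> have a first-order expansion, and
\<open>F\<close> has a second-order one.\<close>

theorem convex_has_peano_jet_ae:
  fixes f :: "real ^ 'n \<Rightarrow> real"
  assumes f: "convex_on (ball c r) f" and \<rho>: "0 < \<rho>" "\<rho> < r"
  shows "negligible {y \<in> ball c \<rho>. \<not> (\<exists>q B. has_peano_jet f y q B)}"
proof -
  define K where "K = cball c \<rho>"
  have K: "compact K" "K \<noteq> {}" "K \<subseteq> ball c r" "convex K" "ball c \<rho> \<subseteq> K"
    using \<rho> by (auto simp: K_def)
  have fK: "convex_on K f" "continuous_on K f"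
    using convex_on_subset[OF f K(3,4)] continuous_on_subset[OF convex_on_continuous[OF open_ball f] K(3)] by auto
  define F where "F z = f z + 1 / 2 * (norm z)\<^sup>2" for z
  have "\<exists>y. y \<in> K \<and> (\<forall>z\<in>K. (F y - p \<bullet> y) + (norm (z - y))\<^sup>2 / 2 \<le> F z - p \<bullet> z)" for p
  proof -
    obtain y where "y \<in> K"
      "\<And>z. z \<in> K \<Longrightarrow> (f y + (norm y)\<^sup>2 / 2 - p \<bullet> y) + (norm (z - y))\<^sup>2 / 2 \<le> f z + (norm z)\<^sup>2 / 2 - p \<bullet> z"
      by (rule convex_plus_half_norm_sq_minimizer[OF K(1,2) fK, of p]) blast
    then show ?thesis by (intro exI[of _ y]) (simp add: F_def)
  qed
  then obtain J where J: "\<And>p. J p \<in> K"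
    "\<And>p z. z \<in> K \<Longrightarrow> (F (J p) - p \<bullet> J p) + (norm (z - J p))\<^sup>2 / 2 \<le> F z - p \<bullet> z"
    by metis
  have co: "(norm (J p - J p'))\<^sup>2 \<le> (J p - J p') \<bullet> (p - p')" for p p'
    using J(2)[OF J(1)[of p'], of p] J(2)[OF J(1)[of p], of p']
    by (simp add: norm_minus_commute inner_diff_left inner_diff_right inner_commute)
  have lip: "1-lipschitz_on UNIV J"
  proof (rule lipschitz_onI)
    fix p p' :: "real ^ 'n"
    have "norm (J p - J p') * norm (J p - J p') \<le> norm (J p - J p') * norm (p - p')"
      using co[of p p'] norm_cauchy_schwarz[of "J p - J p'" "p - p'"] by (simp add: power2_eq_square)
    then show "dist (J p) (J p') \<le> 1 * dist p p'"
      by (cases "J p = J p'") (auto simp: dist_norm)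
  qed simp
  have Jeq: "J p = y" if "y \<in> K" "\<And>z. z \<in> K \<Longrightarrow> F y + p \<bullet> (z - y) \<le> F z" for p y
  proof -
    have "F y + (p \<bullet> J p - p \<bullet> y) \<le> F (J p)"
      using that(2)[OF J(1)[of p]] by (simp add: inner_diff_right)
    then have "(norm (y - J p))\<^sup>2 \<le> 0" using J(2)[OF that(1), of p] by linarith
    then show ?thesis by simp
  qed
  have sub: "\<exists>p. \<forall>z\<in>K. F y + p \<bullet> (z - y) \<le> F z" if yK: "y \<in> K" for y
  proof -
    obtain q where q: "\<And>z. z \<in> ball c r \<Longrightarrow> f y + q \<bullet> (z - y) \<le> f z"
      using convex_on_subgradient_exists[OF f open_ball subsetD[OF K(3) yK]] by blast
    have "F y + (q + y) \<bullet> (z - y) \<le> F z" if "z \<in> K" for z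
    proof -
      have "0 \<le> (norm (z - y))\<^sup>2" by simp
      then have "1 / 2 * (norm y)\<^sup>2 + y \<bullet> (z - y) \<le> 1 / 2 * (norm z)\<^sup>2"
        unfolding power2_norm_eq_inner
        by (simp add: inner_diff_left inner_diff_right inner_commute)
      then show ?thesis
        using q[of z] that K(3) by (auto simp: F_def inner_add_left)
    qed
    then show ?thesis by blast
  qed
  define N where "N = {p. \<not> J differentiable (at p)}"
  define C where "C = {p. J differentiable (at p) \<and> \<not> inj (frechet_derivative J (at p))}"
  have "negligible (J ` N)"
  proof (rule negligible_locally_Lipschitz_image)
    show "negligible N" unfolding N_def using rademacher[OF lip] by (rule negligible_if_AE_lborel)
    show "\<exists>T B. open T \<and> p \<in> T \<and> (\<forall>p'\<in>N \<inter> T. norm (J p' - J p) \<le> B * norm (p' - p))" for p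
      using lipschitz_on_normD[OF lip] by (intro exI[of _ UNIV] exI[of _ 1]) auto
  qed simp
  moreover have "negligible (J ` C)"
  proof (rule negligible_image_singular_derivative)
    fix p assume "p \<in> C"
    then show "(J has_derivative frechet_derivative J (at p)) (at p within C)"
      "\<not> inj (frechet_derivative J (at p))"
      by (auto simp: C_def frechet_derivative_works intro: has_derivative_at_withinI)
  qed
  ultimately have neg: "negligible (J ` N \<union> J ` C)" by (rule negligible_Un)
  have "\<exists>q B. has_peano_jet f y q B" if y: "y \<in> ball c \<rho>" "y \<notin> J ` N \<union> J ` C" for y
  proof -
    obtain p0 where p0: "\<forall>z\<in>K. F y + p0 \<bullet> (z - y) \<le> F z" using sub K(5) y(1) by blast
    have Jp0: "J p0 = y" using Jeq p0 K(5) y(1) by blast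
    define T where "T = frechet_derivative J (at p0)"
    have T: "(J has_derivative T) (at p0)" "inj T"
      using y(2) Jp0 by (auto simp: N_def C_def T_def frechet_derivative_works)
    obtain S where S: "linear S" "S \<circ> T = id"
      using linear_injective_left_inverse[OF has_derivative_linear[OF T(1)] T(2)] by blast
    have ST: "S (T h) = h" for h using S(2) by (simp add: fun_eq_iff)
    obtain B where B: "symmetric_matrix B" "\<And>h. (B *v h) \<bullet> h = S h \<bullet> h"
      using quadratic_form_symmetrized[OF S(1)] by blast
    have "has_peano_jet F y p0 B"
      unfolding has_peano_jet_iff
    proof (intro conjI B(1) allI impI)
      fix \<epsilon> :: real assume \<epsilon>: "0 < \<epsilon>"
      obtain \<delta> where \<delta>: "0 < \<delta>"
        "\<And>p. norm (J p - J p0) < \<delta> \<Longrightarrow> norm (p - p0 - S (J p - J p0)) \<le> \<epsilon> * norm (J p - J p0)"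
        using cocoercive_inverse_expansion[OF co T(1) S(1) ST \<epsilon>] by blast
      define \<delta>' where "\<delta>' = min \<delta> (\<rho> - dist c y)"
      have \<delta>': "0 < \<delta>'" using \<delta>(1) y(1) by (simp add: \<delta>'_def)
      have bs: "ball y \<delta>' \<subseteq> K"
      proof
        fix z assume "z \<in> ball y \<delta>'"
        then show "z \<in> K" using dist_triangle[of c z y] by (simp add: K_def \<delta>'_def)
      qed
      show "\<exists>\<delta>>0. \<forall>z. norm (z - y) < \<delta> \<longrightarrow>
        \<bar>F z - (F y + p0 \<bullet> (z - y) + 1 / 2 * ((B *v (z - y)) \<bullet> (z - y)))\<bar> \<le> \<epsilon> * (norm (z - y))\<^sup>2"
      proof (intro exI[of _ \<delta>'] conjI \<delta>' allI impI)
        fix z assume "norm (z - y) < \<delta>'"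
        then have z: "z \<in> ball y \<delta>'" by (simp add: dist_norm norm_minus_commute)
        have "\<bar>F z - F y - p0 \<bullet> (z - y) - (S (z - y) \<bullet> (z - y)) / 2\<bar> \<le> \<epsilon> * (norm (z - y))\<^sup>2"
        proof (rule second_order_bound_from_subgradients[OF S(1) z])
          fix x assume x: "x \<in> ball y \<delta>'"
          obtain p where p: "\<forall>z\<in>K. F x + p \<bullet> (z - x) \<le> F z" using sub bs x by blast
          have "J p = x" using Jeq p bs x by blast
          then show "\<exists>p. (\<forall>z\<in>ball y \<delta>'. F x + p \<bullet> (z - x) \<le> F z) \<and> norm (p - p0 - S (x - y)) \<le> \<epsilon> * norm (x - y)"
            using p bs \<delta>(2)[of p] x Jp0
            by (intro exI[of _ p]) (auto simp: \<delta>'_def dist_norm norm_minus_commute)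
        qed (use \<epsilon> in simp)
        then show "\<bar>F z - (F y + p0 \<bullet> (z - y) + 1 / 2 * ((B *v (z - y)) \<bullet> (z - y)))\<bar> \<le> \<epsilon> * (norm (z - y))\<^sup>2"
          unfolding B(2) by linarith
      qed
    qed
    then have "has_peano_jet (\<lambda>y. f y + 1 / 2 * (norm y)\<^sup>2) y p0 B" by (simp add: F_def[abs_def])
    then show ?thesis using has_peano_jet_remove_half_norm_sq by blast
  qed
  then have "{y \<in> ball c \<rho>. \<not> (\<exists>q B. has_peano_jet f y q B)} \<subseteq> J ` N \<union> J ` C" by blast
  then show ?thesis by (rule negligible_subset[OF neg])
qed

lemma locally_semiconvex_Diff2_ae:
  fixes u :: "real ^ 'n \<Rightarrow> real"
  assumes "locally_semiconvex_on X u" "x \<in> X"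
  obtains W where "open W" "x \<in> W" "negligible (W - Diff2 X u)"
proof -
  obtain c r \<mu> where cr: "x \<in> ball c r" "ball c r \<subseteq> X" "semiconvex_on \<mu> (ball c r) u"
    using assms unfolding locally_semiconvex_on_def by blast
  define \<rho> where "\<rho> = (dist c x + r) / 2"
  have \<rho>: "dist c x < \<rho>" "\<rho> < r" using cr(1) by (simp_all add: \<rho>_def)
  have \<rho>0: "0 < \<rho>" using \<rho>(1) zero_le_dist[of c x] by linarith
  have "negligible {y \<in> ball c \<rho>. \<not> (\<exists>q B. has_peano_jet (\<lambda>x. u x + \<mu> / 2 * (norm x)\<^sup>2) y q B)}"
    by (rule convex_has_peano_jet_ae[OF _ \<rho>0 \<rho>(2)]) (use cr(3) in \<open>simp add: semiconvex_on_def\<close>)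
  moreover have "ball c \<rho> - Diff2 X u \<subseteq> {y \<in> ball c \<rho>. \<not> (\<exists>q B. has_peano_jet (\<lambda>x. u x + \<mu> / 2 * (norm x)\<^sup>2) y q B)}"
  proof (intro subsetI CollectI conjI notI)
    fix y assume y: "y \<in> ball c \<rho> - Diff2 X u"
    then show "y \<in> ball c \<rho>" by simp
    assume "\<exists>q B. has_peano_jet (\<lambda>x. u x + \<mu> / 2 * (norm x)\<^sup>2) y q B"
    then have "\<exists>q B. has_peano_jet u y q B" using has_peano_jet_remove_half_norm_sq by blast
    moreover have "y \<in> X" using y \<rho>(2) cr(2) by auto
    ultimately show False using y by (simp add: Diff2_def)
  qed
  ultimately have "negligible (ball c \<rho> - Diff2 X u)" by (rule negligible_subset)
  then show thesis using that[of "ball c \<rho>"] \<rho>(1) by simp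
qed

section \<open>Touching paraboloids\<close>

text \<open>This is what semiconvexity is used for: the subgradients of \<open>u + k/2 |.|\<^sup>2\<close>, after completing the
square at \<open>y\<close>, are paraboloids of opening \<open>- k\<close> that touch \<open>u\<close> from below at \<open>y\<close>. In this form the
constant can be enlarged, the domain shrunk, and functions added, without reference to convexity.\<close>

definition lower_paraboloids :: "real \<Rightarrow> 'a::real_inner set \<Rightarrow> ('a \<Rightarrow> real) \<Rightarrow> bool" where
  "lower_paraboloids k V u \<longleftrightarrow>
     (\<forall>y\<in>V. \<exists>q. \<forall>z\<in>V. u y + q \<bullet> (z - y) - k / 2 * (norm (z - y))\<^sup>2 \<le> u z)"

lemma lower_paraboloids_mono:
  assumes "lower_paraboloids k V u" "W \<subseteq> V" "k \<le> k'"
  shows "lower_paraboloids k' W u"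
  unfolding lower_paraboloids_def
proof
  fix y assume "y \<in> W"
  then obtain q where q: "\<forall>z\<in>V. u y + q \<bullet> (z - y) - k / 2 * (norm (z - y))\<^sup>2 \<le> u z"
    using assms(1,2) unfolding lower_paraboloids_def by blast
  have "u y + q \<bullet> (z - y) - k' / 2 * (norm (z - y))\<^sup>2 \<le> u z" if "z \<in> W" for z
  proof -
    have "k / 2 * (norm (z - y))\<^sup>2 \<le> k' / 2 * (norm (z - y))\<^sup>2"
      using assms(3) by (intro mult_right_mono) auto
    moreover have "u y + q \<bullet> (z - y) - k / 2 * (norm (z - y))\<^sup>2 \<le> u z" using q that assms(2) by blast
    ultimately show ?thesis by linarith
  qed
  then show "\<exists>q. \<forall>z\<in>W. u y + q \<bullet> (z - y) - k' / 2 * (norm (z - y))\<^sup>2 \<le> u z" by blast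
qed

lemma lower_paraboloids_add:
  assumes "lower_paraboloids k V u" "lower_paraboloids l V v"
  shows "lower_paraboloids (k + l) V (\<lambda>y. u y + v y)"
  unfolding lower_paraboloids_def
proof
  fix y assume y: "y \<in> V"
  obtain q where q: "\<forall>z\<in>V. u y + q \<bullet> (z - y) - k / 2 * (norm (z - y))\<^sup>2 \<le> u z"
    using assms(1) y unfolding lower_paraboloids_def by blast
  obtain q' where q': "\<forall>z\<in>V. v y + q' \<bullet> (z - y) - l / 2 * (norm (z - y))\<^sup>2 \<le> v z"
    using assms(2) y unfolding lower_paraboloids_def by blast
  have "u y + v y + (q + q') \<bullet> (z - y) - (k + l) / 2 * (norm (z - y))\<^sup>2 \<le> u z + v z" if "z \<in> V" for z
    using bspec[OF q that] bspec[OF q' that] by (simp add: inner_add_left algebra_simps add_divide_distrib)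
  then show "\<exists>q. \<forall>z\<in>V. u y + v y + q \<bullet> (z - y) - (k + l) / 2 * (norm (z - y))\<^sup>2 \<le> u z + v z" by blast
qed

lemma locally_semiconvex_imp_lower_paraboloids:
  fixes u :: "real ^ 'n \<Rightarrow> real"
  assumes "locally_semiconvex_on X u" "x \<in> X"
  obtains R \<mu> where "0 < R" "0 \<le> \<mu>" "ball x R \<subseteq> X" "lower_paraboloids \<mu> (ball x R) u"
    "continuous_on (ball x R) u"
proof -
  obtain c r \<mu> where cr: "x \<in> ball c r" "ball c r \<subseteq> X" "semiconvex_on \<mu> (ball c r) u"
    using assms unfolding locally_semiconvex_on_def by blast
  define f where "f y = u y + \<mu> / 2 * (norm y)\<^sup>2" for y
  have \<mu>: "0 \<le> \<mu>" and f: "convex_on (ball c r) f"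
    using cr(3) by (auto simp: semiconvex_on_def f_def[abs_def])
  obtain R where R: "0 < R" "ball x R \<subseteq> ball c r" using openE[OF open_ball cr(1)] by blast
  have "lower_paraboloids \<mu> (ball c r) u"
    unfolding lower_paraboloids_def
  proof
    fix y assume y: "y \<in> ball c r"
    obtain q where q: "\<And>z. z \<in> ball c r \<Longrightarrow> f y + q \<bullet> (z - y) \<le> f z"
      using convex_on_subgradient_exists[OF f open_ball y] by blast
    have "u y + (q - \<mu> *\<^sub>R y) \<bullet> (z - y) - \<mu> / 2 * (norm (z - y))\<^sup>2 \<le> u z" if "z \<in> ball c r" for z
    proof -
      have "(\<mu> *\<^sub>R y) \<bullet> (z - y) + \<mu> / 2 * (norm (z - y))\<^sup>2 = \<mu> / 2 * (norm z)\<^sup>2 - \<mu> / 2 * (norm y)\<^sup>2"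
        unfolding power2_norm_eq_inner
        by (simp add: inner_diff_left inner_diff_right inner_commute algebra_simps)
      then show ?thesis using q[OF that] by (simp add: f_def inner_diff_left)
    qed
    then show "\<exists>q. \<forall>z\<in>ball c r. u y + q \<bullet> (z - y) - \<mu> / 2 * (norm (z - y))\<^sup>2 \<le> u z" by blast
  qed
  then have "lower_paraboloids \<mu> (ball x R) u" using R(2) by (rule lower_paraboloids_mono) simp
  moreover have "continuous_on (ball x R) u"
  proof -
    have "continuous_on (ball x R) f"
      using continuous_on_subset[OF convex_on_continuous[OF open_ball f] R(2)] .
    then have "continuous_on (ball x R) (\<lambda>y. f y - \<mu> / 2 * (norm y)\<^sup>2)"
      by (intro continuous_intros)
    then show ?thesis by (simp add: f_def)
  qed
  ultimately show thesis using that R \<mu> cr(2) by blast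
qed

lemma norm_matrix_vector_bound:
  obtains M where "0 \<le> M" "\<And>h. norm ((A :: real ^ 'n ^ 'm) *v h) \<le> M * norm h"
proof -
  obtain K where K: "\<And>h. norm (A *v h) \<le> norm h * K" "K > 0"
    using bounded_linear.pos_bounded[OF matrix_vector_mul_bounded_linear[of A]] by blast
  then show thesis using that[of K] by (simp add: mult.commute)
qed

lemma quadratic_form_bound:
  assumes "\<And>h. norm ((A :: real ^ 'n ^ 'n) *v h) \<le> M * norm h"
  shows "(A *v h) \<bullet> h \<le> M * (norm h)\<^sup>2"
proof -
  have "(A *v h) \<bullet> h \<le> norm (A *v h) * norm h" by (rule norm_cauchy_schwarz)
  also have "\<dots> \<le> M * norm h * norm h" using assms by (intro mult_right_mono) auto
  finally show ?thesis by (simp add: power2_eq_square)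
qed

text \<open>Two paraboloids that touch at \<open>y\<close> and enclose \<open>u\<close> must have the same slope there, since a difference of
slopes is of first order and the gap between the paraboloids of second order.\<close>

lemma GDERIV_between_paraboloids:
  fixes u :: "'a::real_inner \<Rightarrow> real"
  assumes e: "0 < e"
    and lo: "\<And>z. z \<in> ball y e \<Longrightarrow> u y + q \<bullet> (z - y) - k * (norm (z - y))\<^sup>2 \<le> u z"
    and up: "\<And>z. z \<in> ball y e \<Longrightarrow> u z \<le> u y + p \<bullet> (z - y) + l * (norm (z - y))\<^sup>2"
  shows "p = q" "GDERIV u y :> p"
proof -
  define m where "m = \<bar>k\<bar> + \<bar>l\<bar> + 1"
  have m: "m > 0" "k \<le> m" "l \<le> m" "k + l < m" by (auto simp: m_def)
  show eq: "p = q"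
  proof (rule ccontr)
    assume "p \<noteq> q"
    define d where "d = q - p"
    have d: "d \<noteq> 0" using \<open>p \<noteq> q\<close> by (simp add: d_def)
    \<comment> \<open>A step so short that the second-order gap is smaller than the first-order difference.\<close>
    define t where "t = min (1 / m) (e / (2 * norm d))"
    have t: "0 < t" "t \<le> 1 / m" "t * norm d < e"
    proof -
      show "0 < t" using m e d by (simp add: t_def)
      show "t \<le> 1 / m" by (simp add: t_def)
      have "t * norm d \<le> e / (2 * norm d) * norm d" by (intro mult_right_mono) (auto simp: t_def)
      also have "\<dots> < e" using e d by simp
      finally show "t * norm d < e" .
    qed
    have zb: "y + t *\<^sub>R d \<in> ball y e" using t by (simp add: dist_norm)
    have "t * (q \<bullet> d) - t * (p \<bullet> d) \<le> (k + l) * (t * norm d)\<^sup>2"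
      using lo[OF zb] up[OF zb] t(1) by (simp add: algebra_simps)
    also have "t * (q \<bullet> d) - t * (p \<bullet> d) = t * (norm d)\<^sup>2"
      by (simp add: d_def power2_norm_eq_inner inner_diff_left right_diff_distrib)
    also have "(k + l) * (t * norm d)\<^sup>2 = t * (norm d)\<^sup>2 * ((k + l) * t)"
      by (simp add: power2_eq_square)
    finally have "t * (norm d)\<^sup>2 * 1 \<le> t * (norm d)\<^sup>2 * ((k + l) * t)" by simp
    then have "1 \<le> (k + l) * t" using t(1) d by (simp add: mult_le_cancel_left_pos)
    also have "\<dots> < m * t" using m t(1) by (intro mult_strict_right_mono) auto
    also have "\<dots> \<le> 1" using t(2) m(1) by (simp add: field_simps)
    finally show False by simp
  qed
  show "GDERIV u y :> p"
    unfolding gderiv_def has_derivative_at_alt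
  proof (intro conjI bounded_linear_inner_left allI impI)
    fix \<epsilon> :: real assume \<epsilon>: "0 < \<epsilon>"
    show "\<exists>d>0. \<forall>z. norm (z - y) < d \<longrightarrow> norm (u z - u y - (z - y) \<bullet> p) \<le> \<epsilon> * norm (z - y)"
    proof (intro exI[of _ "min e (\<epsilon> / m)"] conjI allI impI)
      show "0 < min e (\<epsilon> / m)" using e \<epsilon> m by simp
      fix z assume z: "norm (z - y) < min e (\<epsilon> / m)"
      then have zb: "z \<in> ball y e" by (simp add: dist_norm norm_minus_commute)
      have "k * (norm (z - y))\<^sup>2 \<le> m * (norm (z - y))\<^sup>2" "l * (norm (z - y))\<^sup>2 \<le> m * (norm (z - y))\<^sup>2"
        using m by (auto intro: mult_right_mono)
      moreover have "q \<bullet> (z - y) = (z - y) \<bullet> p" "p \<bullet> (z - y) = (z - y) \<bullet> p"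
        by (simp_all add: eq inner_commute)
      ultimately have "\<bar>u z - u y - (z - y) \<bullet> p\<bar> \<le> m * (norm (z - y))\<^sup>2"
        using lo[OF zb] up[OF zb] by linarith
      also have "\<dots> = (m * norm (z - y)) * norm (z - y)" by (simp add: power2_eq_square)
      also have "\<dots> \<le> \<epsilon> * norm (z - y)"
        using z m by (intro mult_right_mono) (auto simp: field_simps)
      finally show "norm (u z - u y - (z - y) \<bullet> p) \<le> \<epsilon> * norm (z - y)" by simp
    qed
  qed
qed

text \<open>Where paraboloids touch \<open>w\<close> from both sides, the gradient is Lipschitz. Compare the upper paraboloid at
\<open>z1\<close> with the lower one at \<open>z2\<close> at the point \<open>z2 + \<tau>\<close>, where \<open>\<tau>\<close> has the direction of \<open>p2 - p1\<close> and the
length of \<open>z2 - z1\<close>: all quadratic terms are multiples of \<open>|z2 - z1|\<^sup>2\<close>, and the linear ones leave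
\<open>|p2 - p1| |z2 - z1|\<close>. As \<open>z2\<close> may be any nearby point, the lemma also
yields the continuity of the gradient at the contact point \<open>z1\<close>.\<close>

lemma contact_gradient_lipschitz:
  fixes w :: "'a::real_inner \<Rightarrow> real"
  assumes up: "\<And>y. y \<in> V \<Longrightarrow> w y \<le> w z1 + p1 \<bullet> (y - z1) + M / 2 * (norm (y - z1))\<^sup>2"
    and lo1: "\<And>y. y \<in> V \<Longrightarrow> w z1 + p1 \<bullet> (y - z1) - l / 2 * (norm (y - z1))\<^sup>2 \<le> w y"
    and lo2: "\<And>y. y \<in> V \<Longrightarrow> w z2 + p2 \<bullet> (y - z2) - l / 2 * (norm (y - z2))\<^sup>2 \<le> w y"
    and V: "cball z2 (norm (z2 - z1)) \<subseteq> V" and ne: "z1 \<noteq> z2" and M: "0 \<le> M" and l: "0 \<le> l"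
  shows "norm (p2 - p1) \<le> (2 * M + l) * norm (z2 - z1)"
proof (cases "p1 = p2")
  case True
  then show ?thesis using M l by simp
next
  case False
  define d where "d = norm (z2 - z1)"
  have d: "d > 0" using ne by (simp add: d_def)
  define \<tau> where "\<tau> = (d / norm (p2 - p1)) *\<^sub>R (p2 - p1)"
  have n\<tau>: "norm \<tau> = d" using False d by (simp add: \<tau>_def)
  define y where "y = z2 + \<tau>"
  have yV: "y \<in> V" using V n\<tau> by (auto simp: y_def d_def dist_norm)
  have z2V: "z2 \<in> V" using V by auto
  have "norm (y - z1) \<le> norm \<tau> + norm (z2 - z1)"
    using norm_triangle_ineq[of \<tau> "z2 - z1"] by (simp add: y_def algebra_simps)
  then have "norm (y - z1) \<le> 2 * d" using n\<tau> by (simp add: d_def)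
  then have "(norm (y - z1))\<^sup>2 \<le> (2 * d)\<^sup>2" by (intro power_mono) auto
  then have "M / 2 * (norm (y - z1))\<^sup>2 \<le> M / 2 * (2 * d)\<^sup>2" using M by (intro mult_left_mono) auto
  then have "w y \<le> w z1 + p1 \<bullet> (y - z1) + 2 * M * d\<^sup>2"
    using up[OF yV] by (simp add: power_mult_distrib)
  moreover have "w z2 + p2 \<bullet> \<tau> - l / 2 * d\<^sup>2 \<le> w y"
    using lo2[OF yV] n\<tau> by (simp add: y_def)
  moreover have "w z1 + p1 \<bullet> (z2 - z1) - l / 2 * d\<^sup>2 \<le> w z2"
    using lo1[OF z2V] by (simp add: d_def)
  moreover have "p1 \<bullet> (y - z1) = p1 \<bullet> (z2 - z1) + p1 \<bullet> \<tau>" 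
    by (simp add: y_def inner_diff_right inner_add_right)
  ultimately have "p2 \<bullet> \<tau> - p1 \<bullet> \<tau> \<le> 2 * M * d\<^sup>2 + l * d\<^sup>2" by (simp add: field_simps)
  also have "p2 \<bullet> \<tau> - p1 \<bullet> \<tau> = d * norm (p2 - p1)"
  proof -
    have "p2 \<bullet> \<tau> - p1 \<bullet> \<tau> = d / norm (p2 - p1) * ((p2 - p1) \<bullet> (p2 - p1))"
      by (simp add: \<tau>_def inner_diff_left right_diff_distrib diff_divide_distrib)
    also have "\<dots> = d * norm (p2 - p1)"
      using False by (simp add: power2_norm_eq_inner[symmetric] power2_eq_square)
    finally show ?thesis .
  qed
  finally have "d * norm (p2 - p1) \<le> d * ((2 * M + l) * d)"
    by (simp add: power2_eq_square algebra_simps)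
  then show ?thesis using d unfolding d_def[symmetric] by simp
qed

lemma upper_contact_jet_iff_ball:
  fixes u :: "real ^ 'n \<Rightarrow> real"
  assumes "open X"
  shows "upper_contact_jet X u x p A \<longleftrightarrow> x \<in> X \<and> symmetric_matrix A \<and>
     (\<exists>R>0. ball x R \<subseteq> X \<and> (\<forall>y\<in>ball x R. u y \<le> u x + p \<bullet> (y - x) + 1 / 2 * ((A *v (y - x)) \<bullet> (y - x))))"
    (is "_ \<longleftrightarrow> ?R")
proof
  assume L: "upper_contact_jet X u x p A"
  then have x: "x \<in> X" "symmetric_matrix A" by (auto simp: upper_contact_jet_def)
  obtain d where d: "d > 0" "\<And>y. y \<in> X \<Longrightarrow> y \<noteq> x \<Longrightarrow> dist y x < d \<Longrightarrow>
      u y \<le> u x + p \<bullet> (y - x) + 1 / 2 * ((A *v (y - x)) \<bullet> (y - x))"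
    using L unfolding upper_contact_jet_def eventually_at by blast
  obtain e where e: "e > 0" "ball x e \<subseteq> X" using assms x(1) by (rule openE)
  have "u y \<le> u x + p \<bullet> (y - x) + 1 / 2 * ((A *v (y - x)) \<bullet> (y - x))" if "y \<in> ball x (min d e)" for y
    using that d(2)[of y] e(2) by (cases "y = x") (auto simp: dist_commute)
  then show ?R using x d(1) e by (intro conjI exI[of _ "min d e"]) auto
next
  assume ?R
  then obtain R where R: "R > 0" "\<And>y. y \<in> ball x R \<Longrightarrow> u y \<le> u x + p \<bullet> (y - x) + 1 / 2 * ((A *v (y - x)) \<bullet> (y - x))"
    and x: "x \<in> X" "symmetric_matrix A" by blast
  have "\<forall>\<^sub>F y in at x within X. u y \<le> u x + p \<bullet> (y - x) + 1 / 2 * ((A *v (y - x)) \<bullet> (y - x))"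
    unfolding eventually_at using R by (intro exI[of _ R]) (auto simp: dist_commute)
  then show "upper_contact_jet X u x p A" using x by (simp add: upper_contact_jet_def)
qed

text \<open>In \<open>u = (u + v) - v\<close> both terms lie below a paraboloid that touches at \<open>x\<close>.\<close>

lemma upper_contact_jet_summand:
  fixes u v :: "real ^ 'n \<Rightarrow> real"
  assumes X: "open X" and jet: "upper_contact_jet X (\<lambda>y. u y + v y) x p A"
    and R: "0 < R" and v: "lower_paraboloids k (ball x R) v"
  obtains q where "upper_contact_jet X u x q (A + k *\<^sub>R mat 1)"
proof -
  obtain r where r: "r > 0" "ball x r \<subseteq> X"
      "\<forall>y\<in>ball x r. u y + v y \<le> u x + v x + p \<bullet> (y - x) + 1 / 2 * ((A *v (y - x)) \<bullet> (y - x))"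
    and x: "x \<in> X" "symmetric_matrix A"
    using jet unfolding upper_contact_jet_iff_ball[OF X] by blast
  have "x \<in> ball x R" using R by simp
  then obtain q where q: "\<forall>z\<in>ball x R. v x + q \<bullet> (z - x) - k / 2 * (norm (z - x))\<^sup>2 \<le> v z"
    using v unfolding lower_paraboloids_def by blast
  have "u y \<le> u x + (p - q) \<bullet> (y - x) + 1 / 2 * (((A + k *\<^sub>R mat 1) *v (y - x)) \<bullet> (y - x))"
    if "y \<in> ball x (min r R)" for y
  proof -
    have "((A + k *\<^sub>R mat 1) *v (y - x)) \<bullet> (y - x) = (A *v (y - x)) \<bullet> (y - x) + k * (norm (y - x))\<^sup>2"
      by (simp add: matrix_vector_mult_add_rdistrib scaleR_mat_vector_mult inner_add_left power2_norm_eq_inner)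
    moreover have "u y + v y \<le> u x + v x + p \<bullet> (y - x) + 1 / 2 * ((A *v (y - x)) \<bullet> (y - x))"
      "v x + q \<bullet> (y - x) - k / 2 * (norm (y - x))\<^sup>2 \<le> v y"
      using r(3) q that by auto
    ultimately show ?thesis by (simp add: inner_diff_left field_simps)
  qed
  then have "upper_contact_jet X u x (p - q) (A + k *\<^sub>R mat 1)"
    unfolding upper_contact_jet_iff_ball[OF X]
    using x r(1,2) R by (auto intro!: exI[of _ "min r R"] symmetric_matrix_add symmetric_matrix_scaleR_mat)
  then show thesis by (rule that)
qed

lemma upper_contact_jet_paraboloid:
  fixes u :: "real ^ 'n \<Rightarrow> real"
  assumes "open X" "upper_contact_jet X u x p A"
  obtains r M where "0 < r" "0 \<le> M" "ball x r \<subseteq> X"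
    "\<And>y. y \<in> ball x r \<Longrightarrow> u y \<le> u x + p \<bullet> (y - x) + M / 2 * (norm (y - x))\<^sup>2"
proof -
  obtain r where r: "r > 0" "ball x r \<subseteq> X"
      "\<forall>y\<in>ball x r. u y \<le> u x + p \<bullet> (y - x) + 1 / 2 * ((A *v (y - x)) \<bullet> (y - x))"
    using assms(2) unfolding upper_contact_jet_iff_ball[OF assms(1)] by blast
  obtain M where M: "0 \<le> M" "\<And>h. norm (A *v h) \<le> M * norm h"
    using norm_matrix_vector_bound[of A] by blast
  have "u y \<le> u x + p \<bullet> (y - x) + M / 2 * (norm (y - x))\<^sup>2" if "y \<in> ball x r" for y
    using bspec[OF r(3) that] quadratic_form_bound[OF M(2), of "y - x"] by simp
  then show thesis using that r(1,2) M(1) by blast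
qed

lemma upper_contact_jet_GDERIV:
  fixes u :: "real ^ 'n \<Rightarrow> real"
  assumes X: "open X" and R: "0 < R" and u: "lower_paraboloids k (ball x R) u"
    and jet: "upper_contact_jet X u x p A"
  shows "GDERIV u x :> p"
proof -
  obtain r M where r: "0 < r" "0 \<le> M" 
    "\<And>y. y \<in> ball x r \<Longrightarrow> u y \<le> u x + p \<bullet> (y - x) + M / 2 * (norm (y - x))\<^sup>2"
    using upper_contact_jet_paraboloid[OF X jet] by metis
  have "x \<in> ball x R" using R by simp
  then obtain q where q: "\<forall>z\<in>ball x R. u x + q \<bullet> (z - x) - k / 2 * (norm (z - x))\<^sup>2 \<le> u z"
    using u unfolding lower_paraboloids_def by blast
  show ?thesis
    by (rule GDERIV_between_paraboloids(2)[of "min r R" x u q "k / 2" p "M / 2"]) (use r q R in auto)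
qed

text \<open>The Peano expansion provides a paraboloid from above, to be compared with the given one from below.\<close>

lemma lower_paraboloid_slope_eq_grad:
  fixes u :: "real ^ 'n \<Rightarrow> real"
  assumes "0 < e" and lo: "\<And>y. y \<in> ball z e \<Longrightarrow> u z + q \<bullet> (y - z) - k * (norm (y - z))\<^sup>2 \<le> u y"
    and jet: "has_peano_jet u z p B"
  shows "grad u z = q"
proof -
  obtain M where M: "0 \<le> M" "\<And>h. norm (B *v h) \<le> M * norm h"
    using norm_matrix_vector_bound[of B] by blast
  have "(1::real) > 0" by simp
  then obtain \<delta> where \<delta>: "\<delta> > 0" "\<And>y. norm (y - z) < \<delta> \<Longrightarrow>
       \<bar>u y - (u z + p \<bullet> (y - z) + 1 / 2 * ((B *v (y - z)) \<bullet> (y - z)))\<bar> \<le> 1 * (norm (y - z))\<^sup>2"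
    using jet unfolding has_peano_jet_iff by blast
  have up: "u y \<le> u z + p \<bullet> (y - z) + (M / 2 + 1) * (norm (y - z))\<^sup>2" if "y \<in> ball z \<delta>" for y
  proof -
    have "u y - (u z + p \<bullet> (y - z) + 1 / 2 * ((B *v (y - z)) \<bullet> (y - z))) \<le> (norm (y - z))\<^sup>2"
      using \<delta>(2)[of y] that by (simp add: dist_norm norm_minus_commute abs_le_iff)
    then show ?thesis using quadratic_form_bound[OF M(2), of "y - z"] by (simp add: algebra_simps)
  qed
  have "p = q"
    by (rule GDERIV_between_paraboloids(1)[of "min \<delta> e" z u q k p "M / 2 + 1"]) (use assms \<delta> up in auto)
  then show ?thesis using has_peano_jet_grad_hess[OF jet] by simp
qed

lemma quadratic_form_scaleR: "((B :: real ^ 'n ^ 'n) *v (s *\<^sub>R h)) \<bullet> (s *\<^sub>R h) = s\<^sup>2 * ((B *v h) \<bullet> h)"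
  by (simp add: matrix_vector_mult_scaleR power2_eq_square)

text \<open>The symmetric second difference cancels the slopes. Hessians can thus be compared with touching paraboloids
from above or below, whatever their slopes are.\<close>

lemma has_peano_jet_second_difference:
  fixes u :: "real ^ 'n \<Rightarrow> real"
  assumes jet: "has_peano_jet u z q B" and e: "0 < \<epsilon>"
  obtains \<delta> where "0 < \<delta>" "\<And>t. \<bar>t\<bar> < \<delta> \<Longrightarrow>
     \<bar>u (z + t *\<^sub>R h) + u (z - t *\<^sub>R h) - 2 * u z - t\<^sup>2 * ((B *v h) \<bullet> h)\<bar> \<le> \<epsilon> * t\<^sup>2"
proof -
  define N where "N = (norm h)\<^sup>2 + 1"
  have N: "0 < N" "(norm h)\<^sup>2 \<le> N" by (simp_all add: N_def add_nonneg_pos)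
  define \<eta> where "\<eta> = \<epsilon> / (2 * N)"
  have \<eta>: "\<eta> > 0" using e N by (simp add: \<eta>_def)
  obtain \<delta> where \<delta>: "\<delta> > 0" "\<And>y. norm (y - z) < \<delta> \<Longrightarrow>
       \<bar>u y - (u z + q \<bullet> (y - z) + 1 / 2 * ((B *v (y - z)) \<bullet> (y - z)))\<bar> \<le> \<eta> * (norm (y - z))\<^sup>2"
    using jet \<eta> unfolding has_peano_jet_iff by blast
  show thesis
  proof (rule that[of "\<delta> / (norm h + 1)"])
    show "0 < \<delta> / (norm h + 1)" using \<delta>(1) by (simp add: add_nonneg_pos)
    fix t :: real assume t: "\<bar>t\<bar> < \<delta> / (norm h + 1)"
    have "0 < norm h + 1" by (simp add: add_nonneg_pos)
    then have "\<bar>t\<bar> * (norm h + 1) < \<delta>" using t by (simp add: pos_less_divide_eq)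
    then have th: "\<bar>t\<bar> * norm h < \<delta>" by (simp add: algebra_simps)
    have 1: "\<bar>u (z + s *\<^sub>R h) - (u z + s * (q \<bullet> h) + 1 / 2 * (s\<^sup>2 * ((B *v h) \<bullet> h)))\<bar> \<le> \<eta> * (s\<^sup>2 * (norm h)\<^sup>2)"
      if "\<bar>s\<bar> = \<bar>t\<bar>" for s
    proof -
      have "norm (z + s *\<^sub>R h - z) < \<delta>" using th that by simp
      moreover have "(norm (s *\<^sub>R h))\<^sup>2 = s\<^sup>2 * (norm h)\<^sup>2" by (simp add: power_mult_distrib)
      ultimately show ?thesis
        using \<delta>(2)[of "z + s *\<^sub>R h"]
        by (simp only: add_diff_cancel_left' quadratic_form_scaleR inner_scaleR_right[of q])
    qed
    have "\<bar>u (z + t *\<^sub>R h) - (u z + t * (q \<bullet> h) + 1 / 2 * (t\<^sup>2 * ((B *v h) \<bullet> h)))\<bar> \<le> \<eta> * (t\<^sup>2 * (norm h)\<^sup>2)"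
      "\<bar>u (z - t *\<^sub>R h) - (u z - t * (q \<bullet> h) + 1 / 2 * (t\<^sup>2 * ((B *v h) \<bullet> h)))\<bar> \<le> \<eta> * (t\<^sup>2 * (norm h)\<^sup>2)"
      using 1[of t] 1[of "- t"] by simp_all
    then have "\<bar>u (z + t *\<^sub>R h) + u (z - t *\<^sub>R h) - 2 * u z - t\<^sup>2 * ((B *v h) \<bullet> h)\<bar> \<le> 2 * (\<eta> * (t\<^sup>2 * (norm h)\<^sup>2))"
      by linarith
    also have "\<dots> \<le> \<epsilon> * t\<^sup>2"
    proof -
      have "2 * \<eta> * (norm h)\<^sup>2 \<le> 2 * \<eta> * N" using \<eta> N by (intro mult_left_mono) auto
      also have "\<dots> = \<epsilon>" using N by (simp add: \<eta>_def)
      finally have "2 * \<eta> * (norm h)\<^sup>2 * t\<^sup>2 \<le> \<epsilon> * t\<^sup>2" by (intro mult_right_mono) auto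
      then show ?thesis by (simp add: mult_ac)
    qed
    finally show "\<bar>u (z + t *\<^sub>R h) + u (z - t *\<^sub>R h) - 2 * u z - t\<^sup>2 * ((B *v h) \<bullet> h)\<bar> \<le> \<epsilon> * t\<^sup>2" .
  qed
qed

lemma has_peano_jet_hessian_le:
  fixes u :: "real ^ 'n \<Rightarrow> real"
  assumes jet: "has_peano_jet u z q B" and e: "0 < e"
    and up: "\<And>y. y \<in> ball z e \<Longrightarrow> u y \<le> u z + a \<bullet> (y - z) + 1 / 2 * ((A *v (y - z)) \<bullet> (y - z))"
  shows "(B *v h) \<bullet> h \<le> (A *v h) \<bullet> h"
proof (rule field_le_epsilon)
  fix \<epsilon> :: real assume "0 < \<epsilon>"
  then obtain \<delta> where \<delta>: "0 < \<delta>" "\<And>t. \<bar>t\<bar> < \<delta> \<Longrightarrow>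
     \<bar>u (z + t *\<^sub>R h) + u (z - t *\<^sub>R h) - 2 * u z - t\<^sup>2 * ((B *v h) \<bullet> h)\<bar> \<le> \<epsilon> * t\<^sup>2"
    using has_peano_jet_second_difference[OF jet, of \<epsilon> h] by blast
  define N where "N = norm h + 1"
  have N: "0 < N" "norm h \<le> N" by (simp_all add: N_def add_nonneg_pos)
  define t where "t = min (\<delta> / 2) (e / (2 * N))"
  have t: "0 < t" "t < \<delta>" "t * norm h < e"
  proof -
    show "0 < t" using \<delta>(1) e N by (simp add: t_def)
    show "t < \<delta>" using \<delta>(1) by (simp add: t_def)
    have "t * norm h \<le> t * N" using \<open>0 < t\<close> N by (intro mult_left_mono) auto
    also have "\<dots> \<le> e / (2 * N) * N" using N by (intro mult_right_mono) (auto simp: t_def)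
    also have "\<dots> = e / 2" using N by simp
    finally show "t * norm h < e" using e by simp
  qed
  have "u (z + s *\<^sub>R h) \<le> u z + s * (a \<bullet> h) + 1 / 2 * (s\<^sup>2 * ((A *v h) \<bullet> h))" if "\<bar>s\<bar> = t" for s
    using up[of "z + s *\<^sub>R h"] that t(3)
    by (simp only: add_diff_cancel_left' quadratic_form_scaleR inner_scaleR_right[of a]) (simp add: dist_norm)
  from this[of t] this[of "- t"]
  have "u (z + t *\<^sub>R h) + u (z - t *\<^sub>R h) - 2 * u z \<le> t\<^sup>2 * ((A *v h) \<bullet> h)"
    using t(1) by simp
  then have "t\<^sup>2 * ((B *v h) \<bullet> h) \<le> t\<^sup>2 * ((A *v h) \<bullet> h + \<epsilon>)"
    using \<delta>(2)[of t] t by (simp add: abs_le_iff algebra_simps)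
  then show "(B *v h) \<bullet> h \<le> (A *v h) \<bullet> h + \<epsilon>" using t(1) by (simp add: mult_le_cancel_left_pos)
qed

lemma has_peano_jet_uminus:
  assumes "has_peano_jet u z q B"
  shows "has_peano_jet (\<lambda>y. - u y) z (- q) (- B)"
proof -
  have "- u y - (- u z + (- q) \<bullet> (y - z) + 1 / 2 * (((- B) *v (y - z)) \<bullet> (y - z)))
      = - (u y - (u z + q \<bullet> (y - z) + 1 / 2 * ((B *v (y - z)) \<bullet> (y - z))))" for y
    using matrix_vector_mult_diff_rdistrib[of 0 B "y - z"] by simp
  moreover have "symmetric_matrix (- B)"
    using assms by (simp add: has_peano_jet_def symmetric_matrix_def transpose_def vec_eq_iff)
  ultimately show ?thesis
    using assms unfolding has_peano_jet_iff by (simp only: abs_minus_cancel) blast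
qed

lemma has_peano_jet_hessian_ge:
  fixes u :: "real ^ 'n \<Rightarrow> real"
  assumes jet: "has_peano_jet u z q B" and e: "0 < e"
    and lo: "\<And>y. y \<in> ball z e \<Longrightarrow> u z + a \<bullet> (y - z) - k / 2 * (norm (y - z))\<^sup>2 \<le> u y"
  shows "- k * (norm h)\<^sup>2 \<le> (B *v h) \<bullet> h"
proof -
  have "((- B) *v h) \<bullet> h \<le> ((k *\<^sub>R mat 1) *v h) \<bullet> h"
  proof (rule has_peano_jet_hessian_le[OF has_peano_jet_uminus[OF jet] e])
    fix y assume "y \<in> ball z e"
    from lo[OF this] show "- u y \<le> - u z + (- a) \<bullet> (y - z) + 1 / 2 * ((k *\<^sub>R mat 1 *v (y - z)) \<bullet> (y - z))"
      by (simp add: scaleR_mat_vector_mult power2_norm_eq_inner)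
  qed
  moreover have "(- B) *v h = - (B *v h)" using matrix_vector_mult_diff_rdistrib[of 0 B h] by simp
  ultimately show ?thesis by (simp add: scaleR_mat_vector_mult power2_norm_eq_inner)
qed

section \<open>Jensen's lemma\<close>

lemma quadratic_form_add:
  fixes A :: "real ^ 'n ^ 'n"
  assumes "symmetric_matrix A"
  shows "(A *v (a + b)) \<bullet> (a + b) = (A *v a) \<bullet> a + 2 * ((A *v a) \<bullet> b) + (A *v b) \<bullet> b"
proof -
  have "(A *v b) \<bullet> a = (A *v a) \<bullet> b"
    using assms unfolding symmetric_matrix_def
    by (metis dot_lmul_matrix inner_commute transpose_matrix_vector)
  then show ?thesis by (simp add: matrix_vector_right_distrib inner_add_left inner_add_right)
qed

text \<open>Let \<open>\<phi>\<close> be the paraboloid with slope \<open>p\<close> and matrix \<open>A' = A + \<epsilon> I\<close> that touches \<open>w\<close> at \<open>x\<close>. The surplus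
\<open>\<epsilon> I\<close> makes the contact strict. Therefore, for every small vector \<open>b\<close>, the maximum of
\<open>w - \<phi> - b \<bullet> (. - x)\<close> over a small ball \<open>K\<close> is attained close to \<open>x\<close>. A maximizer \<open>z\<close> is a contact point
with the matrix \<open>A'\<close>, and \<open>b\<close> can be recovered from it as \<open>b = G z\<close>, where \<open>G\<close> is the difference of
the gradients of \<open>w\<close> and \<open>\<phi>\<close>. So \<open>G\<close> maps the set \<open>P\<close> of contact points onto a set containing a ball.
Because \<open>w\<close> has touching paraboloids from both sides on \<open>P\<close>, its gradient and hence \<open>G\<close> are Lipschitz
on \<open>P\<close>. A null set \<open>P\<close> would have a null image.\<close>

lemma jensen_contact_points_not_negligible:
  fixes w :: "real ^ 'n \<Rightarrow> real"
  assumes X: "open X" and R: "0 < R" "ball x R \<subseteq> X" and l: "0 \<le> l"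
    and low: "lower_paraboloids l (ball x R) w" and cont: "continuous_on (ball x R) w"
    and jet: "upper_contact_jet X w x p A" and \<epsilon>: "0 < \<epsilon>" and r: "0 < r"
  shows "\<not> negligible {z \<in> ball x r. \<exists>a. upper_contact_jet X w z a (A + \<epsilon> *\<^sub>R mat 1)}"
proof -
  obtain s where s: "s > 0" "\<forall>y\<in>ball x s. w y \<le> w x + p \<bullet> (y - x) + 1 / 2 * ((A *v (y - x)) \<bullet> (y - x))"
    and A: "symmetric_matrix A"
    using jet unfolding upper_contact_jet_iff_ball[OF X] by blast
  define \<rho> where "\<rho> = min r (min R s) / 2"
  have \<rho>: "0 < \<rho>" "\<rho> < r" "\<rho> < R" "\<rho> < s" using r R s by (auto simp: \<rho>_def)
  define K where "K = cball x \<rho>"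
  have K: "compact K" "x \<in> K" "K \<subseteq> ball x R" "K \<subseteq> ball x s" using \<rho> by (auto simp: K_def)
  define A' where "A' = A + \<epsilon> *\<^sub>R mat 1"
  have A': "symmetric_matrix A'"
    unfolding A'_def by (intro symmetric_matrix_add A symmetric_matrix_scaleR_mat)
  have A'h: "(A' *v h) \<bullet> h = (A *v h) \<bullet> h + \<epsilon> * (norm h)\<^sup>2" for h
    by (simp add: A'_def matrix_vector_mult_add_rdistrib scaleR_mat_vector_mult inner_add_left power2_norm_eq_inner)
  obtain M where M: "0 \<le> M" "\<And>h. norm (A' *v h) \<le> M * norm h"
    using norm_matrix_vector_bound[of A'] by blast
  define contact where "contact z a \<longleftrightarrow>
     (\<forall>y\<in>K. w y \<le> w z + a \<bullet> (y - z) + 1 / 2 * ((A' *v (y - z)) \<bullet> (y - z)))" for z a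
  \<comment> \<open>With contact points this close to \<open>x\<close>, a ball around one of them reaching to another one stays in \<open>K\<close>.\<close>
  define P where "P = {z \<in> ball x (\<rho> / 3). \<exists>a. contact z a}"
  have contact_jet: "upper_contact_jet X w z a A'" if "z \<in> ball x (\<rho> / 3)" "contact z a" for z a
  proof -
    have "z \<in> ball x \<rho>" using that(1) \<rho>(1) by simp
    then obtain e where e: "e > 0" "ball z e \<subseteq> ball x \<rho>" using openE[OF open_ball] by blast
    have "ball x \<rho> \<subseteq> X" using \<rho>(3) R(2) subset_ball[of \<rho> R x] by auto
    then have "ball z e \<subseteq> K" "ball z e \<subseteq> X" "z \<in> X" 
      using e(2) \<open>z \<in> ball x \<rho>\<close> by (auto simp: K_def)
    then show ?thesis
      unfolding upper_contact_jet_iff_ball[OF X] using A' e(1) that(2) by (auto simp: contact_def)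
  qed
  have contact_up: "w y \<le> w z + a \<bullet> (y - z) + M / 2 * (norm (y - z))\<^sup>2" if "contact z a" "y \<in> ball x \<rho>" for z a y
  proof -
    have "y \<in> K" using that(2) by (simp add: K_def)
    then have "w y \<le> w z + a \<bullet> (y - z) + 1 / 2 * ((A' *v (y - z)) \<bullet> (y - z))"
      using that(1) by (simp add: contact_def)
    then show ?thesis using quadratic_form_bound[OF M(2), of "y - z"] by simp
  qed
  have slope: "w z + a \<bullet> (y - z) - l / 2 * (norm (y - z))\<^sup>2 \<le> w y"
    if z: "z \<in> ball x (\<rho> / 3)" "contact z a" and y: "y \<in> ball x \<rho>" for z a y
  proof -
    have zR: "z \<in> ball x R" using z(1) \<rho> by simp
    then obtain q where q: "\<forall>y\<in>ball x R. w z + q \<bullet> (y - z) - l / 2 * (norm (y - z))\<^sup>2 \<le> w y"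
      using low unfolding lower_paraboloids_def by blast
    have "z \<in> ball x \<rho>" using z(1) \<rho>(1) by simp
    then obtain e where e: "e > 0" "ball z e \<subseteq> ball x \<rho>" using openE[OF open_ball] by blast
    have "a = q"
    proof (rule GDERIV_between_paraboloids(1)[OF e(1)])
      fix y assume "y \<in> ball z e"
      then have "y \<in> ball x \<rho>" using e(2) by blast
      then show "w y \<le> w z + a \<bullet> (y - z) + M / 2 * (norm (y - z))\<^sup>2" by (rule contact_up[OF z(2)])
      have "y \<in> ball x R" using \<open>y \<in> ball x \<rho>\<close> \<rho>(3) by simp
      then show "w z + q \<bullet> (y - z) - l / 2 * (norm (y - z))\<^sup>2 \<le> w y" using q by blast
    qed
    moreover have "y \<in> ball x R" using y \<rho>(3) by simp
    ultimately show ?thesis using q by blast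
  qed
  have slope_lip: "norm (a2 - a1) \<le> (2 * M + l) * norm (z2 - z1)"
    if z: "z1 \<in> ball x (\<rho> / 3)" "z2 \<in> ball x (\<rho> / 3)" "contact z1 a1" "contact z2 a2" "z1 \<noteq> z2" for z1 z2 a1 a2
  proof (rule contact_gradient_lipschitz[where V = "ball x \<rho>" and w = w])
    show "cball z2 (norm (z2 - z1)) \<subseteq> ball x \<rho>"
    proof
      fix y assume "y \<in> cball z2 (norm (z2 - z1))"
      then show "y \<in> ball x \<rho>"
        using z(1,2) dist_triangle[of x y z2] dist_triangle[of z2 z1 x] by (simp add: dist_norm norm_minus_commute)
    qed
  qed (use z M(1) l contact_up slope in auto)
  define g where "g z = (SOME a. contact z a)" for z
  have g: "contact z (g z)" if "z \<in> P" for z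
    using that unfolding P_def g_def by (auto intro: someI_ex)
  have g_eq: "g z = a" if "z \<in> ball x (\<rho> / 3)" "contact z a" for z a
  proof -
    have z: "z \<in> P" using that by (auto simp: P_def)
    have low': "w z + g z \<bullet> (y - z) - l / 2 * (norm (y - z))\<^sup>2 \<le> w y" if "y \<in> ball x \<rho>" for y
      using slope[OF _ g[OF z] that] z by (simp add: P_def)
    have "z \<in> ball x \<rho>" using that(1) \<rho>(1) by simp
    then obtain e where e: "e > 0" "ball z e \<subseteq> ball x \<rho>" using openE[OF open_ball] by blast
    have "a = g z"
      by (rule GDERIV_between_paraboloids(1)[where e = e and y = z and u = w and k = "l / 2" and l = "M / 2"])
         (use low' contact_up[OF that(2)] e in auto)
    then show ?thesis by simp
  qed
  define G where "G z = g z - p - A' *v (z - x)" for z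
  \<comment> \<open>A maximizer for \<open>b\<close> has distance at most \<open>2 |b| / \<epsilon>\<close> from \<open>x\<close>, which has to be below \<open>\<rho> / 3\<close>.\<close>
  define \<delta> where "\<delta> = \<epsilon> * \<rho> / 6"
  have \<delta>: "\<delta> > 0" using \<epsilon> \<rho>(1) by (simp add: \<delta>_def)
  have onto: "ball 0 \<delta> \<subseteq> G ` P"
  proof
    fix b :: "real ^ 'n" assume b: "b \<in> ball 0 \<delta>"
    define \<theta> where "\<theta> y = w y - (w x + p \<bullet> (y - x) + 1 / 2 * ((A' *v (y - x)) \<bullet> (y - x))) - b \<bullet> (y - x)" for y
    have "continuous_on K \<theta>"
      unfolding \<theta>_def
      by (intro continuous_intros continuous_on_subset[OF cont K(3)]
            matrix_vector_mult_linear_continuous_on[THEN continuous_on_compose2]) auto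
    then obtain z where z: "z \<in> K" "\<And>y. y \<in> K \<Longrightarrow> \<theta> y \<le> \<theta> z"
      using continuous_attains_sup[of K \<theta>] K by blast
    \<comment> \<open>The value at the maximizer is at least the value 0 at \<open>x\<close>.\<close>
    have "0 \<le> \<theta> z" using z(2)[OF K(2)] by (simp add: \<theta>_def)
    moreover have "w z \<le> w x + p \<bullet> (z - x) + 1 / 2 * ((A *v (z - x)) \<bullet> (z - x))"
      using s(2) K(4) z(1) by blast
    ultimately have "\<epsilon> / 2 * (norm (z - x))\<^sup>2 \<le> - (b \<bullet> (z - x))"
      unfolding \<theta>_def A'h by (simp add: algebra_simps)
    also have "\<dots> \<le> norm b * norm (z - x)"
      using Cauchy_Schwarz_ineq2[of b "z - x"] by (simp add: abs_le_iff)
    finally have "norm (z - x) * (\<epsilon> / 2 * norm (z - x)) \<le> norm (z - x) * norm b"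
      by (simp add: power2_eq_square mult_ac)
    then have "\<epsilon> / 2 * norm (z - x) \<le> norm b"
      by (cases "z = x") (auto simp: mult_le_cancel_left)
    also have "norm b < \<epsilon> * \<rho> / 6" using b by (simp add: \<delta>_def)
    finally have "\<epsilon> * norm (z - x) < \<epsilon> * (\<rho> / 3)" by simp
    then have zb: "z \<in> ball x (\<rho> / 3)"
      using \<epsilon> by (simp add: mult_less_cancel_left_pos dist_norm norm_minus_commute)
    have "contact z (p + A' *v (z - x) + b)"
      unfolding contact_def
    proof
      fix y assume "y \<in> K"
      then have "\<theta> y \<le> \<theta> z" by (rule z)
      moreover have "y - x = (z - x) + (y - z)" by simp
      then have "(A' *v (y - x)) \<bullet> (y - x)
         = (A' *v (z - x)) \<bullet> (z - x) + 2 * ((A' *v (z - x)) \<bullet> (y - z)) + (A' *v (y - z)) \<bullet> (y - z)"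
        using quadratic_form_add[OF A', of "z - x" "y - z"] by simp
      moreover have "p \<bullet> (y - x) = p \<bullet> (z - x) + p \<bullet> (y - z)" "b \<bullet> (y - x) = b \<bullet> (z - x) + b \<bullet> (y - z)"
        by (simp_all add: inner_diff_right)
      ultimately show "w y \<le> w z + (p + A' *v (z - x) + b) \<bullet> (y - z) + 1 / 2 * ((A' *v (y - z)) \<bullet> (y - z))"
        unfolding \<theta>_def inner_add_left by linarith
    qed
    from g_eq[OF zb this] have "G z = b" by (simp add: G_def)
    moreover have "z \<in> P" using zb \<open>contact z _\<close> by (auto simp: P_def)
    ultimately show "b \<in> G ` P" by blast
  qed
  have "\<not> negligible P"
  proof
    assume "negligible P"
    then have "negligible (G ` P)"
    proof (rule negligible_locally_Lipschitz_image[rotated])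
      fix z assume z: "z \<in> P"
      have "norm (G y - G z) \<le> (3 * M + l) * norm (y - z)" if y: "y \<in> P" for y
      proof (cases "y = z")
        case False
        have "norm (g y - g z) \<le> (2 * M + l) * norm (y - z)"
          using slope_lip[of z y "g z" "g y"] g[OF z] g[OF y] y z False by (simp add: P_def)
        moreover have "norm (A' *v (y - z)) \<le> M * norm (y - z)" by (rule M)
        moreover have "G y - G z = (g y - g z) - A' *v (y - z)"
          by (simp add: G_def matrix_vector_mult_diff_distrib)
        then have "norm (G y - G z) = norm ((g y - g z) - A' *v (y - z))" by (rule arg_cong)
        moreover have "norm (g y - g z - A' *v (y - z)) \<le> norm (g y - g z) + norm (A' *v (y - z))"
          by (rule norm_triangle_ineq4)
        ultimately have "norm (G y - G z) \<le> (2 * M + l) * norm (y - z) + M * norm (y - z)"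
          by linarith
        then show ?thesis by (simp add: algebra_simps)
      qed simp
      then show "\<exists>T B. open T \<and> z \<in> T \<and> (\<forall>y\<in>P \<inter> T. norm (G y - G z) \<le> B * norm (y - z))"
        by (intro exI[of _ UNIV] exI[of _ "3 * M + l"]) auto
    qed simp
    then have "negligible (ball (0 :: real ^ 'n) \<delta>)" using onto negligible_subset by blast
    then show False using \<delta> open_not_negligible[of "ball (0 :: real ^ 'n) \<delta>"] by simp
  qed
  moreover have "P \<subseteq> {z \<in> ball x r. \<exists>a. upper_contact_jet X w z a (A + \<epsilon> *\<^sub>R mat 1)}"
  proof
    fix z assume "z \<in> P"
    then obtain a where "z \<in> ball x (\<rho> / 3)" "contact z a" by (auto simp: P_def)
    moreover have "ball x (\<rho> / 3) \<subseteq> ball x r" using \<rho>(1,2) by auto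
    ultimately show "z \<in> {z \<in> ball x r. \<exists>a. upper_contact_jet X w z a (A + \<epsilon> *\<^sub>R mat 1)}"
      using contact_jet[of z a] unfolding A'_def by blast
  qed
  ultimately show ?thesis using negligible_subset by blast
qed

section \<open>Sequences of contact points\<close>

text \<open>At the contact point \<open>x\<close> there is a paraboloid above \<open>u\<close>, and at all nearby points there is one below. So the
gradient satisfies a Lipschitz estimate at \<open>x\<close>.\<close>

lemma grad_tendsto_at_contact_point:
  fixes u :: "real ^ 'n \<Rightarrow> real"
  assumes X: "open X" and R: "0 < R" and k: "0 \<le> k" and u: "lower_paraboloids k (ball x R) u"
    and jet: "upper_contact_jet X u x q A"
    and xs: "xs \<longlonglongrightarrow> x" and diff: "\<And>j. \<exists>p B. has_peano_jet u (xs j) p B"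
  shows "(\<lambda>j. grad u (xs j)) \<longlonglongrightarrow> grad u x"
proof -
  obtain r M where r: "0 < r" "0 \<le> M" "ball x r \<subseteq> X"
    "\<And>y. y \<in> ball x r \<Longrightarrow> u y \<le> u x + q \<bullet> (y - x) + M / 2 * (norm (y - x))\<^sup>2"
    using upper_contact_jet_paraboloid[OF X jet] by blast
  define \<rho> where "\<rho> = min r R"
  have \<rho>: "0 < \<rho>" "\<rho> \<le> r" "\<rho> \<le> R" using r R by (auto simp: \<rho>_def)
  have low: "lower_paraboloids k (ball x \<rho>) u"
    using u by (rule lower_paraboloids_mono) (use \<rho> in auto)
  have "GDERIV u x :> q" by (rule upper_contact_jet_GDERIV[OF X R u jet])
  then have gx: "grad u x = q" by (rule grad_eq)
  have "x \<in> ball x \<rho>" using \<rho> by simp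
  then obtain q' where q': "\<forall>z\<in>ball x \<rho>. u x + q' \<bullet> (z - x) - k / 2 * (norm (z - x))\<^sup>2 \<le> u z"
    using low unfolding lower_paraboloids_def by blast
  have "q = q'"
    by (rule GDERIV_between_paraboloids(1)[where e = \<rho> and y = x and u = u and k = "k / 2" and l = "M / 2"])
       (use q' r(4) \<rho> in auto)
  have bound: "norm (grad u y - grad u x) \<le> (2 * M + k) * norm (y - x)"
    if y: "y \<in> ball x (\<rho> / 2)" "\<exists>p B. has_peano_jet u y p B" for y
  proof (cases "y = x")
    case False
    have yb: "y \<in> ball x \<rho>" using y(1) \<rho>(1) by simp
    then obtain a where a: "\<forall>z\<in>ball x \<rho>. u y + a \<bullet> (z - y) - k / 2 * (norm (z - y))\<^sup>2 \<le> u z"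
      using low unfolding lower_paraboloids_def by blast
    obtain e where e: "e > 0" "ball y e \<subseteq> ball x \<rho>" using openE[OF open_ball yb] by blast
    obtain p B where "has_peano_jet u y p B" using y(2) by blast
    then have "grad u y = a"
      by (rule lower_paraboloid_slope_eq_grad[OF e(1), rotated]) (use a e(2) in blast)
    moreover have "norm (a - q) \<le> (2 * M + k) * norm (y - x)"
    proof (rule contact_gradient_lipschitz[where V = "ball x \<rho>" and w = u])
      show "cball y (norm (y - x)) \<subseteq> ball x \<rho>"
      proof
        fix z assume "z \<in> cball y (norm (y - x))"
        then show "z \<in> ball x \<rho>"
          using y(1) dist_triangle[of x z y] by (simp add: dist_norm norm_minus_commute)
      qed
    qed (use r \<rho> q' \<open>q = q'\<close> a k False in auto)
    ultimately show ?thesis by (simp add: gx)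
  qed simp
  have "\<forall>\<^sub>F j in sequentially. dist (xs j) x < \<rho> / 2" using tendstoD[OF xs, of "\<rho> / 2"] \<rho>(1) by simp
  then have "\<forall>\<^sub>F j in sequentially. norm (grad u (xs j) - grad u x) \<le> (2 * M + k) * norm (xs j - x)"
    by eventually_elim (use bound diff in \<open>auto simp: dist_commute\<close>)
  moreover have "(\<lambda>j. (2 * M + k) * norm (xs j - x)) \<longlonglongrightarrow> 0"
    using xs by (auto intro!: tendsto_eq_intros)
  ultimately have "(\<lambda>j. grad u (xs j) - grad u x) \<longlonglongrightarrow> 0" by (rule Lim_null_comparison)
  then show ?thesis by (simp add: LIM_zero_iff)
qed

text \<open>By polarization, the quadratic form bounds the entries of the matrix.\<close>

lemma symmetric_matrix_norm_bound:
  fixes B :: "real ^ 'n ^ 'n"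
  assumes B: "symmetric_matrix B" and k: "\<And>h. \<bar>(B *v h) \<bullet> h\<bar> \<le> k * (norm h)\<^sup>2"
  shows "norm B \<le> real CARD('n) * real CARD('n) * (2 * k)"
proof -
  have k0: "0 \<le> k"
    using order_trans[OF abs_ge_zero k[of "axis undefined 1"]] by simp
  have entry: "\<bar>B $ i $ j\<bar> \<le> 2 * k" for i j
  proof -
    define a where "a = (axis i 1 :: real ^ 'n)"
    define b where "b = (axis j 1 :: real ^ 'n)"
    have n: "norm a = 1" "norm b = 1" by (simp_all add: a_def b_def)
    have "(B *v b) \<bullet> a = B $ i $ j"
      by (simp add: a_def b_def matrix_vector_mult_basis inner_axis column_def)
    moreover have "4 * ((B *v b) \<bullet> a) = (B *v (b + a)) \<bullet> (b + a) - (B *v (b + - a)) \<bullet> (b + - a)"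
      unfolding quadratic_form_add[OF B]
      using matrix_vector_mult_diff_distrib[of B 0 a] by simp
    moreover have "\<bar>(B *v (b + a)) \<bullet> (b + a)\<bar> \<le> k * 2\<^sup>2"
    proof -
      have "norm (b + a) \<le> 2" using norm_triangle_ineq[of b a] n by simp
      then have "k * (norm (b + a))\<^sup>2 \<le> k * 2\<^sup>2" using k0 by (intro mult_left_mono power_mono) auto
      then show ?thesis using k[of "b + a"] by linarith
    qed
    moreover have "\<bar>(B *v (b + - a)) \<bullet> (b + - a)\<bar> \<le> k * 2\<^sup>2"
    proof -
      have "norm (b + - a) \<le> 2" using norm_triangle_ineq[of b "- a"] n by simp
      then have "k * (norm (b + - a))\<^sup>2 \<le> k * 2\<^sup>2" using k0 by (intro mult_left_mono power_mono) auto
      then show ?thesis using k[of "b + - a"] by linarith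
    qed
    ultimately show ?thesis by (simp add: abs_le_iff)
  qed
  have "norm B \<le> (\<Sum>i\<in>UNIV. norm (B $ i))" unfolding norm_vec_def by (rule L2_set_le_sum) simp
  also have "\<dots> \<le> (\<Sum>i\<in>(UNIV :: 'n set). \<Sum>j\<in>(UNIV :: 'n set). 2 * k)"
    by (intro sum_mono order_trans[OF norm_le_l1_cart] entry)
  also have "\<dots> = real CARD('n) * real CARD('n) * (2 * k)" by simp
  finally show ?thesis .
qed


text \<open>Contact of the sum with the matrix \<open>A + \<epsilon> j I\<close> at \<open>z j\<close> bounds the sum of the Hessians from above, and
semiconvexity bounds each of them from below, so the Hessians of both summands stay in a bounded set. A
convergent subsequence has the required limits as \<open>\<epsilon> j\<close> tends to 0.\<close>

theorem theorem2p16: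
  fixes X :: "(real ^ 'n) set" and u v :: "real ^ 'n \<Rightarrow> real"
    and x p :: "real ^ 'n" and A :: "real ^ 'n ^ 'n"
  assumes "open X"
    and "locally_semiconvex_on X u" and "locally_semiconvex_on X v"
    and "x \<in> X"
    and "upper_contact_jet X (\<lambda>y. u y + v y) x p A"
  shows "(upper_contact_point X u x \<and> upper_contact_point X v x \<and>
          u differentiable (at x) \<and> v differentiable (at x) \<and>
          (\<forall>q B. upper_contact_jet X u x q B \<longrightarrow> q = grad u x) \<and>
          (\<forall>q B. upper_contact_jet X v x q B \<longrightarrow> q = grad v x)) \<and>
         (\<forall>E U. open U \<and> x \<in> U \<and> U - E \<in> null_sets lebesgue \<longrightarrow>
           (\<exists>B C (xs :: nat \<Rightarrow> real ^ 'n).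
              symmetric_matrix B \<and> symmetric_matrix C \<and>
              (\<forall>j. upper_contact_point X (\<lambda>y. u y + v y) (xs j) \<and>
                   xs j \<in> E \<inter> Diff2 X u \<inter> Diff2 X v) \<and>
              xs \<longlonglongrightarrow> x \<and>
              (\<lambda>j. grad u (xs j)) \<longlonglongrightarrow> grad u x \<and>
              (\<lambda>j. grad v (xs j)) \<longlonglongrightarrow> grad v x \<and>
              (\<lambda>j. hess u (xs j)) \<longlonglongrightarrow> B \<and>
              (\<lambda>j. hess v (xs j)) \<longlonglongrightarrow> C \<and>
              B + C \<preceq>\<^sub>L A))"
proof -
  let ?w = "\<lambda>y. u y + v y"
  note X = assms(1) and jet = assms(5)
  obtain Ru ku where Ru: "0 < Ru" "0 \<le> ku" "ball x Ru \<subseteq> X" "lower_paraboloids ku (ball x Ru) u"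
      "continuous_on (ball x Ru) u"
    using locally_semiconvex_imp_lower_paraboloids[OF assms(2,4)] by blast
  obtain Rv kv where Rv: "0 < Rv" "0 \<le> kv" "ball x Rv \<subseteq> X" "lower_paraboloids kv (ball x Rv) v"
      "continuous_on (ball x Rv) v"
    using locally_semiconvex_imp_lower_paraboloids[OF assms(3,4)] by blast
  define R where "R = min Ru Rv"
  define k where "k = max ku kv"
  have R: "0 < R" "ball x R \<subseteq> ball x Ru" "ball x R \<subseteq> ball x Rv" "ball x R \<subseteq> X"
    using Ru(1,3) Rv(1,3) by (auto simp: R_def)
  have k: "0 \<le> k" "ku \<le> k" "kv \<le> k" using Ru(2) by (auto simp: k_def)
  have lu: "lower_paraboloids k (ball x R) u" by (rule lower_paraboloids_mono[OF Ru(4) R(2) k(2)])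
  have lv: "lower_paraboloids k (ball x R) v" by (rule lower_paraboloids_mono[OF Rv(4) R(3) k(3)])
  have lw: "lower_paraboloids (k + k) (ball x R) ?w" by (rule lower_paraboloids_add[OF lu lv])
  have cw: "continuous_on (ball x R) ?w"
    using Ru(5) Rv(5) R by (intro continuous_intros) (auto intro: continuous_on_subset)
  obtain q\<^sub>u where ju: "upper_contact_jet X u x q\<^sub>u (A + k *\<^sub>R mat 1)"
    using upper_contact_jet_summand[OF X jet R(1) lv] by blast
  have "upper_contact_jet X (\<lambda>y. v y + u y) x p A" using jet by (simp add: add.commute)
  then obtain q\<^sub>v where jv: "upper_contact_jet X v x q\<^sub>v (A + k *\<^sub>R mat 1)"
    using upper_contact_jet_summand[OF X _ R(1) lu] by blast
  have slopes: "q = grad f x" if "lower_paraboloids k (ball x R) f" "upper_contact_jet X f x q B" for f q B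
    using grad_eq[OF upper_contact_jet_GDERIV[OF X R(1) that]] by simp
  have diffx: "f differentiable (at x)" if "lower_paraboloids k (ball x R) f" "upper_contact_jet X f x q B" for f q B
    using upper_contact_jet_GDERIV[OF X R(1) that] unfolding gderiv_def by (rule differentiableI)
  have part1: "upper_contact_point X u x \<and> upper_contact_point X v x \<and>
          u differentiable (at x) \<and> v differentiable (at x) \<and>
          (\<forall>q B. upper_contact_jet X u x q B \<longrightarrow> q = grad u x) \<and>
          (\<forall>q B. upper_contact_jet X v x q B \<longrightarrow> q = grad v x)"
    using ju jv slopes lu lv diffx unfolding upper_contact_point_def by blast
  moreover have "\<exists>B C (xs :: nat \<Rightarrow> real ^ 'n).
              symmetric_matrix B \<and> symmetric_matrix C \<and>
              (\<forall>j. upper_contact_point X ?w (xs j) \<and> xs j \<in> E \<inter> Diff2 X u \<inter> Diff2 X v) \<and>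
              xs \<longlonglongrightarrow> x \<and>
              (\<lambda>j. grad u (xs j)) \<longlonglongrightarrow> grad u x \<and>
              (\<lambda>j. grad v (xs j)) \<longlonglongrightarrow> grad v x \<and>
              (\<lambda>j. hess u (xs j)) \<longlonglongrightarrow> B \<and>
              (\<lambda>j. hess v (xs j)) \<longlonglongrightarrow> C \<and>
              B + C \<preceq>\<^sub>L A"
    if U: "open U" "x \<in> U" "U - E \<in> null_sets lebesgue" for E U
  proof -
    obtain Wu where Wu: "open Wu" "x \<in> Wu" "negligible (Wu - Diff2 X u)"
      using locally_semiconvex_Diff2_ae[OF assms(2,4)] by blast
    obtain Wv where Wv: "open Wv" "x \<in> Wv" "negligible (Wv - Diff2 X v)"
      using locally_semiconvex_Diff2_ae[OF assms(3,4)] by blast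
    have "open (U \<inter> Wu \<inter> Wv)" "x \<in> U \<inter> Wu \<inter> Wv" using U Wu Wv by auto
    then obtain r0 where r0: "0 < r0" "ball x r0 \<subseteq> U \<inter> Wu \<inter> Wv" by (rule openE)
    define \<epsilon> where "\<epsilon> j = 1 / real (Suc j)" for j :: nat
    have \<epsilon>: "0 < \<epsilon> j" "\<epsilon> j \<le> 1" for j by (simp_all add: \<epsilon>_def)
    have \<epsilon>0: "\<epsilon> \<longlonglongrightarrow> 0" unfolding \<epsilon>_def by (rule LIMSEQ_Suc[OF lim_1_over_n])
    \<comment> \<open>The contact points near \<open>x\<close> are not negligible, so one of them avoids the three exceptional null sets.\<close>
    have "\<exists>z. z \<in> ball x (min (\<epsilon> j) (min r0 R)) \<and> z \<in> E \<inter> Diff2 X u \<inter> Diff2 X v \<and>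
            (\<exists>a. upper_contact_jet X ?w z a (A + \<epsilon> j *\<^sub>R mat 1))" (is "\<exists>z. ?Q z") for j
    proof (rule ccontr)
      assume none: "\<nexists>z. ?Q z"
      define P where "P = {z \<in> ball x (min (\<epsilon> j) (min r0 R)). \<exists>a. upper_contact_jet X ?w z a (A + \<epsilon> j *\<^sub>R mat 1)}"
      have "\<not> negligible P"
        unfolding P_def
        by (rule jensen_contact_points_not_negligible[OF X R(1,4) _ lw cw jet \<epsilon>(1)])
           (use k r0 R(1) \<epsilon>(1)[of j] in auto)
      moreover have "P \<subseteq> (U - E) \<union> ((Wu - Diff2 X u) \<union> (Wv - Diff2 X v))"
      proof
        fix z assume z: "z \<in> P"
        then have "z \<in> U \<inter> Wu \<inter> Wv" using r0(2) by (auto simp: P_def)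
        moreover have "z \<notin> E \<inter> Diff2 X u \<inter> Diff2 X v" using none z unfolding P_def by blast
        ultimately show "z \<in> (U - E) \<union> ((Wu - Diff2 X u) \<union> (Wv - Diff2 X v))" by blast
      qed
      moreover have "negligible ((U - E) \<union> ((Wu - Diff2 X u) \<union> (Wv - Diff2 X v)))"
        using U(3) Wu(3) Wv(3) by (intro negligible_Un) (auto simp: negligible_iff_null_sets)
      ultimately show False using negligible_subset by blast
    qed
    then obtain z where z: "\<And>j. z j \<in> ball x (min (\<epsilon> j) (min r0 R))"
        "\<And>j. z j \<in> E \<inter> Diff2 X u \<inter> Diff2 X v"
        "\<And>j. \<exists>a. upper_contact_jet X ?w (z j) a (A + \<epsilon> j *\<^sub>R mat 1)"
      by metis
    have zx: "z \<longlonglongrightarrow> x"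
    proof -
      have "dist (z j) x \<le> \<epsilon> j" for j using z(1)[of j] by (simp add: dist_commute)
      then have "\<forall>\<^sub>F j in sequentially. norm (z j - x) \<le> \<epsilon> j" by (simp add: dist_norm)
      then have "(\<lambda>j. z j - x) \<longlonglongrightarrow> 0" using \<epsilon>0 by (rule Lim_null_comparison)
      then show ?thesis by (simp add: LIM_zero_iff)
    qed
    define B where "B j = hess u (z j)" for j
    define C where "C j = hess v (z j)" for j
    have pu: "\<exists>q. has_peano_jet u (z j) q (B j)" and pv: "\<exists>q. has_peano_jet v (z j) q (C j)" for j
    proof -
      have hess_jet: "\<exists>q. has_peano_jet f y q (hess f y)" if "y \<in> Diff2 X f" for f y
      proof -
        obtain q D where jet: "has_peano_jet f y q D" using \<open>y \<in> Diff2 X f\<close> by (auto simp: Diff2_def)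
        then show ?thesis using has_peano_jet_grad_hess(2)[OF jet] by blast
      qed
      show "\<exists>q. has_peano_jet u (z j) q (B j)" "\<exists>q. has_peano_jet v (z j) q (C j)"
        unfolding B_def C_def using hess_jet z(2)[of j] by auto
    qed
    have sym: "symmetric_matrix (B j)" "symmetric_matrix (C j)" for j
      using pu[of j] pv[of j] by (auto simp: has_peano_jet_def)
    have up: "((B j + C j) *v h) \<bullet> h \<le> (A *v h) \<bullet> h + \<epsilon> j * (norm h)\<^sup>2" for j h
    proof -
      obtain q q' where "has_peano_jet u (z j) q (B j)" "has_peano_jet v (z j) q' (C j)" using pu pv by blast
      then have pw: "has_peano_jet ?w (z j) (q + q') (B j + C j)" by (rule has_peano_jet_add)
      obtain a e where "e > 0" "\<forall>y\<in>ball (z j) e. ?w y \<le> ?w (z j) + a \<bullet> (y - z j)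
            + 1 / 2 * (((A + \<epsilon> j *\<^sub>R mat 1) *v (y - z j)) \<bullet> (y - z j))"
        using z(3)[of j] unfolding upper_contact_jet_iff_ball[OF X] by blast
      then have "((B j + C j) *v h) \<bullet> h \<le> ((A + \<epsilon> j *\<^sub>R mat 1) *v h) \<bullet> h"
        using has_peano_jet_hessian_le[OF pw] by blast
      then show ?thesis
        by (simp add: matrix_vector_mult_add_rdistrib scaleR_mat_vector_mult inner_add_left power2_norm_eq_inner)
    qed
    have low: "- k * (norm h)\<^sup>2 \<le> (D *v h) \<bullet> h"
      if f: "lower_paraboloids k (ball x R) f" "has_peano_jet f (z j) q D" for f q D j h
    proof -
      have zR: "z j \<in> ball x R" using z(1)[of j] by simp
      obtain e where e: "e > 0" "ball (z j) e \<subseteq> ball x R" using openE[OF open_ball zR] by blast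
      obtain a where a: "\<forall>y\<in>ball x R. f (z j) + a \<bullet> (y - z j) - k / 2 * (norm (y - z j))\<^sup>2 \<le> f y"
        using f(1) zR unfolding lower_paraboloids_def by blast
      show ?thesis by (rule has_peano_jet_hessian_ge[OF f(2) e(1)]) (use a e(2) in blast)
    qed
    have lowB: "- k * (norm h)\<^sup>2 \<le> (B j *v h) \<bullet> h" and lowC: "- k * (norm h)\<^sup>2 \<le> (C j *v h) \<bullet> h" for j h
      using low lu lv pu pv by blast+
    obtain M where M: "0 \<le> M" "\<And>h. norm (A *v h) \<le> M * norm h" using norm_matrix_vector_bound[of A] by blast
    define m where "m = M + 1 + k"
    have form_bound: "\<bar>(B j *v h) \<bullet> h\<bar> \<le> m * (norm h)\<^sup>2" "\<bar>(C j *v h) \<bullet> h\<bar> \<le> m * (norm h)\<^sup>2" for j h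
    proof -
      have "\<epsilon> j * (norm h)\<^sup>2 \<le> 1 * (norm h)\<^sup>2" using \<epsilon> by (intro mult_right_mono) auto
      moreover have "(A *v h) \<bullet> h \<le> M * (norm h)\<^sup>2" by (rule quadratic_form_bound[OF M(2)])
      ultimately have s: "(B j *v h) \<bullet> h + (C j *v h) \<bullet> h \<le> (M + 1) * (norm h)\<^sup>2"
        using up[of j h] by (simp add: matrix_vector_mult_add_rdistrib inner_add_left algebra_simps)
      have t: "m * (norm h)\<^sup>2 = (M + 1) * (norm h)\<^sup>2 + k * (norm h)\<^sup>2" by (simp add: m_def algebra_simps)
      have "0 \<le> (M + 1) * (norm h)\<^sup>2" "0 \<le> k * (norm h)\<^sup>2" using M k by auto
      then show "\<bar>(B j *v h) \<bullet> h\<bar> \<le> m * (norm h)\<^sup>2" "\<bar>(C j *v h) \<bullet> h\<bar> \<le> m * (norm h)\<^sup>2"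
        using s t lowB[of h j] lowC[of h j] by (auto simp: abs_le_iff)
    qed
    define b where "b = real CARD('n) * real CARD('n) * (2 * m)"
    have "norm (B j) \<le> b" "norm (C j) \<le> b" for j
      unfolding b_def using symmetric_matrix_norm_bound[OF sym(1)] symmetric_matrix_norm_bound[OF sym(2)] form_bound by auto
    then have "norm (B j, C j) \<le> b + b" for j
      using norm_Pair_le[of "B j" "C j"] by (meson add_mono order_trans)
    then have "bounded (range (\<lambda>j. (B j, C j)))" by (auto intro: boundedI)
    then obtain L r where r: "strict_mono (r :: nat \<Rightarrow> nat)" "((\<lambda>j. (B j, C j)) \<circ> r) \<longlonglongrightarrow> L"
      using bounded_imp_convergent_subsequence by blast
    define xs where "xs j = z (r j)" for j
    have B: "(\<lambda>j. B (r j)) \<longlonglongrightarrow> fst L" and C: "(\<lambda>j. C (r j)) \<longlonglongrightarrow> snd L"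
      using tendsto_fst[OF r(2)] tendsto_snd[OF r(2)] by (simp_all add: o_def)
    have xs: "xs \<longlonglongrightarrow> x" unfolding xs_def using LIMSEQ_subseq_LIMSEQ[OF zx r(1)] by (simp add: o_def)
    have sym_limit: "symmetric_matrix D" if "D' \<longlonglongrightarrow> D" "\<And>j. symmetric_matrix (D' j)" for D' and D :: "real ^ 'n ^ 'n"
    proof -
      have "D $ i $ l = D $ l $ i" for i l
      proof (rule LIMSEQ_unique)
        show "(\<lambda>j. D' j $ i $ l) \<longlonglongrightarrow> D $ i $ l" by (intro tendsto_vec_nth that)
        have "D' j $ i $ l = D' j $ l $ i" for j
        proof -
          have "transpose (D' j) $ i $ l = D' j $ l $ i" by (simp add: transpose_def)
          then show ?thesis using that(2)[of j] unfolding symmetric_matrix_def by simp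
        qed
        then have "(\<lambda>j. D' j $ i $ l) = (\<lambda>j. D' j $ l $ i)" by (rule ext)
        moreover have "(\<lambda>j. D' j $ l $ i) \<longlonglongrightarrow> D $ l $ i" by (intro tendsto_vec_nth that)
        ultimately show "(\<lambda>j. D' j $ i $ l) \<longlonglongrightarrow> D $ l $ i" by (simp only:)
      qed
      then show ?thesis by (simp add: symmetric_matrix_def transpose_def vec_eq_iff)
    qed
    have "fst L + snd L \<preceq>\<^sub>L A"
      unfolding loewner_le_def
    proof
      fix h
      have "linear (\<lambda>D :: real ^ 'n ^ 'n. (D *v h) \<bullet> h)"
        by (rule linearI) (simp_all add: matrix_vector_mult_add_rdistrib inner_add_left scaleR_matrix_vector_assoc[symmetric])
      then have "bounded_linear (\<lambda>D :: real ^ 'n ^ 'n. (D *v h) \<bullet> h)" by (simp add: linear_conv_bounded_linear)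
      then have "(\<lambda>j. ((B (r j) + C (r j)) *v h) \<bullet> h) \<longlonglongrightarrow> ((fst L + snd L) *v h) \<bullet> h"
        by (rule bounded_linear.tendsto) (intro tendsto_add B C)
      moreover have "(\<lambda>j. (A *v h) \<bullet> h + \<epsilon> (r j) * (norm h)\<^sup>2) \<longlonglongrightarrow> (A *v h) \<bullet> h + 0 * (norm h)\<^sup>2"
        using LIMSEQ_subseq_LIMSEQ[OF \<epsilon>0 r(1)] by (intro tendsto_intros) (simp add: o_def)
      ultimately have "((fst L + snd L) *v h) \<bullet> h \<le> (A *v h) \<bullet> h + 0 * (norm h)\<^sup>2"
        by (rule LIMSEQ_le) (use up in blast)
      then show "((fst L + snd L) *v h) \<bullet> h \<le> (A *v h) \<bullet> h" by simp
    qed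
    moreover have "symmetric_matrix (fst L)" "symmetric_matrix (snd L)"
      using sym_limit[OF B] sym_limit[OF C] sym by auto
    moreover have "\<forall>j. upper_contact_point X ?w (xs j) \<and> xs j \<in> E \<inter> Diff2 X u \<inter> Diff2 X v"
      unfolding xs_def upper_contact_point_def using z(2,3) by blast
    moreover have "(\<lambda>j. grad u (xs j)) \<longlonglongrightarrow> grad u x"
      by (rule grad_tendsto_at_contact_point[OF X R(1) k(1) lu ju xs]) (unfold xs_def, use pu in blast)
    moreover have "(\<lambda>j. grad v (xs j)) \<longlonglongrightarrow> grad v x"
      by (rule grad_tendsto_at_contact_point[OF X R(1) k(1) lv jv xs]) (unfold xs_def, use pv in blast)
    moreover have "(\<lambda>j. hess u (xs j)) \<longlonglongrightarrow> fst L" "(\<lambda>j. hess v (xs j)) \<longlonglongrightarrow> snd L"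
      using B C by (simp_all add: B_def C_def xs_def)
    ultimately show ?thesis using xs by blast
  qed
  ultimately show ?thesis by blast
qed

end
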